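(* Every nonsingular mixed identity (with constants in $G$) of the simple groups $G=\mathrm{Alt}_n$ or $G={}^a\mathbf G(q)'$ for ${}^a\mathbf G\in\{A_n,B_n,C_n,D_n,{}^2A_n,{}^2D_n\}$, with $q$ a prime power, is of length $$\Omega\left(\frac{\log n}{\log\log n}\right),$$ i.e. there are absolute constants $c>0$ and $N$ (independent of $q$) such that for $n\ge N$ every such identity has length at least $c\,\frac{\log n}{\log\log n}$.
   Context: Mixed identities. Let $\mathbf F_r$ be the free group on $x_1,\dots,x_r$ ($r\geq 1$ arbitrary). Every $w\in G*\mathbf F_r$ has a reduced form $w=c_0x_{i(1)}^{\varepsilon(1)}c_1\cdots c_{l-1}x_{i(l)}^{\varepsilon(l)}c_l$ with $c_j\in G$, $\varepsilon(j)\in\{\pm1\}$, where $c_j\ne 1$ whenever $i(j)=i(j+1)$ and $\varepsilon(j)=-\varepsilon(j+1)$ ($1\le j\le l-1$); its length is $|w|=l$. $w$ is a mixed identity for $G$ if $w\neq1$ and $w(g_1,\dots,g_r)=1$ for all $(g_1,\dots,g_r)\in G^r$. The content of $w$ is $x_{i(1)}^{\varepsilon(1)}\cdots x_{i(l)}^{\varepsilon(l)}\in\mathbf F_r$ (all constants deleted); $w$ is nonsingular if its content is nontrivial. The groups ${}^a\mathbf G(q)'$ are the finite simple classical groups of Lie rank parameter $n$: $A_n$: $\mathrm{PSL}_{n+1}$; ${}^2A_n$: $\mathrm{PSU}_{n+1}$; $B_n$: $\mathrm P\Omega_{2n+1}$; $C_n$: $\mathrm{PSp}_{2n}$; $D_n$: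 $\mathrm P\Omega^+_{2n}$; ${}^2D_n$: $\mathrm P\Omega^-_{2n}$, over finite fields. *)

theory Defs
  imports
    "HOL-Algebra.Sym_Groups"
    "HOL-Algebra.Elementary_Groups"
    "HOL-Number_Theory.Prime_Powers"
    "Jordan_Normal_Form.Matrix"
begin

section \<open>The free product of a group with a free group\<close>

text \<open>
  A letter \<^term>\<open>(i, True)\<close> is the generator $x_i$ and \<^term>\<open>(i, False)\<close> is its inverse; the
  generators of the free group of rank $r$ are numbered $0, \dots, r-1$.  The pair
  \<open>(c\<^sub>0, [(y\<^sub>1, c\<^sub>1), \<dots>, (y\<^sub>l, c\<^sub>l)])\<close> stands for the product
  \<open>c\<^sub>0 y\<^sub>1 c\<^sub>1 \<dots> y\<^sub>l c\<^sub>l\<close>.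
\<close>

type_synonym letter = "nat \<times> bool"
type_synonym 'a mixed_word = "'a \<times> (letter \<times> 'a) list"

definition inv_letter :: "letter \<Rightarrow> letter" where
  "inv_letter x = (fst x, \<not> snd x)"

definition reduced_words :: "('a, 'b) monoid_scheme \<Rightarrow> nat \<Rightarrow> 'a mixed_word set" where
  "reduced_words G r = {(c, ys). c \<in> carrier G
     \<and> (\<forall>(y, d) \<in> set ys. fst y < r \<and> d \<in> carrier G)
     \<and> successively (\<lambda>(x, d) (y, e). y = inv_letter x \<longrightarrow> d \<noteq> \<one>\<^bsub>G\<^esub>) ys}"

text \<open>Left multiplication of a reduced word by a constant and by a letter.\<close>

definition const_act :: "('a, 'b) monoid_scheme \<Rightarrow> 'a \<Rightarrow> 'a mixed_word \<Rightarrow> 'a mixed_word" where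
  "const_act G c w = (c \<otimes>\<^bsub>G\<^esub> fst w, snd w)"

fun letter_act :: "('a, 'b) monoid_scheme \<Rightarrow> letter \<Rightarrow> 'a mixed_word \<Rightarrow> 'a mixed_word" where
  "letter_act G x (d, []) = (\<one>\<^bsub>G\<^esub>, [(x, d)])"
| "letter_act G x (d, (y, e) # ys) =
     (if d = \<one>\<^bsub>G\<^esub> \<and> y = inv_letter x then (e, ys) else (\<one>\<^bsub>G\<^esub>, (x, d) # (y, e) # ys))"

definition word_act :: "('a, 'b) monoid_scheme \<Rightarrow> 'a mixed_word \<Rightarrow> 'a mixed_word \<Rightarrow> 'a mixed_word" where
  "word_act G w v =
     const_act G (fst w) (foldr (\<lambda>(x, d) u. letter_act G x (const_act G d u)) (snd w) v)"

text \<open>$G * \mathbf{F}_r$, realised on its reduced forms.\<close>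

definition free_prod :: "('a, 'b) monoid_scheme \<Rightarrow> nat \<Rightarrow> 'a mixed_word monoid" where
  "free_prod G r = \<lparr>carrier = reduced_words G r, mult = word_act G, one = (\<one>\<^bsub>G\<^esub>, [])\<rparr>"

text \<open>$\mathbf{F}_r$ is the free product of the trivial group with $\mathbf{F}_r$.\<close>

abbreviation free_grp :: "nat \<Rightarrow> unit mixed_word monoid" where
  "free_grp r \<equiv> free_prod (singleton_group ()) r"

definition word_length :: "'a mixed_word \<Rightarrow> nat" where
  "word_length w = length (snd w)"

text \<open>Deleting the constants can create cancellations; the content is the resulting element of the
  free group, that is, the product of the letters of \<open>w\<close> there.\<close>

definition content :: "'a mixed_word \<Rightarrow> unit mixed_word" where
  "content w = foldr (letter_act (singleton_group ())) (map fst (snd w)) ((), [])"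

definition letter_val :: "('a, 'b) monoid_scheme \<Rightarrow> (nat \<Rightarrow> 'a) \<Rightarrow> letter \<Rightarrow> 'a" where
  "letter_val G g x = (if snd x then g (fst x) else inv\<^bsub>G\<^esub> g (fst x))"

definition word_val :: "('a, 'b) monoid_scheme \<Rightarrow> (nat \<Rightarrow> 'a) \<Rightarrow> 'a mixed_word \<Rightarrow> 'a" where
  "word_val G g w = fst w \<otimes>\<^bsub>G\<^esub>
     foldr (\<lambda>(x, d) h. letter_val G g x \<otimes>\<^bsub>G\<^esub> (d \<otimes>\<^bsub>G\<^esub> h)) (snd w) \<one>\<^bsub>G\<^esub>"

definition mixed_identity :: "('a, 'b) monoid_scheme \<Rightarrow> nat \<Rightarrow> 'a mixed_word \<Rightarrow> bool" where
  "mixed_identity G r w \<longleftrightarrow> w \<in> carrier (free_prod G r) \<and> w \<noteq> \<one>\<^bsub>free_prod G r\<^esub>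
     \<and> (\<forall>g \<in> {..<r} \<rightarrow> carrier G. word_val G g w = \<one>\<^bsub>G\<^esub>)"

definition nonsingular :: "nat \<Rightarrow> 'a mixed_word \<Rightarrow> bool" where
  "nonsingular r w \<longleftrightarrow> content w \<noteq> \<one>\<^bsub>free_grp r\<^esub>"

subsection \<open>The free product is a group, and evaluation and content are homomorphisms\<close>

lemma inv_letter_simps [simp]:
  "inv_letter (inv_letter x) = x" "fst (inv_letter x) = fst x" "inv_letter x \<noteq> x"
  by (auto simp: inv_letter_def prod_eq_iff)

lemma reduced_wordsD:
  assumes "w \<in> reduced_words G r"
  shows "fst w \<in> carrier G" "\<forall>(y, d) \<in> set (snd w). fst y < r \<and> d \<in> carrier G"
  using assms by (cases w; simp add: reduced_words_def case_prod_beta)+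

context group
begin

lemma const_act_closed:
  "c \<in> carrier G \<Longrightarrow> w \<in> reduced_words G r \<Longrightarrow> const_act G c w \<in> reduced_words G r"
  by (cases w) (simp add: const_act_def reduced_words_def)

lemma letter_act_closed:
  assumes "fst x < r" "w \<in> reduced_words G r"
  shows "letter_act G x w \<in> reduced_words G r"
  using assms
  by (cases "(G, x, w)" rule: letter_act.cases)
    (auto simp: reduced_words_def successively_Cons)

lemma const_act_mult:
  "a \<in> carrier G \<Longrightarrow> b \<in> carrier G \<Longrightarrow> w \<in> reduced_words G r
    \<Longrightarrow> const_act G (a \<otimes> b) w = const_act G a (const_act G b w)"
  by (auto simp: const_act_def reduced_words_def m_assoc)

lemma const_act_one: "w \<in> reduced_words G r \<Longrightarrow> const_act G \<one> w = w"
  by (auto simp: const_act_def reduced_words_def)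

lemma letter_act_cancel:
  assumes "w \<in> reduced_words G r"
  shows "letter_act G x (letter_act G (inv_letter x) w) = w"
proof (cases w)
  case (Pair d ys)
  show ?thesis
  proof (cases ys)
    case Nil
    then show ?thesis using Pair by simp
  next
    case (Cons z zs)
    obtain y e where z: "z = (y, e)" by (cases z)
    show ?thesis
    proof (cases "d = \<one> \<and> y = x")
      case True
      show ?thesis
        using True Pair Cons z assms
        by (cases zs) (auto simp: reduced_words_def successively_Cons)
    next
      case False
      then show ?thesis using Pair Cons z by auto
    qed
  qed
qed

lemma foldr_act_closed:
  assumes "\<forall>(y, d) \<in> set ys. fst y < r \<and> d \<in> carrier G" "v \<in> reduced_words G r"
  shows "foldr (\<lambda>(x, d) u. letter_act G x (const_act G d u)) ys v \<in> reduced_words G r"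
  using assms
  by (induction ys) (auto intro!: letter_act_closed const_act_closed)

lemma word_act_closed:
  assumes "w \<in> reduced_words G r" "v \<in> reduced_words G r"
  shows "word_act G w v \<in> reduced_words G r"
  unfolding word_act_def
  using assms by (intro const_act_closed foldr_act_closed) (simp_all add: reduced_wordsD)

lemma word_act_const_act:
  assumes "c \<in> carrier G" "w \<in> reduced_words G r" "v \<in> reduced_words G r"
  shows "word_act G (const_act G c w) v = const_act G c (word_act G w v)"
proof -
  have "foldr (\<lambda>(x, d) u. letter_act G x (const_act G d u)) (snd w) v \<in> reduced_words G r"
    using assms by (intro foldr_act_closed) (simp_all add: reduced_wordsD)
  moreover have "fst w \<in> carrier G" using assms by (auto simp: reduced_words_def)
  ultimately show ?thesis
    using assms const_act_mult[of c "fst w"]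
    unfolding word_act_def by (simp add: const_act_def)
qed

lemma word_act_letter_act:
  assumes "fst x < r" "w \<in> reduced_words G r" "v \<in> reduced_words G r"
  shows "word_act G (letter_act G x w) v = letter_act G x (word_act G w v)"
proof -
  obtain d ys where w: "w = (d, ys)" by (cases w)
  let ?f = "foldr (\<lambda>(x, d) u. letter_act G x (const_act G d u))"
  have ys: "\<forall>(y, d) \<in> set ys. fst y < r \<and> d \<in> carrier G" and d: "d \<in> carrier G"
    using reduced_wordsD[OF assms(2)] by (simp_all add: w)
  have *: "word_act G (\<one>, (x, d) # ys) v = letter_act G x (word_act G w v)"
    unfolding word_act_def w
    using ys d assms
    by (simp add: const_act_one[OF letter_act_closed[OF _ const_act_closed[OF _ foldr_act_closed]]])
  show ?thesis
  proof (cases "\<exists>e zs. ys = (inv_letter x, e) # zs \<and> d = \<one>")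
    case False
    then have "letter_act G x w = (\<one>, (x, d) # ys)"
      by (cases ys) (auto simp: w)
    then show ?thesis using * by simp
  next
    case True
    then obtain e zs where ez: "ys = (inv_letter x, e) # zs" "d = \<one>" by auto
    have zs: "\<forall>(y, d) \<in> set zs. fst y < r \<and> d \<in> carrier G" and e: "e \<in> carrier G"
      using ys ez by auto
    let ?u = "const_act G e (?f zs v)"
    have u: "?u \<in> reduced_words G r"
      using zs e assms by (intro const_act_closed foldr_act_closed)
    have "word_act G w v = letter_act G (inv_letter x) ?u"
      using u assms(1) letter_act_closed[of "inv_letter x" r ?u]
      unfolding word_act_def w ez by (simp add: const_act_one)
    moreover have "word_act G (letter_act G x w) v = ?u"
      by (simp add: w ez word_act_def)
    ultimately show ?thesis using letter_act_cancel[OF u] by simp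
  qed
qed

lemma reduced_words_induct [consumes 1, case_names one const letter]:
  assumes "w \<in> reduced_words G r"
    and one: "P (\<one>, [])"
    and const: "\<And>c w. c \<in> carrier G \<Longrightarrow> w \<in> reduced_words G r \<Longrightarrow> P w \<Longrightarrow> P (const_act G c w)"
    and letter: "\<And>x w. fst x < r \<Longrightarrow> w \<in> reduced_words G r \<Longrightarrow> P w \<Longrightarrow> P (letter_act G x w)"
  shows "P w"
proof -
  have "P (c, ys)" if "(c, ys) \<in> reduced_words G r" for c ys
    using that
  proof (induction ys arbitrary: c)
    case Nil
    then show ?case
      using const[of c "(\<one>, [])"] one by (auto simp: const_act_def reduced_words_def)
  next
    case (Cons z zs)
    obtain x d where z: "z = (x, d)" by (cases z)
    have red: "(d, zs) \<in> reduced_words G r" "fst x < r" "c \<in> carrier G"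
      using Cons.prems z by (auto simp: reduced_words_def successively_Cons)
    have "letter_act G x (d, zs) = (\<one>, (x, d) # zs)"
      using Cons.prems z by (cases zs) (auto simp: reduced_words_def successively_Cons)
    moreover have "P (const_act G c (letter_act G x (d, zs)))"
      using red Cons.IH by (intro const letter letter_act_closed) auto
    ultimately show ?case using red z by (simp add: const_act_def)
  qed
  then show ?thesis using assms(1) by (cases w) auto
qed

lemma one_reduced: "(\<one>, []) \<in> reduced_words G r"
  by (simp add: reduced_words_def)

lemma word_act_one: "w \<in> reduced_words G r \<Longrightarrow> word_act G (\<one>, []) w = w"
  by (simp add: word_act_def const_act_one)

lemma word_act_assoc:
  assumes "u \<in> reduced_words G r" "v \<in> reduced_words G r" "w \<in> reduced_words G r"
  shows "word_act G (word_act G u v) w = word_act G u (word_act G v w)"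
  using assms(1)
proof (induction u rule: reduced_words_induct)
  case one
  show ?case using assms by (simp add: word_act_one[where r = r] word_act_closed)
next
  case (const c u)
  then show ?case using assms by (simp add: word_act_const_act[where r = r] word_act_closed)
next
  case (letter x u)
  then show ?case using assms by (simp add: word_act_letter_act[where r = r] word_act_closed)
qed

lemma word_act_left_inverse:
  assumes "w \<in> reduced_words G r"
  shows "\<exists>v \<in> reduced_words G r. word_act G v w = (\<one>, [])"
  using assms
proof (induction w rule: reduced_words_induct)
  case one
  show ?case using one_reduced word_act_one by blast
next
  case (const c w)
  then obtain v where v: "v \<in> reduced_words G r" "word_act G v w = (\<one>, [])" by auto
  let ?c = "const_act G (inv c) (\<one>, [])"
  have c: "?c \<in> reduced_words G r"
    using const by (intro const_act_closed one_reduced) auto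
  have "word_act G ?c (const_act G c w) = w"
    using const
    by (simp add: word_act_const_act[OF _ one_reduced const_act_closed] const_act_closed
        word_act_one[where r = r] const_act_mult[where r = r, symmetric] const_act_one[where r = r])
  then have "word_act G (word_act G v ?c) (const_act G c w) = (\<one>, [])"
    using v c const by (simp add: word_act_assoc const_act_closed)
  then show ?case using v c word_act_closed by blast
next
  case (letter x w)
  then obtain v where v: "v \<in> reduced_words G r" "word_act G v w = (\<one>, [])" by auto
  let ?x = "letter_act G (inv_letter x) (\<one>, [])"
  have x: "?x \<in> reduced_words G r"
    using letter by (intro letter_act_closed one_reduced) auto
  have "word_act G ?x (letter_act G x w) = w"
    using letter letter_act_cancel[of w r "inv_letter x"]
    by (subst word_act_letter_act[where r = r])
      (auto simp: one_reduced letter_act_closed word_act_one[where r = r] simp del: letter_act.simps)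
  then have "word_act G (word_act G v ?x) (letter_act G x w) = (\<one>, [])"
    using v x letter by (simp add: word_act_assoc letter_act_closed del: letter_act.simps)
  then show ?case using v x word_act_closed by blast
qed

theorem group_free_prod: "group (free_prod G r)"
  by (rule groupI)
    (auto simp: free_prod_def word_act_closed one_reduced word_act_assoc word_act_one
      dest: word_act_left_inverse)

lemma letter_val_closed:
  "g \<in> {..<r} \<rightarrow> carrier G \<Longrightarrow> fst x < r \<Longrightarrow> letter_val G g x \<in> carrier G"
  by (auto simp: letter_val_def)

lemma word_val_foldr_closed:
  assumes "g \<in> {..<r} \<rightarrow> carrier G" "\<forall>(y, d) \<in> set ys. fst y < r \<and> d \<in> carrier G"
  shows "foldr (\<lambda>(x, d) h. letter_val G g x \<otimes> (d \<otimes> h)) ys \<one> \<in> carrier G"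
  using assms(2) by (induction ys) (auto intro!: m_closed letter_val_closed[OF assms(1)])

lemma word_val_closed:
  assumes "g \<in> {..<r} \<rightarrow> carrier G" "w \<in> reduced_words G r"
  shows "word_val G g w \<in> carrier G"
  using assms unfolding word_val_def
  by (intro m_closed word_val_foldr_closed) (use reduced_wordsD in blast)+

lemma word_val_const_act:
  assumes "g \<in> {..<r} \<rightarrow> carrier G" "c \<in> carrier G" "w \<in> reduced_words G r"
  shows "word_val G g (const_act G c w) = c \<otimes> word_val G g w"
proof -
  have "fst w \<in> carrier G" "\<forall>(y, d) \<in> set (snd w). fst y < r \<and> d \<in> carrier G"
    using reduced_wordsD[OF assms(3)] by auto
  then show ?thesis
    using assms word_val_foldr_closed[OF assms(1), of "snd w"]
    by (simp add: word_val_def const_act_def m_assoc)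
qed

lemma letter_val_inv:
  assumes "g \<in> {..<r} \<rightarrow> carrier G" "fst x < r"
  shows "letter_val G g x \<otimes> letter_val G g (inv_letter x) = \<one>"
proof -
  have "g (fst x) \<in> carrier G" using assms by auto
  then show ?thesis by (simp add: letter_val_def inv_letter_def)
qed

lemma word_val_letter_act:
  assumes g: "g \<in> {..<r} \<rightarrow> carrier G" and x: "fst x < r" and w: "w \<in> reduced_words G r"
  shows "word_val G g (letter_act G x w) = letter_val G g x \<otimes> word_val G g w"
proof -
  obtain d ys where dy: "w = (d, ys)" by (cases w)
  let ?f = "foldr (\<lambda>(x, d) h. letter_val G g x \<otimes> (d \<otimes> h))"
  have ys: "\<forall>(y, d) \<in> set ys. fst y < r \<and> d \<in> carrier G" and d: "d \<in> carrier G"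
    using reduced_wordsD[OF w] by (simp_all add: dy)
  note cl = word_val_foldr_closed[OF g ys] letter_val_closed[OF g x]
  show ?thesis
  proof (cases "\<exists>e zs. ys = (inv_letter x, e) # zs \<and> d = \<one>")
    case False
    then have "letter_act G x w = (\<one>, (x, d) # ys)"
      by (cases ys) (auto simp: dy)
    then show ?thesis using cl d by (simp add: word_val_def dy)
  next
    case True
    then obtain e zs where ez: "ys = (inv_letter x, e) # zs" "d = \<one>" by auto
    have e: "e \<otimes> ?f zs \<one> \<in> carrier G"
      using ys ez by (auto intro!: m_closed word_val_foldr_closed[OF g])
    moreover have "letter_val G g (inv_letter x) \<in> carrier G"
      using x by (intro letter_val_closed[OF g]) auto
    ultimately show ?thesis
      using cl(2) letter_val_inv[OF g x]
      by (simp add: word_val_def dy ez m_assoc[symmetric])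
  qed
qed

theorem word_val_hom:
  assumes g: "g \<in> {..<r} \<rightarrow> carrier G"
  shows "word_val G g \<in> hom (free_prod G r) G"
proof (rule homI)
  fix u v assume uv: "u \<in> carrier (free_prod G r)" "v \<in> carrier (free_prod G r)"
  then have "u \<in> reduced_words G r" and v: "v \<in> reduced_words G r" by (auto simp: free_prod_def)
  then have "word_val G g (word_act G u v) = word_val G g u \<otimes> word_val G g v"
  proof (induction u rule: reduced_words_induct)
    case one
    show ?case
      using v word_val_closed[OF g v] by (simp add: word_act_one) (simp add: word_val_def)
  next
    case (const c u)
    then show ?case
      using v word_val_closed[OF g] 
      by (simp add: word_act_const_act[where r = r] word_val_const_act[OF g] word_act_closed m_assoc)
  next
    case (letter x u)
    then show ?case
      using v word_val_closed[OF g] letter_val_closed[OF g]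
      by (simp add: word_act_letter_act[where r = r] word_val_letter_act[OF g] word_act_closed m_assoc)
  qed
  then show "word_val G g (u \<otimes>\<^bsub>free_prod G r\<^esub> v) = word_val G g u \<otimes> word_val G g v"
    by (simp add: free_prod_def)
qed (use g in \<open>auto simp: free_prod_def word_val_closed\<close>)

lemma content_closed:
  assumes "w \<in> reduced_words G r"
  shows "content w \<in> reduced_words (singleton_group ()) r"
proof -
  interpret S: group "singleton_group ()" by simp
  have "foldr (letter_act (singleton_group ())) xs ((), []) \<in> reduced_words (singleton_group ()) r"
    if "\<forall>x \<in> set xs. fst x < r" for xs
    using that S.one_reduced[of r] by (induction xs) (auto intro: S.letter_act_closed)
  moreover have "\<forall>x \<in> set (map fst (snd w)). fst x < r"
    using reduced_wordsD(2)[OF assms] by auto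
  ultimately show ?thesis unfolding content_def by blast
qed

lemma content_const_act [simp]: "content (const_act G c w) = content w"
  by (simp add: content_def const_act_def)

lemma content_letter_act:
  assumes x: "fst x < r" and w: "w \<in> reduced_words G r"
  shows "content (letter_act G x w) = letter_act (singleton_group ()) x (content w)"
proof -
  interpret S: group "singleton_group ()" by simp
  obtain d ys where dy: "w = (d, ys)" by (cases w)
  show ?thesis
  proof (cases "\<exists>e zs. ys = (inv_letter x, e) # zs \<and> d = \<one>")
    case False
    then have "letter_act G x w = (\<one>, (x, d) # ys)"
      by (cases ys) (auto simp: dy)
    then show ?thesis by (simp add: content_def dy)
  next
    case True
    then obtain e zs where ez: "ys = (inv_letter x, e) # zs" "d = \<one>" by auto
    have "(e, zs) \<in> reduced_words G r"
      using w by (auto simp: dy ez reduced_words_def successively_Cons)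
    then have "content (e, zs) \<in> reduced_words (singleton_group ()) r"
      by (rule content_closed)
    from S.letter_act_cancel[OF this, of x] show ?thesis
      by (simp add: dy ez content_def)
  qed
qed

theorem content_hom: "content \<in> hom (free_prod G r) (free_grp r)"
proof (rule homI)
  interpret S: group "singleton_group ()" by simp
  fix u v assume uv: "u \<in> carrier (free_prod G r)" "v \<in> carrier (free_prod G r)"
  then have "u \<in> reduced_words G r" and v: "v \<in> reduced_words G r" by (auto simp: free_prod_def)
  then have "content (word_act G u v) = word_act (singleton_group ()) (content u) (content v)"
  proof (induction u rule: reduced_words_induct)
    case one
    show ?case
      using v S.word_act_one[OF content_closed[OF v]]
      by (simp add: word_act_one) (simp add: content_def singleton_group_def)
  next
    case (const c u)
    then show ?case using v by (simp add: word_act_const_act)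
  next
    case (letter x u)
    then show ?case
      using v
      by (simp add: word_act_letter_act content_letter_act word_act_closed
          S.word_act_letter_act[OF _ content_closed content_closed])
  qed
  then show "content (u \<otimes>\<^bsub>free_prod G r\<^esub> v) = content u \<otimes>\<^bsub>free_grp r\<^esub> content v"
    by (simp add: free_prod_def)
qed (auto simp: free_prod_def content_closed)

end

section \<open>Classical groups\<close>

text \<open>
  Matrices and vectors over a ring record; indices start at 0.  The type-class based operations on
  \<^typ>\<open>'a mat\<close> are not used, since the field has to vary within one formula.
\<close>

definition mat_monoid :: "('f, 'b) ring_scheme \<Rightarrow> nat \<Rightarrow> 'f mat monoid" where
  "mat_monoid F m =
     \<lparr>carrier = {A \<in> carrier_mat m m. \<forall>i<m. \<forall>j<m. A $$ (i, j) \<in> carrier F},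
      mult = (\<lambda>A B. mat m m (\<lambda>(i, j). \<Oplus>\<^bsub>F\<^esub>k\<in>{..<m}. A $$ (i, k) \<otimes>\<^bsub>F\<^esub> B $$ (k, j))),
      one = mat m m (\<lambda>(i, j). if i = j then \<one>\<^bsub>F\<^esub> else \<zero>\<^bsub>F\<^esub>)\<rparr>"

definition GL :: "('f, 'b) ring_scheme \<Rightarrow> nat \<Rightarrow> 'f mat monoid" where
  "GL F m = units_of (mat_monoid F m)"

definition ring_det :: "('f, 'b) ring_scheme \<Rightarrow> nat \<Rightarrow> 'f mat \<Rightarrow> 'f" where
  "ring_det F m A = (\<Oplus>\<^bsub>F\<^esub>p\<in>{p. p permutes {..<m}}.
     let t = (\<Otimes>\<^bsub>F\<^esub>i\<in>{..<m}. A $$ (i, p i)) in if evenperm p then t else \<ominus>\<^bsub>F\<^esub> t)"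

definition vecs :: "('f, 'b) ring_scheme \<Rightarrow> nat \<Rightarrow> 'f vec set" where
  "vecs F m = {v \<in> carrier_vec m. \<forall>i<m. v $ i \<in> carrier F}"

definition mat_vec :: "('f, 'b) ring_scheme \<Rightarrow> nat \<Rightarrow> 'f mat \<Rightarrow> 'f vec \<Rightarrow> 'f vec" where
  "mat_vec F m A v = vec m (\<lambda>i. \<Oplus>\<^bsub>F\<^esub>k\<in>{..<m}. A $$ (i, k) \<otimes>\<^bsub>F\<^esub> v $ k)"

definition SL :: "('f, 'b) ring_scheme \<Rightarrow> nat \<Rightarrow> 'f mat set" where
  "SL F m = {A \<in> carrier (GL F m). ring_det F m A = \<one>\<^bsub>F\<^esub>}"

definition isometries ::
    "('f, 'b) ring_scheme \<Rightarrow> nat \<Rightarrow> ('f vec \<Rightarrow> 'f vec \<Rightarrow> 'f) \<Rightarrow> 'f mat set" where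
  "isometries F m B = {A \<in> carrier (GL F m).
     \<forall>u \<in> vecs F m. \<forall>v \<in> vecs F m. B (mat_vec F m A u) (mat_vec F m A v) = B u v}"

definition quad_isometries ::
    "('f, 'b) ring_scheme \<Rightarrow> nat \<Rightarrow> ('f vec \<Rightarrow> 'f) \<Rightarrow> 'f mat set" where
  "quad_isometries F m Q = {A \<in> carrier (GL F m). \<forall>v \<in> vecs F m. Q (mat_vec F m A v) = Q v}"

text \<open>The image of a linear group \<open>H\<close> in the projective linear group: \<open>H\<close> modulo its scalars\<close>

definition scalars :: "('f, 'b) ring_scheme \<Rightarrow> nat \<Rightarrow> 'f mat set" where
  "scalars F m = {mat m m (\<lambda>(i, j). if i = j then a else \<zero>\<^bsub>F\<^esub>) | a. a \<in> carrier F}"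

definition projective :: "('f, 'b) ring_scheme \<Rightarrow> nat \<Rightarrow> 'f mat set \<Rightarrow> 'f mat set monoid" where
  "projective F m H = (GL F m)\<lparr>carrier := H\<rparr> Mod (H \<inter> scalars F m)"

definition PSL :: "('f, 'b) ring_scheme \<Rightarrow> nat \<Rightarrow> 'f mat set monoid" where
  "PSL F m = projective F m (SL F m)"

text \<open>The standard Hermitian form with respect to the automorphism \<open>x \<mapsto> x\<^sup>q\<close>, to be used for a field
  with $q^2$ elements\<close>

definition hermitian :: "('f, 'b) ring_scheme \<Rightarrow> nat \<Rightarrow> nat \<Rightarrow> 'f vec \<Rightarrow> 'f vec \<Rightarrow> 'f" where
  "hermitian F q m u v = (\<Oplus>\<^bsub>F\<^esub>i\<in>{..<m}. u $ i \<otimes>\<^bsub>F\<^esub> (v $ i [^]\<^bsub>F\<^esub> q))"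

definition PSU :: "('f, 'b) ring_scheme \<Rightarrow> nat \<Rightarrow> nat \<Rightarrow> 'f mat set monoid" where
  "PSU F q m = projective F m (SL F m \<inter> isometries F m (hermitian F q m))"

text \<open>The hyperbolic pairs of the standard bases below sit at the positions \<open>2i\<close>, \<open>2i + 1\<close>.\<close>

definition symplectic :: "('f, 'b) ring_scheme \<Rightarrow> nat \<Rightarrow> 'f vec \<Rightarrow> 'f vec \<Rightarrow> 'f" where
  "symplectic F n u v = (\<Oplus>\<^bsub>F\<^esub>i\<in>{..<n}.
     (u $ (2 * i) \<otimes>\<^bsub>F\<^esub> v $ (2 * i + 1)) \<ominus>\<^bsub>F\<^esub> (u $ (2 * i + 1) \<otimes>\<^bsub>F\<^esub> v $ (2 * i)))"

definition PSp :: "('f, 'b) ring_scheme \<Rightarrow> nat \<Rightarrow> 'f mat set monoid" where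
  "PSp F n = projective F (2 * n) (isometries F (2 * n) (symplectic F n))"

definition hyperbolic :: "('f, 'b) ring_scheme \<Rightarrow> nat \<Rightarrow> 'f vec \<Rightarrow> 'f" where
  "hyperbolic F k v = (\<Oplus>\<^bsub>F\<^esub>i\<in>{..<k}. v $ (2 * i) \<otimes>\<^bsub>F\<^esub> v $ (2 * i + 1))"

definition binary_form :: "('f, 'b) ring_scheme \<Rightarrow> 'f \<Rightarrow> 'f \<Rightarrow> 'f \<Rightarrow> 'f \<Rightarrow> 'f \<Rightarrow> 'f" where
  "binary_form F a b c x y =
     (a \<otimes>\<^bsub>F\<^esub> (x \<otimes>\<^bsub>F\<^esub> x)) \<oplus>\<^bsub>F\<^esub> (b \<otimes>\<^bsub>F\<^esub> (x \<otimes>\<^bsub>F\<^esub> y)) \<oplus>\<^bsub>F\<^esub> (c \<otimes>\<^bsub>F\<^esub> (y \<otimes>\<^bsub>F\<^esub> y))"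

definition anisotropic :: "('f, 'b) ring_scheme \<Rightarrow> 'f \<Rightarrow> 'f \<Rightarrow> 'f \<Rightarrow> bool" where
  "anisotropic F a b c \<longleftrightarrow> a \<in> carrier F \<and> b \<in> carrier F \<and> c \<in> carrier F
     \<and> (\<forall>x \<in> carrier F. \<forall>y \<in> carrier F.
          binary_form F a b c x y = \<zero>\<^bsub>F\<^esub> \<longrightarrow> x = \<zero>\<^bsub>F\<^esub> \<and> y = \<zero>\<^bsub>F\<^esub>)"

text \<open>$\Omega$ is the derived subgroup of the full isometry group of the quadratic form, in every
  characteristic.\<close>

definition POmega :: "('f, 'b) ring_scheme \<Rightarrow> nat \<Rightarrow> ('f vec \<Rightarrow> 'f) \<Rightarrow> 'f mat set monoid" where
  "POmega F m Q = projective F m (derived (GL F m) (quad_isometries F m Q))"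

definition POmega_odd :: "('f, 'b) ring_scheme \<Rightarrow> nat \<Rightarrow> 'f mat set monoid" where
  "POmega_odd F n = POmega F (2 * n + 1)
     (\<lambda>v. hyperbolic F n v \<oplus>\<^bsub>F\<^esub> (v $ (2 * n) \<otimes>\<^bsub>F\<^esub> v $ (2 * n)))"

definition POmega_plus :: "('f, 'b) ring_scheme \<Rightarrow> nat \<Rightarrow> 'f mat set monoid" where
  "POmega_plus F n = POmega F (2 * n) (hyperbolic F n)"

text \<open>Minus type, for \<open>n \<ge> 1\<close>: \<open>n - 1\<close> hyperbolic planes and an anisotropic plane, on which the
  form is $a x^2 + b x y + c y^2$\<close>

definition POmega_minus ::
    "('f, 'b) ring_scheme \<Rightarrow> 'f \<Rightarrow> 'f \<Rightarrow> 'f \<Rightarrow> nat \<Rightarrow> 'f mat set monoid" where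
  "POmega_minus F a b c n = POmega F (2 * n)
     (\<lambda>v. hyperbolic F (n - 1) v
        \<oplus>\<^bsub>F\<^esub> binary_form F a b c (v $ (2 * n - 2)) (v $ (2 * n - 1)))"

text \<open>
  The groups of types $A_n, B_n, C_n, D_n, {}^2D_n$ (field of order $q$) and ${}^2A_n$ (field of
  order $q^2$).  Taking the fields with carrier in \<^typ>\<open>nat\<close> is no restriction, since every
  finite field has an isomorphic copy there; it allows to quantify over them within a formula.
  The same group occurs once for each choice of \<open>F\<close> and of the anisotropic plane, always up to
  isomorphism.
\<close>

definition classical_groups :: "nat \<Rightarrow> nat \<Rightarrow> nat mat set monoid set" where
  "classical_groups n q =
     (\<Union>F \<in> {F :: nat ring. field F \<and> order F = q}.
        {PSL F (n + 1), POmega_odd F n, PSp F n, POmega_plus F n}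
        \<union> {POmega_minus F a b c n | a b c. anisotropic F a b c})
     \<union> (\<Union>F \<in> {F :: nat ring. field F \<and> order F = q\<^sup>2}. {PSU F q (n + 1)})"

end

theory Submission
  imports
    Defs
    "HOL-Library.Function_Algebras"
    "HOL-Algebra.Multiplicative_Group"
    "Jordan_Normal_Form.Determinant"
begin

text \<open>
  Only the constants \<open>c\<close> in subwords \<open>x c x\<^sup>-\<^sup>1\<close> are critical.  If such a \<open>c\<close> acts as a scalar on a large
  nondegenerate subspace, then it commutes with all values of the letters supported there, and
  \<open>x c x\<^sup>-\<^sup>1\<close> can be replaced by \<open>c\<close>; this keeps the content and costs a constant factor of the
  dimension.  If no critical constant is of this kind, then there are singular vectors \<open>p\<^sub>a \<bottom> r\<^sub>a\<close>, one
  pair for each constant \<open>c\<^sub>a\<close>, such that \<open>p\<^sub>a\<close> is not orthogonal to \<open>c\<^sub>a r\<^sub>a\<close>, while everything else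
  is orthogonal.  Let the letter at position \<open>a\<close> take \<open>c\<^sub>a r\<^sub>a\<close> to \<open>r\<^sub>a\<^sub>-\<^sub>1\<close>, by a transvection along \<open>p\<^sub>a\<close>
  and \<open>r\<^sub>a\<^sub>-\<^sub>1\<close>, up to vectors that are not seen later on.  Then the value of the word does not act as
  a scalar, since it takes the last \<open>r\<close> to a vector that is not orthogonal to the first \<open>p\<close>.  In
  alternating groups, points and 3-cycles replace vectors and transvections.  Hence the length is even
  of order at least \<open>log n\<close>.
\<close>

section \<open>Words acting on a set\<close>

text \<open>The obstacle is that a letter has one value at all its positions, so the transvections
  of these positions act together. They commute once their vectors are mutually orthogonal. Choosing
  the pairs successively gives all of this except \<open>p a\<close> against \<open>r a\<close>,
  which occurs only when a letter has two neighbouring positions. Doubling the generators confines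
  this demand to subwords \<open>x c x^-1\<close>, where collapsing disposes of the constants that
  cannot meet it.

  The bound does not depend on the field because only linear conditions are counted, each costing
  boundedly many hyperbolic pairs. A collapse multiplies the defect by 13, up to lower terms, and
  happens at most once per letter; this gives \<open>14 ^ L\<close>, hence a logarithm of the
  dimension.

  The form serves only to produce transvections, and a transvection is itself a commutator of
  transvections. So determinant one and passage to derived subgroups are harmless.

  The fields vary as records, while spans and determinants come from type classes. The product of
  all rings reconciles the two: each field is a corner of a single type-class ring.\<close>

text \<open>The constants of a word are now arbitrary functions, and a letter is evaluated by a valuation;
  the leading constant is kept apart.\<close>

fun wfun :: "(letter \<Rightarrow> 'x \<Rightarrow> 'x) \<Rightarrow> (letter \<times> ('x \<Rightarrow> 'x)) list \<Rightarrow> 'x \<Rightarrow> 'x" where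
  "wfun \<rho> [] z = z"
| "wfun \<rho> ((x, c) # ys) z = \<rho> x (c (wfun \<rho> ys z))"

lemma wfun_append: "wfun \<rho> (us @ vs) z = wfun \<rho> us (wfun \<rho> vs z)"
  by (induction \<rho> us z rule: wfun.induct) auto

text \<open>Words whose letters reduce freely to the empty word. Deleting an adjacent inverse pair
  from a word outside \<open>cancels\<close> leaves a word outside it; this is how the collapse
  keeps the content nontrivial.\<close>

inductive cancels :: "letter list \<Rightarrow> bool" where
  Nil: "cancels []"
| Cons: "cancels (us @ vs) \<Longrightarrow> cancels (us @ x # inv_letter x # vs)"

lemma wfun_closed:
  assumes "\<And>x z. z \<in> X \<Longrightarrow> \<rho> x z \<in> X" "\<And>c z. c \<in> Cs \<Longrightarrow> z \<in> X \<Longrightarrow> c z \<in> X"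
    "snd ` set ys \<subseteq> Cs" "z \<in> X"
  shows "wfun \<rho> ys z \<in> X"
  using assms(3)
proof (induction ys)
  case (Cons y ys)
  obtain x c where y: "y = (x, c)" by (cases y)
  have "c (wfun \<rho> ys z) \<in> X" by (rule assms(2)) (use Cons y in auto)
  then show ?case by (simp add: y assms(1))
qed (simp add: assms(4))

text \<open>A letter carries the constant to its right. What is left of a deleted pair is therefore
  composed with the constant of the last letter of \<open>us\<close>, or with the leading constant
  if \<open>us\<close> is empty.\<close>

lemma absorb_constant:
  assumes comp: "\<And>c d. c \<in> Cs \<Longrightarrow> d \<in> Cs \<Longrightarrow> (\<lambda>z. c (d z)) \<in> Cs"
    and c0: "c0 \<in> Cs" and us: "snd ` set us \<subseteq> Cs" and e: "e \<in> Cs"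
  shows "\<exists>c1 us'. c1 \<in> Cs \<and> snd ` set us' \<subseteq> Cs \<and> map fst us' = map fst us \<and>
    (\<forall>\<rho> z. c1 (wfun \<rho> us' z) = c0 (wfun \<rho> us (e z)))"
proof (cases us rule: rev_cases)
  case Nil
  have "(\<lambda>z. c0 (e z)) \<in> Cs" by (rule comp[OF c0 e])
  then show ?thesis
    by (intro exI[of _ "\<lambda>z. c0 (e z)"] exI[of _ "[]"]) (simp add: Nil)
next
  case (snoc us0 yb)
  obtain y b where yb: "yb = (y, b)" by (cases yb)
  have "b \<in> Cs" using snoc us yb by auto
  then have "(\<lambda>z. b (e z)) \<in> Cs" by (rule comp[OF _ e])
  then show ?thesis
    using snoc us c0 by (intro exI[of _ c0] exI[of _ "us0 @ [(y, \<lambda>z. b (e z))]"])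
      (simp add: wfun_append yb)
qed

lemma not_successively_split:
  assumes "\<not> successively P ys"
  shows "\<exists>us a b vs. ys = us @ a # b # vs \<and> \<not> P a b"
  using assms
proof (induction ys rule: induct_list012)
  case (3 x y zs)
  show ?case
  proof (cases "P x y")
    case True
    then obtain us a b vs where "y # zs = us @ a # b # vs" "\<not> P a b" using 3 by auto
    then show ?thesis by (intro exI[of _ "x # us"]) auto
  next
    case False
    then show ?thesis by (intro exI[of _ "[]"]) auto
  qed
qed auto

text \<open>If a constant between \<open>x\<close> and \<open>x\<^sup>-\<^sup>1\<close> commutes with all values of the letters, both letters can
  be dropped, which changes neither the value nor the content.  The state \<open>s\<close> restricts the
  admissible valuations so that such constants do commute; \<open>D\<close> is the price paid so far.\<close>

lemma collapse_induct:
  fixes val :: "'s \<Rightarrow> (letter \<Rightarrow> 'x \<Rightarrow> 'x) set" and ok :: "nat \<Rightarrow> 's \<Rightarrow> bool"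
  assumes comp: "\<And>c d. c \<in> Cs \<Longrightarrow> d \<in> Cs \<Longrightarrow> (\<lambda>z. c (d z)) \<in> Cs"
    and maps: "\<And>c z. c \<in> Cs \<Longrightarrow> z \<in> X \<Longrightarrow> c z \<in> X"
    and inv: "\<And>s \<rho> x z. \<rho> \<in> val s \<Longrightarrow> z \<in> X \<Longrightarrow> \<rho> x (\<rho> (inv_letter x) z) = z"
    and val_maps: "\<And>s \<rho> x z. \<rho> \<in> val s \<Longrightarrow> z \<in> X \<Longrightarrow> \<rho> x z \<in> X"
    and step: "\<And>D s c. ok D s \<Longrightarrow> g D \<le> M \<Longrightarrow> c \<in> Cs \<Longrightarrow> \<not> far D s c \<Longrightarrow>
      \<exists>s'. ok (g D) s' \<and> val s' \<subseteq> val s \<and> (\<forall>\<rho>\<in>val s'. \<forall>x. \<forall>z\<in>X. \<rho> x (c z) = c (\<rho> x z))"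
    and final: "\<And>D s c0 ys. ok D s \<Longrightarrow> g D \<le> M \<Longrightarrow> c0 \<in> Cs \<Longrightarrow> snd ` set ys \<subseteq> Cs \<Longrightarrow> ys \<noteq> [] \<Longrightarrow>
      length ys \<le> L \<Longrightarrow> successively (\<lambda>(x, c) (y, d). y = inv_letter x \<longrightarrow> far D s c) ys \<Longrightarrow>
      \<exists>\<rho>\<in>val s. good (\<lambda>z. c0 (wfun \<rho> ys z))"
    and good: "\<And>f h. (\<And>z. z \<in> X \<Longrightarrow> f z = h z) \<Longrightarrow> good f \<Longrightarrow> good h"
    and g_mono: "mono g" and g_le: "\<And>D. D \<le> g D"
  shows "ok D s \<Longrightarrow> (g ^^ length ys) D \<le> M \<Longrightarrow> length ys \<le> L \<Longrightarrow> c0 \<in> Cs \<Longrightarrow>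
    snd ` set ys \<subseteq> Cs \<Longrightarrow> \<not> cancels (map fst ys) \<Longrightarrow> \<exists>\<rho>\<in>val s. good (\<lambda>z. c0 (wfun \<rho> ys z))"
proof (induction "length ys" arbitrary: ys D s c0 rule: less_induct)
  case less
  have funpow_le: "(g ^^ m) D \<le> (g ^^ (m + k)) D" for m k D
  proof (induction k)
    case (Suc k)
    then show ?case using g_le[of "(g ^^ (m + k)) D"] by simp
  qed simp
  have "ys \<noteq> []" using less.prems cancels.Nil by auto
  then have gD: "g D \<le> M"
    using funpow_le[of 1 D "length ys - 1"] less.prems(2) by (cases ys) auto
  show ?case
  proof (cases "successively (\<lambda>(x, c) (y, d). y = inv_letter x \<longrightarrow> far D s c) ys")
    case True
    then show ?thesis
      by (rule final[OF less.prems(1) gD less.prems(4,5) \<open>ys \<noteq> []\<close> less.prems(3)])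
  next
    case False
    from not_successively_split[OF this] obtain us a b vs where ab: "ys = us @ a # b # vs"
      "\<not> (case a of (x, c) \<Rightarrow> \<lambda>(y, d). y = inv_letter x \<longrightarrow> far D s c) b" by blast
    obtain x c y d where "a = (x, c)" "b = (y, d)" by (cases a; cases b)
    with ab have ys: "ys = us @ (x, c) # (inv_letter x, d) # vs" and nfar: "\<not> far D s c" by auto
    have c: "c \<in> Cs" and d: "d \<in> Cs" and us: "snd ` set us \<subseteq> Cs" and vs: "snd ` set vs \<subseteq> Cs"
      using less.prems(5) by (auto simp: ys)
    obtain s' where s': "ok (g D) s'" "val s' \<subseteq> val s"
      "\<And>\<rho> y z. \<rho> \<in> val s' \<Longrightarrow> z \<in> X \<Longrightarrow> \<rho> y (c z) = c (\<rho> y z)"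
      using step[OF less.prems(1) gD c nfar] by blast
    have "\<exists>c1 us'. c1 \<in> Cs \<and> snd ` set us' \<subseteq> Cs \<and> map fst us' = map fst us \<and>
      (\<forall>\<rho> z. c1 (wfun \<rho> us' z) = c0 (wfun \<rho> us ((\<lambda>z. c (d z)) z)))"
      by (rule absorb_constant[OF _ less.prems(4) us comp[OF c d]]) (rule comp)
    then obtain c1 us' where c1: "c1 \<in> Cs" and us': "snd ` set us' \<subseteq> Cs" "map fst us' = map fst us"
      and eq: "\<And>\<rho> z. c1 (wfun \<rho> us' z) = c0 (wfun \<rho> us (c (d z)))"
      by blast
    have len: "length us' = length us" using us'(2) by (metis length_map)
    \<comment> \<open>A collapse deletes two letters but applies \<open>g\<close> once, so the
      iteration bound keeps one application to spare.\<close>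
    have "(g ^^ length (us' @ vs)) (g D) = (g ^^ (length us + length vs + 1)) D"
      using len by (simp add: funpow_swap1)
    also have "\<dots> \<le> (g ^^ (length us + length vs + 1 + 1)) D" by (rule funpow_le)
    also have "\<dots> \<le> M" using less.prems(2) by (simp add: ys)
    finally have le: "(g ^^ length (us' @ vs)) (g D) \<le> M" .
    have "\<not> cancels (map fst (us' @ vs))"
      using less.prems(6) us'(2) cancels.Cons[of "map fst us" "map fst vs" x] by (auto simp: ys)
    moreover have "snd ` set (us' @ vs) \<subseteq> Cs" using us' vs by auto
    moreover have "length (us' @ vs) < length ys" using len by (simp add: ys)
    ultimately obtain \<rho> where \<rho>: "\<rho> \<in> val s'" and gd: "good (\<lambda>z. c1 (wfun \<rho> (us' @ vs) z))"
      using less.hyps[of "us' @ vs" "g D" s' c1] s'(1) le less.prems(3) c1 by force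
    have "c1 (wfun \<rho> (us' @ vs) z) = c0 (wfun \<rho> ys z)" if z: "z \<in> X" for z
    proof -
      let ?v = "wfun \<rho> vs z"
      have v: "?v \<in> X"
        by (rule wfun_closed[where Cs = Cs, OF _ _ vs z]) (rule val_maps[OF \<rho>], assumption, rule maps)
      have "\<rho> x (c (\<rho> (inv_letter x) (d ?v))) = c (d ?v)"
        by (simp only: s'(3)[OF \<rho> val_maps[OF \<rho> maps[OF d v]]] inv[OF \<rho> maps[OF d v]])
      then show ?thesis by (simp add: ys wfun_append eq)
    qed
    then have "good (\<lambda>z. c0 (wfun \<rho> ys z))" by (rule good[OF _ gd])
    then show ?thesis using \<rho> s'(2) by blast
  qed
qed

text \<open>The substitution $x_i \mapsto y_{2i} y_{2i+1}$: afterwards neighbouring letters with the same index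
  are mutually inverse.\<close>

definition split_letter :: "letter \<times> ('x \<Rightarrow> 'x) \<Rightarrow> (letter \<times> ('x \<Rightarrow> 'x)) list" where
  "split_letter y = (case y of ((i, b), c) \<Rightarrow>
     if b then [((2 * i, True), \<lambda>z. z), ((2 * i + 1, True), c)]
     else [((2 * i + 1, False), \<lambda>z. z), ((2 * i, False), c)])"

definition split_word :: "(letter \<times> ('x \<Rightarrow> 'x)) list \<Rightarrow> (letter \<times> ('x \<Rightarrow> 'x)) list" where
  "split_word ys = concat (map split_letter ys)"

definition merge_val :: "(letter \<Rightarrow> 'x \<Rightarrow> 'x) \<Rightarrow> letter \<Rightarrow> 'x \<Rightarrow> 'x" where
  "merge_val \<rho> x = (case x of (i, b) \<Rightarrow>
     if b then (\<lambda>z. \<rho> (2 * i, True) (\<rho> (2 * i + 1, True) z))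
     else (\<lambda>z. \<rho> (2 * i + 1, False) (\<rho> (2 * i, False) z)))"

lemma wfun_split_word: "wfun \<rho> (split_word ys) z = wfun (merge_val \<rho>) ys z"
  by (induction "merge_val \<rho>" ys z rule: wfun.induct)
    (auto simp: split_word_def split_letter_def merge_val_def wfun_append split: prod.splits)

lemma length_split_word: "length (split_word ys) = 2 * length ys"
  by (induction ys) (auto simp: split_word_def split_letter_def split: prod.splits)

lemma constants_split_word: "snd ` set (split_word ys) \<subseteq> insert (\<lambda>z. z) (snd ` set ys)"
proof (induction ys)
  case (Cons y ys)
  obtain i b c where "y = ((i, b), c)" by (cases y) auto
  then have "snd ` set (split_letter y) \<subseteq> {\<lambda>z. z, snd y}" by (simp add: split_letter_def)
  moreover have "set (split_word (y # ys)) = set (split_letter y) \<union> set (split_word ys)"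
    by (simp add: split_word_def)
  ultimately show ?case using Cons by (auto simp del: split_paired_All split_paired_Ex)
qed (simp add: split_word_def)

text \<open>The two halves of a letter have indices of different parity. At a seam the parities
  agree only for opposite exponents, and then equal indices mean that the two old letters were
  mutually inverse. So a subword \<open>x c x\<close> puts no condition on \<open>c\<close>.\<close>

lemma successively_split_word:
  assumes "successively (\<lambda>(x, c) (y, d). y = inv_letter x \<longrightarrow> P c) ys"
  shows "successively (\<lambda>(x, c) (y, d). fst x = fst y \<longrightarrow> y = inv_letter x \<and> P c) (split_word ys)"
  using assms
proof (induction ys rule: induct_list012)
  case 1
  then show ?case by (simp add: split_word_def)
next
  case (2 x)
  obtain i b c where "x = ((i, b), c)" by (cases x) auto
  moreover have "Suc (2 * i) \<noteq> 2 * i" by simp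
  ultimately show ?case by (simp add: split_word_def split_letter_def)
next
  case (3 x y zs)
  have *: "2 * (i::nat) \<noteq> Suc (2 * j)" "Suc (2 * j) \<noteq> 2 * i" for i j by presburger+
  obtain i b c where x: "x = ((i, b), c)" by (cases x) auto
  obtain j b' c' where y: "y = ((j, b'), c')" by (cases y) auto
  let ?Q = "\<lambda>(x, c) (y, d). fst x = fst y \<longrightarrow> y = inv_letter x \<and> P c"
  have eq: "split_word (x # y # zs) = split_letter x @ split_word (y # zs)"
    and eq2: "split_word (y # zs) = split_letter y @ split_word zs" by (simp_all add: split_word_def)
  have IH: "successively ?Q (split_word (y # zs))" using 3 by simp
  have hd: "successively ?Q (split_letter x)" by (simp add: split_letter_def x *)
  have ne: "split_letter x \<noteq> []" "split_letter y \<noteq> []" by (simp_all add: split_letter_def x y)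
  have "y' = inv_letter x' \<longrightarrow> P c" if "x' = (i, b)" "y' = (j, b')" for x' y'
    using 3(3) that by (simp add: x y)
  then have "?Q (last (split_letter x)) (hd (split_letter y))"
    by (cases b; cases b') (auto simp: split_letter_def x y inv_letter_def *)
  then show ?case
    unfolding eq successively_append_iff using IH hd ne by (simp add: eq2 case_prod_beta)
qed

section \<open>Hyperbolic systems\<close>

text \<open>The scalars form a commutative ring with an idempotent \<open>e\<close> such that the corner \<open>e R\<close> is a
  field; \<open>V\<close> is a vector space over this field.  So \<open>e\<close> plays the role of 1, but all module
  operations are those of type classes.  The form \<open>B\<close> is linear in the second argument.\<close>

locale hyp_space = Modules.module scale
  for scale :: "'a::comm_ring_1 \<Rightarrow> 'v::ab_group_add \<Rightarrow> 'v" (infixr \<open>*s\<close> 75) +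
  fixes e eps :: 'a and V E E' :: "'v set" and B :: "'v \<Rightarrow> 'v \<Rightarrow> 'a" and k :: nat
  assumes e_nz: "e \<noteq> 0"
    and e_inv: "\<And>t. e * t = t \<Longrightarrow> t \<noteq> 0 \<Longrightarrow> \<exists>s. s * t = e"
    and eps: "eps * eps = 1"
    and V_sub: "subspace V" and V_e: "\<And>x. x \<in> V \<Longrightarrow> e *s x = x"
    and E_sub: "subspace E" "E \<subseteq> V" and E'_sub: "subspace E'" "E' \<subseteq> V"
    and B_add2: "\<And>x y z. B x (y + z) = B x y + B x z"
    and B_scale2: "\<And>x a y. B x (a *s y) = a * B x y"
    and B_add1: "\<And>x y z. x \<in> V \<Longrightarrow> y \<in> V \<Longrightarrow> B (x + y) z = B x z + B y z"
    and B_refl: "\<And>x y. x \<in> V \<Longrightarrow> y \<in> V \<Longrightarrow> B x y = 0 \<Longrightarrow> B y x = 0"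
    and E_iso: "\<And>x y. x \<in> E \<Longrightarrow> y \<in> E \<Longrightarrow> B x y = 0"
    and E'_iso: "\<And>x y. x \<in> E' \<Longrightarrow> y \<in> E' \<Longrightarrow> B x y = 0"
begin

definition lin :: "('v \<Rightarrow> 'a) \<Rightarrow> bool" where
  "lin f \<longleftrightarrow> (\<forall>x y. f (x + y) = f x + f y) \<and> (\<forall>a x. f (a *s x) = a * f x)"

definition linop :: "('v \<Rightarrow> 'v) \<Rightarrow> bool" where
  "linop c \<longleftrightarrow> (\<forall>x y. c (x + y) = c x + c y) \<and> (\<forall>a x. c (a *s x) = a *s c x) \<and> (\<forall>x\<in>V. c x \<in> V)"

lemma lin_B: "lin (B x)"
  by (simp add: lin_def B_add2 B_scale2)

lemma lin_comp: "lin f \<Longrightarrow> linop c \<Longrightarrow> lin (\<lambda>x. f (c x))"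
  by (simp add: lin_def linop_def)

lemma lin_0: "lin f \<Longrightarrow> f 0 = 0"
  unfolding lin_def by (metis mult_zero_left scale_zero_left)

lemma lin_minus: "lin f \<Longrightarrow> f (- x) = - f x"
  unfolding lin_def by (metis mult_minus1 scale_minus_left scale_one)

lemma lin_diff: "lin f \<Longrightarrow> f (x - y) = f x - f y"
  using lin_minus[of f y] unfolding lin_def diff_conv_add_uminus by metis

lemma lin_sum: "lin f \<Longrightarrow> f (sum h A) = (\<Sum>i\<in>A. f (h i))"
  by (induction A rule: infinite_finite_induct) (simp_all add: lin_0, simp add: lin_def)

lemma lin_span:
  assumes "lin f" "\<And>x. x \<in> X \<Longrightarrow> f x = 0" "x \<in> span X"
  shows "f x = 0"
  using assms(3)
proof (induction rule: span_induct_alt)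
  case base
  then show ?case by (rule lin_0[OF assms(1)])
next
  case (step c x y)
  then show ?case using assms by (simp add: lin_def)
qed

lemma e_field: "lin f \<Longrightarrow> x \<in> V \<Longrightarrow> e * f x = f x"
  using V_e unfolding lin_def by metis

lemma V_linop: "linop c \<Longrightarrow> x \<in> V \<Longrightarrow> c x \<in> V"
  by (simp add: linop_def)

lemma nonzero_mult:
  assumes "e * s = s" "e * t = t" "s \<noteq> 0" "t \<noteq> 0"
  shows "s * t \<noteq> 0"
proof
  assume "s * t = 0"
  moreover obtain u where "u * s = e" using e_inv assms by blast
  ultimately have "e * t = 0" by (metis mult.assoc mult_zero_right)
  then show False using assms by simp
qed

lemmas B_simps = B_add2 B_scale2 lin_diff[OF lin_B] lin_minus[OF lin_B] lin_0[OF lin_B]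

lemma V_closed [intro]:
  "x \<in> V \<Longrightarrow> y \<in> V \<Longrightarrow> x + y \<in> V" "x \<in> V \<Longrightarrow> y \<in> V \<Longrightarrow> x - y \<in> V" "x \<in> V \<Longrightarrow> a *s x \<in> V" "0 \<in> V"
  using V_sub by (auto simp: subspace_add subspace_diff subspace_scale subspace_0)

lemma span_V: "X \<subseteq> V \<Longrightarrow> span X \<subseteq> V"
  by (rule span_minimal[OF _ V_sub])

text \<open>The form is linear only in its second argument; reflexivity of orthogonality carries the
  vanishing over to the first.\<close>

lemma B_span1:
  assumes "X \<subseteq> V" "z \<in> V" "\<And>x. x \<in> X \<Longrightarrow> B x z = 0" "x \<in> span X"
  shows "B x z = 0"
proof (rule B_refl[OF assms(2)])
  show "x \<in> V" using span_V[OF assms(1)] assms(4) by auto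
  show "B z x = 0"
    by (rule lin_span[OF lin_B _ assms(4)]) (use assms B_refl in blast)
qed

text \<open>Gaussian elimination: on \<open>J\<close> minus few indices, the vectors can be corrected so that given
  functionals vanish.\<close>

lemma echelon:
  assumes J: "finite J" "a ` J \<subseteq> V" and fs: "\<forall>f\<in>set fs. lin f"
  shows "\<exists>I a'. I \<subseteq> J \<and> card I \<le> length fs \<and>
    (\<forall>j\<in>J - I. a' j - a j \<in> span (a ` I) \<and> (\<forall>f\<in>set fs. f (a' j) = 0))"
  using fs
proof (induction fs)
  case Nil
  show ?case by (rule exI[of _ "{}"], rule exI[of _ a]) (simp add: span_zero)
next
  case (Cons f fs)
  then have "\<forall>f\<in>set fs. lin f" by simp
  from Cons.IH[OF this] obtain I a' where I: "I \<subseteq> J" "card I \<le> length fs"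
    and "\<forall>j\<in>J - I. a' j - a j \<in> span (a ` I) \<and> (\<forall>f\<in>set fs. f (a' j) = 0)"
    by blast
  then have a': "\<And>j. j \<in> J - I \<Longrightarrow> a' j - a j \<in> span (a ` I)"
    "\<And>j g. j \<in> J - I \<Longrightarrow> g \<in> set fs \<Longrightarrow> g (a' j) = 0"
    by auto
  have f: "lin f" using Cons.prems by simp
  show ?case
  proof (cases "\<forall>j\<in>J - I. f (a' j) = 0")
    case True
    then show ?thesis using I a' by (intro exI[of _ I] exI[of _ a']) auto
  next
    case False
    then obtain i where i: "i \<in> J - I" "f (a' i) \<noteq> 0" by auto
    have sub: "span (a ` I) \<subseteq> span (a ` insert i I)" by (rule span_mono) auto
    have "a' i - a i \<in> span (a ` insert i I)" using a'(1)[OF i(1)] sub by auto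
    moreover have "a i \<in> span (a ` insert i I)" by (rule span_base) auto
    ultimately have ai: "a' i \<in> span (a ` insert i I)"
      using span_add[of "a' i - a i" "a ` insert i I" "a i"] by simp
    have "span (a ` insert i I) \<subseteq> V" by (rule span_V) (use I(1) J(2) i in auto)
    then have "a' i \<in> V" using ai by auto
    then obtain s where s: "s * f (a' i) = e" using e_inv e_field[OF f] i by blast
    \<comment> \<open>The pivot is \<open>a' i\<close>: subtracting a multiple of it clears
      \<open>f\<close>, and the earlier functionals, which vanish on both vectors, stay
      cleared.\<close>
    define a'' where "a'' j = a' j - (f (a' j) * s) *s a' i" for j
    have 1: "a'' j - a j \<in> span (a ` insert i I)" if "j \<in> J - insert i I" for j
    proof -
      have "(a' j - a j) - (f (a' j) * s) *s a' i \<in> span (a ` insert i I)"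
        by (rule span_diff[OF _ span_scale[OF ai]]) (use a'(1)[of j] sub that in auto)
      then show ?thesis by (simp add: a''_def algebra_simps)
    qed
    have 2: "g (a'' j) = 0" if "j \<in> J - insert i I" "g \<in> set (f # fs)" for j g
    proof -
      have g: "lin g" using Cons.prems that by auto
      have gj: "g (a'' j) = g (a' j) - (f (a' j) * s) * g (a' i)"
        using g by (simp add: a''_def lin_diff) (simp add: lin_def)
      show ?thesis
      proof (cases "g = f")
        case True
        have "a j \<in> V" "a' j - a j \<in> V"
          using J(2) that a'(1)[of j] span_V[of "a ` I"] I(1) by auto
        then have "a' j \<in> V" using V_closed(1)[of "a' j - a j" "a j"] by simp
        then have "e * f (a' j) = f (a' j)" using e_field[OF f] by auto
        then show ?thesis using s gj True by (simp add: mult.assoc mult.commute[of _ e])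
      next
        case False
        then have "g \<in> set fs" using that by auto
        then show ?thesis using a'(2)[of j g] a'(2)[of i g] that i gj by simp
      qed
    qed
    have "finite I" using I(1) J(1) finite_subset by auto
    then have "card (insert i I) \<le> length (f # fs)" using I(2) by (simp add: card_insert_if)
    then show ?thesis using 1 2 I(1) i
      by (intro exI[of _ "insert i I"] exI[of _ a'']) auto
  qed
qed

text \<open>A hyperbolic system of defect \<open>D\<close>: a sequence of at least \<open>k - D\<close> hyperbolic pairs whose span
  and whose orthogonal space are controlled by \<open>2 D + 2\<close> vectors and functionals, respectively.\<close>

definition hsys :: "nat \<Rightarrow> nat set \<Rightarrow> (nat \<Rightarrow> 'v) \<Rightarrow> (nat \<Rightarrow> 'v) \<Rightarrow> bool" where
  "hsys D J a b \<longleftrightarrow> finite J \<and> k \<le> card J + D \<and> a ` J \<subseteq> E \<and> b ` J \<subseteq> E' \<and>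
    (\<forall>i\<in>J. \<forall>j\<in>J. B (a i) (b j) = (if i = j then e else 0)
       \<and> B (b i) (a j) = (if i = j then eps * e else 0)) \<and>
    (\<exists>gs. length gs \<le> 2 * D + 2 \<and> (\<forall>g\<in>set gs. lin g) \<and>
      (\<forall>z\<in>V. (\<forall>j\<in>J. B (a j) z = 0 \<and> B (b j) z = 0) \<longrightarrow> (\<forall>g\<in>set gs. g z = 0) \<longrightarrow> z = 0)) \<and>
    (\<exists>ws. length ws \<le> 2 * D + 2 \<and> set ws \<subseteq> V \<and> V \<subseteq> span (a ` J \<union> b ` J \<union> set ws))"

abbreviation hspan :: "nat set \<Rightarrow> (nat \<Rightarrow> 'v) \<Rightarrow> (nat \<Rightarrow> 'v) \<Rightarrow> 'v set" where
  "hspan J a b \<equiv> span (a ` J \<union> b ` J)"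

lemma hsys_mono:
  assumes "hsys D J a b" "D \<le> D'"
  shows "hsys D' J a b"
proof -
  have "n \<le> 2 * D' + 2" if "n \<le> 2 * D + 2" for n using that assms(2) by simp
  moreover have "k \<le> card J + D \<Longrightarrow> k \<le> card J + D'" using assms(2) by simp
  ultimately show ?thesis using assms(1) unfolding hsys_def by (elim conjE exE) (intro conjI exI; blast)
qed

lemma hsys_V:
  assumes "hsys D J a b"
  shows "a ` J \<union> b ` J \<subseteq> V" "hspan J a b \<subseteq> V"
proof -
  show *: "a ` J \<union> b ` J \<subseteq> V" using assms E_sub E'_sub unfolding hsys_def by blast
  show "hspan J a b \<subseteq> V" by (rule span_V[OF *])
qed

text \<open>Each functional costs at most three pairs. Clearing the vectors \<open>a\<close> costs
  one index per functional; the vectors \<open>b\<close> are cleared of the same functionals and of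
  the forms with the discarded \<open>a i\<close>, which costs two. All corrections stay inside the
  isotropic spaces \<open>E\<close> and \<open>E'\<close>, so isotropy is kept without further
  work.\<close>

lemma cut:
  assumes S: "hsys D J a b" and fs: "\<forall>f\<in>set fs. lin f"
  shows "\<exists>J' a' b'. hsys (D + 3 * length fs) J' a' b' \<and> hspan J' a' b' \<subseteq> hspan J a b \<and>
    (\<forall>f\<in>set fs. \<forall>y\<in>hspan J' a' b'. f y = 0)"
proof -
  note S' = S[unfolded hsys_def]
  have finJ: "finite J" and cardJ: "k \<le> card J + D" using S' by simp_all
  have aE: "\<And>j. j \<in> J \<Longrightarrow> a j \<in> E" and bE: "\<And>j. j \<in> J \<Longrightarrow> b j \<in> E'" using S' by blast+
  have "\<forall>i\<in>J. \<forall>j\<in>J. B (a i) (b j) = (if i = j then e else 0) \<and> B (b i) (a j) = (if i = j then eps * e else 0)"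
    using S' by (elim conjE)
  then have ab: "\<And>i j. i \<in> J \<Longrightarrow> j \<in> J \<Longrightarrow> B (a i) (b j) = (if i = j then e else 0)"
    and ba: "\<And>i j. i \<in> J \<Longrightarrow> j \<in> J \<Longrightarrow> B (b i) (a j) = (if i = j then eps * e else 0)"
    by auto
  have aV: "a ` J \<subseteq> V" and bV: "b ` J \<subseteq> V" using hsys_V[OF S] by auto
  have "\<exists>gs. length gs \<le> 2 * D + 2 \<and> (\<forall>g\<in>set gs. lin g) \<and>
      (\<forall>z\<in>V. (\<forall>j\<in>J. B (a j) z = 0 \<and> B (b j) z = 0) \<longrightarrow> (\<forall>g\<in>set gs. g z = 0) \<longrightarrow> z = 0)"
    using S' by (elim conjE)
  then obtain gs where gs: "length gs \<le> 2 * D + 2" "\<forall>g\<in>set gs. lin g"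
    "\<forall>z\<in>V. (\<forall>j\<in>J. B (a j) z = 0 \<and> B (b j) z = 0) \<longrightarrow> (\<forall>g\<in>set gs. g z = 0) \<longrightarrow> z = 0"
    by (elim exE conjE)
  have "\<exists>ws. length ws \<le> 2 * D + 2 \<and> set ws \<subseteq> V \<and> V \<subseteq> span (a ` J \<union> b ` J \<union> set ws)"
    using S' by (elim conjE)
  then obtain ws where ws: "length ws \<le> 2 * D + 2" "set ws \<subseteq> V" "V \<subseteq> span (a ` J \<union> b ` J \<union> set ws)"
    by (elim exE conjE)
  from echelon[OF finJ aV fs] obtain I a' where I: "I \<subseteq> J" "card I \<le> length fs"
    and "\<forall>j\<in>J - I. a' j - a j \<in> span (a ` I) \<and> (\<forall>f\<in>set fs. f (a' j) = 0)"
    by (elim exE conjE)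
  then have a': "\<And>j. j \<in> J - I \<Longrightarrow> a' j - a j \<in> span (a ` I)"
    "\<And>j f. j \<in> J - I \<Longrightarrow> f \<in> set fs \<Longrightarrow> f (a' j) = 0" by auto
  have finI: "finite I" using I(1) finJ finite_subset by auto
  \<comment> \<open>The extra forms make the new \<open>b\<close> orthogonal to the discarded
    \<open>a i\<close> and hence to the corrections of the \<open>a\<close>; this keeps the pairs
    dual.\<close>
  define fs' where "fs' = fs @ map (\<lambda>i. B (a i)) (sorted_list_of_set I)"
  have "\<forall>f\<in>set fs'. lin f" using fs lin_B by (auto simp: fs'_def)
  from echelon[OF finJ bV this] obtain I' b' where I': "I' \<subseteq> J" "card I' \<le> length fs'"
    and "\<forall>j\<in>J - I'. b' j - b j \<in> span (b ` I') \<and> (\<forall>f\<in>set fs'. f (b' j) = 0)"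
    by (elim exE conjE)
  then have b': "\<And>j. j \<in> J - I' \<Longrightarrow> b' j - b j \<in> span (b ` I')"
    "\<And>j f. j \<in> J - I' \<Longrightarrow> f \<in> set fs' \<Longrightarrow> f (b' j) = 0" by auto
  have finI': "finite I'" using I'(1) finJ finite_subset by auto
  have cardI': "card I' \<le> 2 * length fs" using I'(2) I(2) finI by (simp add: fs'_def)
  define K where "K = I \<union> I'"
  have K: "finite K" "K \<subseteq> J" "card K \<le> 3 * length fs"
    using finI finI' I(1) I'(1) card_Un_le[of I I'] I(2) cardI' by (auto simp: K_def)
  define J' where "J' = J - K"
  have J'J: "\<And>j. j \<in> J' \<Longrightarrow> j \<in> J \<and> j \<notin> I \<and> j \<notin> I'" by (auto simp: J'_def K_def)
  have aI: "span (a ` I) \<subseteq> E" by (rule span_minimal[OF _ E_sub(1)]) (use I(1) aE in auto)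
  have bI': "span (b ` I') \<subseteq> E'" by (rule span_minimal[OF _ E'_sub(1)]) (use I'(1) bE in auto)
  have a'E: "a' j \<in> E" if "j \<in> J'" for j
    using subspace_add[OF E_sub(1), of "a' j - a j" "a j"] a'(1)[of j] J'J[OF that] aI aE by auto
  have b'E: "b' j \<in> E'" if "j \<in> J'" for j
    using subspace_add[OF E'_sub(1), of "b' j - b j" "b j"] b'(1)[of j] J'J[OF that] bI' bE by auto
  have a'V: "a' j \<in> V" and b'V: "b' j \<in> V" if "j \<in> J'" for j
    using a'E[OF that] b'E[OF that] E_sub(2) E'_sub(2) by auto
  have da: "a' j - a j \<in> V" and db: "b' j - b j \<in> V" if "j \<in> J'" for j
    using a'(1)[of j] b'(1)[of j] J'J[OF that] aI bI' E_sub(2) E'_sub(2) by blast+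
  have aI_b': "B x (b' j) = 0" if "j \<in> J'" "x \<in> span (a ` I)" for j x
  proof (rule B_span1[OF _ b'V[OF that(1)] _ that(2)])
    show "a ` I \<subseteq> V" using aV I(1) by auto
    show "B x (b' j) = 0" if "x \<in> a ` I" for x
      using b'(2)[of j "x'" for x'] J'J[OF \<open>j \<in> J'\<close>] that finI by (auto simp: fs'_def)
  qed
  have ab': "B (a i) (b' j) = (if i = j then e else 0)" if "i \<in> J'" "j \<in> J'" for i j
  proof -
    have "B (a i) (b' j - b j) = 0"
      by (rule lin_span[OF lin_B _ b'(1)]) (use J'J[OF that(1)] J'J[OF that(2)] ab I'(1) in auto)
    then show ?thesis using ab[of i j] J'J[OF that(1)] J'J[OF that(2)] by (simp add: B_simps)
  qed
  have dual1: "B (a' i) (b' j) = (if i = j then e else 0)" if "i \<in> J'" "j \<in> J'" for i j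
  proof -
    have "B (a' i) (b' j) = B (a i) (b' j) + B (a' i - a i) (b' j)"
      using B_add1[of "a i" "a' i - a i" "b' j"] da[OF that(1)] aV J'J[OF that(1)] by auto
    then show ?thesis using aI_b'[OF that(2) a'(1)] J'J[OF that(1)] ab'[OF that] by auto
  qed
  have b'a: "B (b' i) (a j) = (if i = j then eps * e else 0)" if "i \<in> J'" "j \<in> J'" for i j
  proof -
    have "B (b' i - b i) (a j) = 0"
    proof (rule B_span1)
      show "b ` I' \<subseteq> V" "a j \<in> V" using bV I'(1) aV J'J[OF that(2)] by auto
      show "b' i - b i \<in> span (b ` I')" using b'(1) J'J[OF that(1)] by auto
      show "B x (a j) = 0" if "x \<in> b ` I'" for x
        using that ba J'J[OF \<open>j \<in> J'\<close>] I'(1) by auto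
    qed
    moreover have "B (b' i) (a j) = B (b i) (a j) + B (b' i - b i) (a j)"
      using B_add1[of "b i" "b' i - b i" "a j"] db[OF that(1)] bV J'J[OF that(1)] by auto
    ultimately show ?thesis using ba J'J[OF that(1)] J'J[OF that(2)] by auto
  qed
  have dual2: "B (b' i) (a' j) = (if i = j then eps * e else 0)" if "i \<in> J'" "j \<in> J'" for i j
  proof -
    have "B (a' j - a j) (b' i) = 0"
      by (rule aI_b'[OF that(1) a'(1)]) (use J'J[OF that(2)] in auto)
    then have "B (b' i) (a' j - a j) = 0" using B_refl[OF da b'V] that by auto
    then show ?thesis using b'a[OF that] by (simp add: B_simps)
  qed
  have a'span: "a' j \<in> span (a ` J)" and b'span: "b' j \<in> span (b ` J)" if "j \<in> J'" for j
  proof -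
    have "a' j - a j \<in> span (a ` J)" "b' j - b j \<in> span (b ` J)"
      using a'(1)[of j] b'(1)[of j] J'J[OF that] span_mono[of "a ` I" "a ` J"]
        span_mono[of "b ` I'" "b ` J"] I(1) I'(1) by auto
    moreover have "a j \<in> span (a ` J)" "b j \<in> span (b ` J)" using J'J[OF that] by (auto intro: span_base)
    ultimately show "a' j \<in> span (a ` J)" "b' j \<in> span (b ` J)"
      using span_add[of "a' j - a j" "a ` J" "a j"] span_add[of "b' j - b j" "b ` J" "b j"] by auto
  qed
  have sub: "hspan J' a' b' \<subseteq> hspan J a b"
  proof (rule span_minimal)
    show "a' ` J' \<union> b' ` J' \<subseteq> hspan J a b"
      using a'span b'span span_mono[of "a ` J" "a ` J \<union> b ` J"] span_mono[of "b ` J" "a ` J \<union> b ` J"]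
      by blast
  qed simp
  let ?ks = "sorted_list_of_set K"
  \<comment> \<open>The discarded pairs move into the control data, two entries for each, which
    matches the growth of the bound \<open>2 * D + 2\<close>.\<close>
  define gs' where "gs' = gs @ map (\<lambda>i. B (a i)) ?ks @ map (\<lambda>i. B (b i)) ?ks"
  define ws' where "ws' = ws @ map a ?ks @ map b ?ks"
  have len: "length gs' \<le> 2 * (D + 3 * length fs) + 2" "length ws' \<le> 2 * (D + 3 * length fs) + 2"
    using gs(1) ws(1) K by (auto simp: gs'_def ws'_def)
  have "\<forall>z\<in>V. (\<forall>j\<in>J'. B (a' j) z = 0 \<and> B (b' j) z = 0) \<longrightarrow> (\<forall>g\<in>set gs'. g z = 0) \<longrightarrow> z = 0"
  proof (intro ballI impI)
    fix z assume z: "z \<in> V" and "\<forall>j\<in>J'. B (a' j) z = 0 \<and> B (b' j) z = 0"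
      and zg': "\<forall>g\<in>set gs'. g z = 0"
    then have zJ: "\<And>j. j \<in> J' \<Longrightarrow> B (a' j) z = 0 \<and> B (b' j) z = 0"
      and zg: "\<And>g. g \<in> set gs' \<Longrightarrow> g z = 0" by auto
    have K0: "B (a i) z = 0" "B (b i) z = 0" if "i \<in> K" for i
      using zg[of "B (a i)"] zg[of "B (b i)"] that K(1) by (auto simp: gs'_def)
    have "\<forall>g\<in>set gs. g z = 0" using zg by (auto simp: gs'_def)
    moreover have "\<forall>j\<in>J. B (a j) z = 0 \<and> B (b j) z = 0"
    proof
      fix j assume j: "j \<in> J"
      show "B (a j) z = 0 \<and> B (b j) z = 0"
    proof (cases "j \<in> K")
      case True
      then show ?thesis using K0 by auto
    next
      case False
      then have j': "j \<in> J'" using j by (auto simp: J'_def)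
      have "B (a' j - a j) z = 0"
        by (rule B_span1[OF _ z _ a'(1)]) (use K0 I(1) aV J'J[OF j'] K_def in blast)+
      moreover have "B (b' j - b j) z = 0"
        by (rule B_span1[OF _ z _ b'(1)]) (use K0 I'(1) bV J'J[OF j'] K_def in blast)+
      moreover have "B (a' j) z = B (a j) z + B (a' j - a j) z" "B (b' j) z = B (b j) z + B (b' j - b j) z"
        using B_add1[of "a j" "a' j - a j" z] B_add1[of "b j" "b' j - b j" z] da[OF j'] db[OF j'] aV bV j
        by auto
      ultimately show ?thesis using zJ[OF j'] by simp
    qed
    qed
    ultimately show "z = 0" using gs(3) z by blast
  qed
  moreover have "\<forall>g\<in>set gs'. lin g" using gs(2) lin_B by (auto simp: gs'_def)
  ultimately have gs': "\<exists>gs. length gs \<le> 2 * (D + 3 * length fs) + 2 \<and> (\<forall>g\<in>set gs. lin g) \<and>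
      (\<forall>z\<in>V. (\<forall>j\<in>J'. B (a' j) z = 0 \<and> B (b' j) z = 0) \<longrightarrow> (\<forall>g\<in>set gs. g z = 0) \<longrightarrow> z = 0)"
    using len(1) by (intro exI[of _ gs'] conjI)
  let ?W = "span (a' ` J' \<union> b' ` J' \<union> set ws')"
  have KW: "a i \<in> ?W" "b i \<in> ?W" if "i \<in> K" for i
    using that K(1) by (auto simp: ws'_def intro!: span_base)
  have aW: "a j \<in> ?W" and bW: "b j \<in> ?W" if j: "j \<in> J" for j
  proof -
    have "a j \<in> ?W \<and> b j \<in> ?W"
    proof (cases "j \<in> K")
      case True
      then show ?thesis using KW by auto
    next
      case False
      then have j': "j \<in> J'" using j by (auto simp: J'_def)
      have "span (a ` I) \<subseteq> ?W" "span (b ` I') \<subseteq> ?W"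
        by (rule span_minimal; use KW K_def in auto)+
      then have "a' j - a j \<in> ?W" "b' j - b j \<in> ?W" using a'(1) b'(1) J'J[OF j'] by auto
      moreover have "a' j \<in> ?W" "b' j \<in> ?W" using j' by (auto intro: span_base)
      ultimately show ?thesis
        using span_diff[of "a' j" _ "a' j - a j"] span_diff[of "b' j" _ "b' j - b j"] by fastforce
    qed
    then show "a j \<in> ?W" "b j \<in> ?W" by auto
  qed
  have "span (a ` J \<union> b ` J \<union> set ws) \<subseteq> ?W"
    by (rule span_minimal) (use aW bW in \<open>auto simp: ws'_def intro: span_base\<close>)
  then have "V \<subseteq> ?W" using ws(3) by auto
  moreover have "set ws' \<subseteq> V"
    using ws(2) K(1) order_trans[OF image_mono[OF K(2)] aV] order_trans[OF image_mono[OF K(2)] bV]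
    by (simp add: ws'_def)
  ultimately have ws': "\<exists>ws. length ws \<le> 2 * (D + 3 * length fs) + 2 \<and> set ws \<subseteq> V \<and>
      V \<subseteq> span (a' ` J' \<union> b' ` J' \<union> set ws)"
    using len(2) by (intro exI[of _ ws'] conjI)
  have "card J \<le> card J' + card K" using card_Diff_subset[OF K(1,2)] card_mono[OF finJ K(2)] by (simp add: J'_def)
  then have "k \<le> card J' + (D + 3 * length fs)" using cardJ K(3) by linarith
  then have "hsys (D + 3 * length fs) J' a' b'"
    unfolding hsys_def using gs' ws' dual1 dual2 a'E b'E finJ by (auto simp: J'_def)
  moreover have "f y = 0" if f: "f \<in> set fs" and y: "y \<in> hspan J' a' b'" for f y
    by (rule lin_span[OF fs[rule_format, OF f] _ y]) (use a'(2) b'(2) J'J f in \<open>auto simp: fs'_def\<close>)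
  ultimately show ?thesis using sub by (intro exI[of _ J'] exI[of _ a'] exI[of _ b']) blast
qed

end

section \<open>Singular vectors, and operators that look like scalars\<close>

context hyp_space
begin

text \<open>In the orthogonal case this is the vanishing of the quadratic form on \<open>p\<close>,
  in characteristic 2 as well, where it is stronger than \<open>B p p = 0\<close>. The decomposition
  along \<open>E\<close> and \<open>E'\<close> expresses it for all types of forms alike.\<close>

definition sing :: "'v \<Rightarrow> bool" where
  "sing p \<longleftrightarrow> (\<exists>x\<in>E. \<exists>y\<in>E'. p = x + y \<and> B x y = 0)"

lemma sing_V: "sing p \<Longrightarrow> p \<in> V"
  using E_sub(2) E'_sub(2) unfolding sing_def by blast

lemma sing_iso: "sing p \<Longrightarrow> B p p = 0"
proof -
  assume "sing p"
  then obtain x y where xy: "x \<in> E" "y \<in> E'" "p = x + y" "B x y = 0" unfolding sing_def by blast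
  then have "x \<in> V" "y \<in> V" using E_sub(2) E'_sub(2) by auto
  then show ?thesis using xy B_refl[of x y] E_iso[of x x] E'_iso[of y y] by (simp add: B_add1 B_simps)
qed

lemma sing_E: "x \<in> E \<Longrightarrow> sing x"
  unfolding sing_def using subspace_0[OF E'_sub(1)]
  by (intro bexI[of _ x] bexI[of _ 0]) (simp_all add: B_simps)

lemma sing_E': "y \<in> E' \<Longrightarrow> sing y"
proof -
  assume y: "y \<in> E'"
  have "0 \<in> E" using subspace_0[OF E_sub(1)] .
  moreover have "B 0 y = 0"
    using B_refl[of y 0] y E'_sub(2) by (auto simp: B_simps)
  ultimately show ?thesis unfolding sing_def using y by (intro bexI[of _ 0] bexI[of _ y]) simp_all
qed

definition lone_pair :: "('v \<Rightarrow> 'v) \<Rightarrow> 'v set \<Rightarrow> bool" where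
  "lone_pair c S \<longleftrightarrow> (\<exists>p\<in>S. \<exists>r\<in>S. sing p \<and> sing r \<and> B p r = 0 \<and> B p (c r) \<noteq> 0)"

text \<open>Without a singular pair \<open>p \<bottom> r\<close> such that \<open>p\<close> is not orthogonal to \<open>c r\<close>, the operator \<open>c\<close> acts as
  a scalar, as far as the form can see.\<close>

lemma weak_scalar:
  assumes S: "hsys D J a b" and c: "linop c" and k: "D + 2 \<le> k"
    and no: "\<not> lone_pair c (hspan J a b)"
  shows "\<exists>lam. \<forall>x\<in>a ` J \<union> b ` J. \<forall>y\<in>a ` J \<union> b ` J. B x (c y) = lam * B x y"
proof -
  note S' = S[unfolded hsys_def]
  have finJ: "finite J" and cardJ: "2 \<le> card J" using S' k by simp_all
  have aE: "\<And>j. j \<in> J \<Longrightarrow> a j \<in> E" and bE: "\<And>j. j \<in> J \<Longrightarrow> b j \<in> E'" using S' by blast+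
  have aV: "\<And>j. j \<in> J \<Longrightarrow> a j \<in> V" and bV: "\<And>j. j \<in> J \<Longrightarrow> b j \<in> V" using hsys_V[OF S] by auto
  have "\<forall>i\<in>J. \<forall>j\<in>J. B (a i) (b j) = (if i = j then e else 0) \<and> B (b i) (a j) = (if i = j then eps * e else 0)"
    using S' by (elim conjE)
  then have ab: "\<And>i j. i \<in> J \<Longrightarrow> j \<in> J \<Longrightarrow> B (a i) (b j) = (if i = j then e else 0)"
    and ba: "\<And>i j. i \<in> J \<Longrightarrow> j \<in> J \<Longrightarrow> B (b i) (a j) = (if i = j then eps * e else 0)"
    by auto
  have as: "\<And>j. j \<in> J \<Longrightarrow> a j \<in> hspan J a b" and bs: "\<And>j. j \<in> J \<Longrightarrow> b j \<in> hspan J a b"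
    by (auto intro: span_base)
  have aa0: "\<And>i j. i \<in> J \<Longrightarrow> j \<in> J \<Longrightarrow> B (a i) (a j) = 0" using E_iso aE by auto
  have bb0: "\<And>i j. i \<in> J \<Longrightarrow> j \<in> J \<Longrightarrow> B (b i) (b j) = 0" using E'_iso bE by auto
  have test: "B p (c r) = 0" if "p \<in> hspan J a b" "r \<in> hspan J a b" "sing p" "sing r" "B p r = 0" for p r
    using no that unfolding lone_pair_def by blast
  define f where "f x y = B x (c y)" for x y
  have f_add2: "f x (y + z) = f x y + f x z" and f_diff2: "f x (y - z) = f x y - f x z"
    and f_scale2: "f x (t *s y) = t * f x y" for x y z t
    using lin_comp[OF lin_B c, of x] lin_diff[OF lin_comp[OF lin_B c], of x y z]
    by (simp_all add: f_def lin_def)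
  have f_add1: "f (x + y) z = f x z + f y z" if "x \<in> V" "y \<in> V" for x y z
    using B_add1[OF that] by (simp add: f_def)
  have testf: "f p r = 0" if "p \<in> hspan J a b" "r \<in> hspan J a b" "sing p" "sing r" "B p r = 0" for p r
    using test[OF that] by (simp add: f_def)
  have faa: "f (a i) (a j) = 0" if "i \<in> J" "j \<in> J" for i j
    by (rule testf) (use that as sing_E aE aa0 in auto)
  have fbb: "f (b i) (b j) = 0" if "i \<in> J" "j \<in> J" for i j
    by (rule testf) (use that bs sing_E' bE bb0 in auto)
  have fab: "f (a i) (b j) = 0" if "i \<in> J" "j \<in> J" "i \<noteq> j" for i j
    by (rule testf) (use that as bs sing_E sing_E' aE bE ab in auto)
  have fba: "f (b i) (a j) = 0" if "i \<in> J" "j \<in> J" "i \<noteq> j" for i j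
    by (rule testf) (use that as bs sing_E sing_E' aE bE ba in auto)
  \<comment> \<open>The test pair is orthogonal because its two diagonal contributions cancel; the
    vanishing of \<open>f\<close> on it then equates two diagonal entries.\<close>
  have eq1: "f (a i) (b i) = f (a j) (b j)" if ij: "i \<in> J" "j \<in> J" "i \<noteq> j" for i j
  proof -
    have "f (a i + a j) (b i - b j) = 0"
    proof (rule testf)
      show "a i + a j \<in> hspan J a b" "b i - b j \<in> hspan J a b"
        by (intro span_add span_diff as bs ij)+
      show "sing (a i + a j)" "sing (b i - b j)"
        by (intro sing_E subspace_add[OF E_sub(1)] aE ij sing_E' subspace_diff[OF E'_sub(1)] bE)+
      show "B (a i + a j) (b i - b j) = 0"
        using ij by (simp add: B_add1 aV B_simps ab)
    qed
    then show ?thesis using ij fab[of i j] fab[of j i] by (simp add: f_add1 f_diff2 aV)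
  qed
  have eq2: "f (b i) (a i) = f (b j) (a j)" if ij: "i \<in> J" "j \<in> J" "i \<noteq> j" for i j
  proof -
    have "f (b i + b j) (a i - a j) = 0"
    proof (rule testf)
      show "b i + b j \<in> hspan J a b" "a i - a j \<in> hspan J a b"
        by (intro span_add span_diff as bs ij)+
      show "sing (b i + b j)" "sing (a i - a j)"
        by (intro sing_E subspace_diff[OF E_sub(1)] aE ij sing_E' subspace_add[OF E'_sub(1)] bE)+
      show "B (b i + b j) (a i - a j) = 0"
        using ij by (simp add: B_add1 bV B_simps ba)
    qed
    then show ?thesis using ij fba[of i j] fba[of j i] by (simp add: f_add1 f_diff2 bV)
  qed
  \<comment> \<open>This pair mixes the two isotropic spaces and links the scalar between
    \<open>a i\<close> and \<open>b i\<close> with the one between \<open>b j\<close> and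
    \<open>a j\<close>. Without it \<open>c\<close> could act by different scalars on the two
    halves.\<close>
  have eq3: "f (b j) (a j) = eps * f (a i) (b i)" if ij: "i \<in> J" "j \<in> J" "i \<noteq> j" for i j
  proof -
    have "f (a i + b j) (a j + (- eps) *s b i) = 0"
    proof (rule testf)
      show "a i + b j \<in> hspan J a b" "a j + (- eps) *s b i \<in> hspan J a b"
        by (intro span_add span_scale as bs ij)+
      show "sing (a i + b j)" unfolding sing_def
        using ij ab aE bE by (intro bexI[of _ "a i"] bexI[of _ "b j"]) auto
      have "(- eps) *s b i \<in> E'" by (intro subspace_scale[OF E'_sub(1)] bE ij)
      moreover have "B (a j) ((- eps) *s b i) = 0" unfolding B_scale2 using ij by (simp add: ab)
      ultimately show "sing (a j + (- eps) *s b i)" unfolding sing_def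
        using ij aE by (intro bexI[of _ "a j"] bexI[of _ "(- eps) *s b i"]) auto
      show "B (a i + b j) (a j + (- eps) *s b i) = 0"
        unfolding B_add1[OF aV[OF ij(1)] bV[OF ij(2)]] B_add2 B_scale2
        using ij by (simp add: ab ba aa0 bb0)
    qed
    then show ?thesis
      unfolding f_add1[OF aV[OF ij(1)] bV[OF ij(2)]] f_add2 f_scale2 using ij faa fbb by simp
  qed
  obtain i0 where i0: "i0 \<in> J" using cardJ by fastforce
  have "card (J - {i0}) \<noteq> 0" using cardJ i0 finJ by simp
  then obtain i1 where i1: "i1 \<in> J" "i1 \<noteq> i0"
    by (metis Diff_iff card.empty ex_in_conv singletonI)
  define lam where "lam = f (a i0) (b i0)"
  have lam_e: "lam * e = lam"
    using e_field[OF lin_B V_linop[OF c bV[OF i0]]] by (simp add: lam_def f_def mult.commute)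
  have l1: "f (a i) (b i) = lam" if "i \<in> J" for i
    using eq1[OF that i0] by (cases "i = i0") (auto simp: lam_def)
  have "f (b i1) (a i1) = eps * lam" using eq3[OF i0 i1(1)] i1(2) by (simp add: lam_def)
  then have l2: "f (b i) (a i) = eps * lam" if "i \<in> J" for i
    using eq2[OF that i1(1)] by (cases "i = i1") auto
  have "B x (c y) = lam * B x y" if "x \<in> a ` J \<union> b ` J" "y \<in> a ` J \<union> b ` J" for x y
  proof -
    have m: "lam * (eps * e) = eps * lam" using lam_e by (metis mult.left_commute)
    have "f x y = lam * B x y"
      using that by (auto simp: faa fbb aa0 bb0 fab fba ab ba l1 l2 lam_e m)
    then show ?thesis by (simp add: f_def)
  qed
  then show ?thesis by blast
qed

text \<open>Commuting with a transvection along \<open>p\<close> and \<open>r\<close> requires that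
  \<open>c\<close> scales these vectors and also the forms \<open>B p\<close> and
  \<open>B r\<close>; hence the two-sided conclusion. For \<open>d = c - lam\<close>, the control
  functionals composed with \<open>d\<close> yield the first part, the forms \<open>B (d w)\<close>
  of the control vectors \<open>w\<close> the second. These are at most \<open>4 * D + 4\<close>
  functionals, and \<open>D + 3 * (4 * D + 4) = 13 * D + 12\<close>.\<close>

lemma near_scalar:
  assumes S: "hsys D J a b" and c: "linop c" and k: "D + 2 \<le> k"
    and no: "\<not> lone_pair c (hspan J a b)"
  shows "\<exists>lam J' a' b'. hsys (13 * D + 12) J' a' b' \<and> hspan J' a' b' \<subseteq> hspan J a b \<and>
    (\<forall>y\<in>hspan J' a' b'. c y = lam *s y \<and> (\<forall>z\<in>V. B y (c z) = lam * B y z))"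
proof -
  note S' = S[unfolded hsys_def]
  have "\<exists>gs. length gs \<le> 2 * D + 2 \<and> (\<forall>g\<in>set gs. lin g) \<and>
      (\<forall>z\<in>V. (\<forall>j\<in>J. B (a j) z = 0 \<and> B (b j) z = 0) \<longrightarrow> (\<forall>g\<in>set gs. g z = 0) \<longrightarrow> z = 0)"
    using S' by (elim conjE)
  then obtain gs where gs: "length gs \<le> 2 * D + 2" "\<forall>g\<in>set gs. lin g"
    "\<forall>z\<in>V. (\<forall>j\<in>J. B (a j) z = 0 \<and> B (b j) z = 0) \<longrightarrow> (\<forall>g\<in>set gs. g z = 0) \<longrightarrow> z = 0"
    by (elim exE conjE)
  have "\<exists>ws. length ws \<le> 2 * D + 2 \<and> set ws \<subseteq> V \<and> V \<subseteq> span (a ` J \<union> b ` J \<union> set ws)"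
    using S' by (elim conjE)
  then obtain ws where ws: "length ws \<le> 2 * D + 2" "set ws \<subseteq> V" "V \<subseteq> span (a ` J \<union> b ` J \<union> set ws)"
    by (elim exE conjE)
  obtain lam where lam: "\<And>x y. x \<in> a ` J \<union> b ` J \<Longrightarrow> y \<in> a ` J \<union> b ` J \<Longrightarrow> B x (c y) = lam * B x y"
    using weak_scalar[OF assms] by blast
  define d where "d y = c y - lam *s y" for y
  have dV: "d y \<in> V" if "y \<in> V" for y
    using V_linop[OF c that] that V_closed by (simp add: d_def)
  have d: "linop d"
    unfolding linop_def
  proof (intro conjI allI ballI)
    show "d (x + y) = d x + d y" for x y using c by (simp add: d_def linop_def algebra_simps)
    show "d (t *s x) = t *s d x" for t x
      using c by (simp add: d_def linop_def algebra_simps)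
  qed (rule dV)
  define fs where "fs = map (\<lambda>g y. g (d y)) gs @ map (\<lambda>w. B (d w)) ws"
  have fs: "\<forall>f\<in>set fs. lin f"
  proof -
    have "lin (\<lambda>y. g (d y))" if "g \<in> set gs" for g
      by (rule lin_comp[OF _ d]) (use gs(2) that in auto)
    then show ?thesis using lin_B by (auto simp: fs_def)
  qed
  have len: "length fs \<le> 4 * D + 4" using gs(1) ws(1) by (simp add: fs_def)
  from cut[OF S fs] obtain J' a' b' where S1: "hsys (D + 3 * length fs) J' a' b'"
    "hspan J' a' b' \<subseteq> hspan J a b" and zero: "\<forall>f\<in>set fs. \<forall>y\<in>hspan J' a' b'. f y = 0"
    by (elim exE conjE)
  have "hsys (13 * D + 12) J' a' b'" by (rule hsys_mono[OF S1(1)]) (use len in simp)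
  moreover have Bd: "B x (d y) = 0" if "x \<in> a ` J \<union> b ` J" "y \<in> hspan J a b" for x y
  proof (rule lin_span[OF lin_comp[OF lin_B d] _ that(2)])
    show "B x (d y) = 0" if "y \<in> a ` J \<union> b ` J" for y
      using lam[OF \<open>x \<in> a ` J \<union> b ` J\<close> that] by (simp add: d_def B_simps)
  qed
  have d0: "d y = 0" if y: "y \<in> hspan J' a' b'" for y
  proof -
    have yS: "y \<in> hspan J a b" using y S1(2) by auto
    then have "d y \<in> V" using dV hsys_V[OF S] by auto
    moreover have "\<forall>j\<in>J. B (a j) (d y) = 0 \<and> B (b j) (d y) = 0" using Bd yS by auto
    moreover have "\<forall>g\<in>set gs. g (d y) = 0" using zero y by (auto simp: fs_def)
    ultimately show ?thesis using gs(3) by blast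
  qed
  have Bd2: "B y (d z) = 0" if y: "y \<in> hspan J' a' b'" and z: "z \<in> V" for y z
  proof (rule lin_span[OF lin_comp[OF lin_B d], of "a ` J \<union> b ` J \<union> set ws"])
    have yS: "y \<in> hspan J a b" using y S1(2) by auto
    then have yV: "y \<in> V" using hsys_V[OF S] by auto
    show "z \<in> span (a ` J \<union> b ` J \<union> set ws)" using ws(3) z by auto
    show "B y (d x) = 0" if "x \<in> a ` J \<union> b ` J \<union> set ws" for x
    proof (cases "x \<in> set ws")
      case True
      then have "B (d x) y = 0" using zero y by (auto simp: fs_def)
      moreover have "d x \<in> V" using True ws(2) dV by auto
      ultimately show ?thesis using B_refl yV by auto
    next
      case False
      then have x: "x \<in> a ` J \<union> b ` J" using that by auto
      then have "x \<in> hspan J a b" by (rule span_base)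
      moreover have "d x \<in> V" using x hsys_V(1)[OF S] dV by blast
      ultimately show ?thesis using B_span1[OF hsys_V(1)[OF S] _ _ yS] Bd by blast
    qed
  qed
  have "\<forall>y\<in>hspan J' a' b'. c y = lam *s y \<and> (\<forall>z\<in>V. B y (c z) = lam * B y z)"
    using d0 Bd2 by (simp add: d_def B_simps)
  then show ?thesis using S1(2) calculation by blast
qed

text \<open>Meant for constants that are not critical, where \<open>p\<close> and \<open>r\<close>
  need not be orthogonal. If all \<open>B p (c r)\<close> vanished, a nonzero \<open>r\<close>
  cleared of the control functionals composed with \<open>c\<close> would satisfy
  \<open>c r = 0\<close>. The clearing needs \<open>D + 3 * (2 * D + 2) < k\<close>.\<close>

lemma nonzero_pair:
  assumes S: "hsys D J a b" and c: "linop c" and inj: "\<And>y. y \<in> V \<Longrightarrow> c y = 0 \<Longrightarrow> y = 0"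
    and k: "7 * D + 7 \<le> k"
  shows "\<exists>p\<in>hspan J a b. \<exists>r\<in>hspan J a b. sing p \<and> sing r \<and> B p (c r) \<noteq> 0"
proof (rule ccontr)
  assume no: "\<not> ?thesis"
  note S' = S[unfolded hsys_def]
  have "\<exists>gs. length gs \<le> 2 * D + 2 \<and> (\<forall>g\<in>set gs. lin g) \<and>
      (\<forall>z\<in>V. (\<forall>j\<in>J. B (a j) z = 0 \<and> B (b j) z = 0) \<longrightarrow> (\<forall>g\<in>set gs. g z = 0) \<longrightarrow> z = 0)"
    using S' by (elim conjE)
  then obtain gs where gs: "length gs \<le> 2 * D + 2" "\<forall>g\<in>set gs. lin g"
    "\<forall>z\<in>V. (\<forall>j\<in>J. B (a j) z = 0 \<and> B (b j) z = 0) \<longrightarrow> (\<forall>g\<in>set gs. g z = 0) \<longrightarrow> z = 0"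
    by (elim exE conjE)
  define fs where "fs = map (\<lambda>g y. g (c y)) gs"
  have fs: "\<forall>f\<in>set fs. lin f" using lin_comp[OF _ c] gs(2) by (auto simp: fs_def)
  from cut[OF S fs] obtain J' a' b' where S1: "hsys (D + 3 * length fs) J' a' b'"
    "hspan J' a' b' \<subseteq> hspan J a b" and zero: "\<forall>f\<in>set fs. \<forall>y\<in>hspan J' a' b'. f y = 0"
    by (elim exE conjE)
  have "J' \<noteq> {}" using S1(1) k gs(1) by (auto simp: hsys_def fs_def)
  then obtain j where j: "j \<in> J'" by blast
  have y: "b' j \<in> hspan J' a' b'" using j by (auto intro: span_base)
  have yE: "b' j \<in> E'" and yB: "B (a' j) (b' j) = e" using S1(1) j by (auto simp: hsys_def)
  have yV: "b' j \<in> V" using yE E'_sub(2) by auto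
  have "B x (c (b' j)) = 0" if "x \<in> a ` J \<union> b ` J" for x
  proof -
    have "sing x" using that S' sing_E sing_E' by blast
    moreover have "x \<in> hspan J a b" using that by (rule span_base)
    ultimately show ?thesis using no sing_E'[OF yE] y S1(2) by blast
  qed
  then have "\<forall>j'\<in>J. B (a j') (c (b' j)) = 0 \<and> B (b j') (c (b' j)) = 0" by auto
  moreover have "\<forall>g\<in>set gs. g (c (b' j)) = 0" using zero y by (auto simp: fs_def)
  ultimately have "c (b' j) = 0" using gs(3) V_linop[OF c yV] by blast
  then have "b' j = 0" using inj[OF yV] by simp
  then show False using yB e_nz by (simp add: B_simps)
qed

end

section \<open>Transvections and the selection of singular pairs\<close>

context hyp_space
begin

text \<open>The Siegel (Eichler) transformation along \<open>p\<close> and \<open>r\<close>. For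
  orthogonal isotropic \<open>p\<close> and \<open>r\<close> it has the form \<open>1 + s N\<close>
  with \<open>N N = 0\<close>, so changing the sign of \<open>s\<close> inverts it.\<close>

definition transv :: "'a \<Rightarrow> 'v \<Rightarrow> 'v \<Rightarrow> 'v \<Rightarrow> 'v" where
  "transv s p r y = y + s *s (B p y *s r - (eps * B r y) *s p)"

text \<open>The coefficients are signs so that the maps are isometries in the Hermitian case too,
  see \<open>transv_preserves_B\<close>.\<close>

inductive_set grp :: "'v set \<Rightarrow> ('v \<Rightarrow> 'v) set" for S where
  id: "(\<lambda>z. z) \<in> grp S"
| step: "g \<in> grp S \<Longrightarrow> p \<in> S \<Longrightarrow> r \<in> S \<Longrightarrow> sing p \<Longrightarrow> sing r \<Longrightarrow> B p r = 0 \<Longrightarrow> s = 1 \<or> s = - 1 \<Longrightarrow>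
    (\<lambda>z. transv s p r (g z)) \<in> grp S"

definition vals :: "'v set \<Rightarrow> (letter \<Rightarrow> 'v \<Rightarrow> 'v) set" where
  "vals S = {\<rho>. (\<forall>x. \<rho> x \<in> grp S) \<and> (\<forall>x z. \<rho> x (\<rho> (inv_letter x) z) = z)}"

lemma transv_V: "sing p \<Longrightarrow> sing r \<Longrightarrow> y \<in> V \<Longrightarrow> transv s p r y \<in> V"
  unfolding transv_def by (intro V_closed) (auto dest: sing_V)

lemma grp_V: "g \<in> grp S \<Longrightarrow> z \<in> V \<Longrightarrow> g z \<in> V"
  by (induction rule: grp.induct) (auto intro: transv_V)

lemma grp_mono: "S \<subseteq> S' \<Longrightarrow> g \<in> grp S \<Longrightarrow> g \<in> grp S'"
  by (rotate_tac, induction rule: grp.induct) (auto intro: grp.intros)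

lemma grp_comp:
  assumes "g \<in> grp S" "h \<in> grp S"
  shows "(\<lambda>z. g (h z)) \<in> grp S"
  using assms(1)
proof (induction rule: grp.induct)
  case id
  show ?case using assms(2) by simp
next
  case (step g p r s)
  show ?case by (rule grp.step[OF step.IH step(2-7)])
qed

lemma vals_mono: "S \<subseteq> S' \<Longrightarrow> vals S \<subseteq> vals S'"
  using grp_mono by (auto simp: vals_def)

lemma merge_vals:
  assumes "\<rho> \<in> vals S"
  shows "merge_val \<rho> \<in> vals S"
proof -
  have g: "\<rho> x \<in> grp S" and i: "\<rho> x (\<rho> (inv_letter x) z) = z" for x z
    using assms unfolding vals_def by blast+
  have "merge_val \<rho> x \<in> grp S" for x
    by (cases x) (simp add: merge_val_def grp_comp[OF g g])
  moreover have "merge_val \<rho> x (merge_val \<rho> (inv_letter x) z) = z" for x z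
    using i[of "(2 * fst x, True)"] i[of "(2 * fst x, False)"]
      i[of "(2 * fst x + 1, True)"] i[of "(2 * fst x + 1, False)"]
    by (cases x) (simp add: merge_val_def inv_letter_def)
  ultimately show ?thesis by (simp add: vals_def)
qed

lemma grp_commute:
  assumes c: "linop c" and S: "\<And>y. y \<in> S \<Longrightarrow> c y = lam *s y" "\<And>y z. y \<in> S \<Longrightarrow> z \<in> V \<Longrightarrow> B y (c z) = lam * B y z"
    and g: "g \<in> grp S" and z: "z \<in> V"
  shows "g (c z) = c (g z)"
  using g
proof (induction rule: grp.induct)
  case (step g p r s)
  let ?w = "g z"
  have w: "?w \<in> V" using grp_V step z by auto
  have c_add: "c (x + y) = c x + c y" and c_scale: "c (t *s x) = t *s c x" for x y t
    using c by (simp_all add: linop_def)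
  have c_diff: "c (x - y) = c x - c y" for x y
    using c_add[of "x - y" y] by simp
  have "transv s p r (c ?w) = c ?w + s *s ((lam * B p ?w) *s r - (eps * (lam * B r ?w)) *s p)"
    using S(2)[OF _ w] step by (simp add: transv_def)
  also have "\<dots> = c (transv s p r ?w)"
    using S(1) step by (simp add: transv_def c_add c_scale c_diff mult_ac)
  finally show ?case using step by simp
qed simp

text \<open>The slack \<open>R\<close> leaves room for the selection: a far constant still has a
  suitable pair inside every subsystem reached by cuts of total cost at most \<open>R\<close>. A
  constant that is not far comes with a system of defect \<open>D + R\<close> to which
  \<open>near_scalar\<close> applies.\<close>

definition far :: "nat \<Rightarrow> nat \<Rightarrow> 'v set \<Rightarrow> ('v \<Rightarrow> 'v) \<Rightarrow> bool" where
  "far R D S c \<longleftrightarrow> (\<forall>J a b. hsys (D + R) J a b \<longrightarrow> hspan J a b \<subseteq> S \<longrightarrow> lone_pair c (hspan J a b))"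

definition orth :: "('v \<Rightarrow> 'v) list \<Rightarrow> 'v \<Rightarrow> 'v \<Rightarrow> bool" where
  "orth Cl x y \<longleftrightarrow> (\<forall>C\<in>set Cl. B x (C y) = 0 \<and> B y (C x) = 0)"

lemma orth_sym: "orth Cl x y \<Longrightarrow> orth Cl y x"
  by (auto simp: orth_def)

text \<open>The pairs \<open>(p\<^sub>i, r\<^sub>i)\<close> are chosen one after the other, each orthogonal to the previous ones under
  the operators \<open>Cl\<close>.\<close>

lemma select_pairs:
  assumes S: "hsys D J0 a0 b0" and Cl: "\<forall>C\<in>set Cl. linop C"
    and c: "\<And>i. i < n \<Longrightarrow> linop (c i)" "\<And>i y. i < n \<Longrightarrow> y \<in> V \<Longrightarrow> c i y = 0 \<Longrightarrow> y = 0"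
    and cr: "\<And>i. i < n \<Longrightarrow> cr i \<Longrightarrow> far R D (hspan J0 a0 b0) (c i)"
    and R: "12 * length Cl * n \<le> R" and k: "7 * (D + R) + 7 \<le> k" and m: "m \<le> n"
  shows "\<exists>p r J a b. hsys (D + 12 * length Cl * m) J a b \<and> hspan J a b \<subseteq> hspan J0 a0 b0 \<and>
    (\<forall>i<m. p i \<in> hspan J0 a0 b0 \<and> r i \<in> hspan J0 a0 b0 \<and> sing (p i) \<and> sing (r i) \<and>
      B (p i) (c i (r i)) \<noteq> 0 \<and> (cr i \<longrightarrow> B (p i) (r i) = 0)) \<and>
    (\<forall>i<m. \<forall>x\<in>{p i, r i}. \<forall>y\<in>hspan J a b. orth Cl x y) \<and>
    (\<forall>i<m. \<forall>j<m. i \<noteq> j \<longrightarrow> (\<forall>x\<in>{p i, r i}. \<forall>y\<in>{p j, r j}. orth Cl x y))"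
  using m
proof (induction m)
  case 0
  show ?case using S by (intro exI[of _ "\<lambda>_. 0"] exI[of _ J0] exI[of _ a0] exI[of _ b0]) simp
next
  case (Suc m)
  let ?S0 = "hspan J0 a0 b0"
  have "m \<le> n" using Suc by simp
  from Suc.IH[OF this] obtain p r J a b where H: "hsys (D + 12 * length Cl * m) J a b" "hspan J a b \<subseteq> ?S0"
    and good: "\<forall>i<m. p i \<in> ?S0 \<and> r i \<in> ?S0 \<and> sing (p i) \<and> sing (r i) \<and>
      B (p i) (c i (r i)) \<noteq> 0 \<and> (cr i \<longrightarrow> B (p i) (r i) = 0)"
    and o1: "\<forall>i<m. \<forall>x\<in>{p i, r i}. \<forall>y\<in>hspan J a b. orth Cl x y"
    and o2: "\<forall>i<m. \<forall>j<m. i \<noteq> j \<longrightarrow> (\<forall>x\<in>{p i, r i}. \<forall>y\<in>{p j, r j}. orth Cl x y)"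
    by (elim exE conjE)
  have mn: "m < n" using Suc by simp
  have "12 * length Cl * m \<le> 12 * length Cl * n" using mn by (intro mult_le_mono) auto
  from add_left_mono[OF order_trans[OF this R]] have DR: "D + 12 * length Cl * m \<le> D + R" .
  have "\<exists>p'\<in>hspan J a b. \<exists>r'\<in>hspan J a b. sing p' \<and> sing r' \<and> B p' (c m r') \<noteq> 0 \<and> (cr m \<longrightarrow> B p' r' = 0)"
  proof (cases "cr m")
    case True
    have "lone_pair (c m) (hspan J a b)"
      using cr[OF mn True] hsys_mono[OF H(1) DR] H(2) unfolding far_def by blast
    then show ?thesis unfolding lone_pair_def by blast
  next
    case False
    have "7 * (D + 12 * length Cl * m) + 7 \<le> k" using DR k by simp
    from nonzero_pair[OF H(1) c(1)[OF mn] c(2)[OF mn] this] False show ?thesis by blast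
  qed
  then obtain p' r' where pr': "p' \<in> hspan J a b" "r' \<in> hspan J a b" "sing p'" "sing r'"
    "B p' (c m r') \<noteq> 0" "cr m \<longrightarrow> B p' r' = 0" by blast
  \<comment> \<open>Four functionals for each operator; the last two give
    \<open>B y (C x) = 0\<close> by reflexivity. At three pairs per functional, one selection costs
    \<open>12 * length Cl\<close>.\<close>
  define fs where "fs = concat (map (\<lambda>C. [\<lambda>y. B p' (C y), \<lambda>y. B r' (C y), B (C p'), B (C r')]) Cl)"
  have fs: "\<forall>f\<in>set fs. lin f"
  proof -
    have "\<forall>f\<in>set [\<lambda>y. B p' (C y), \<lambda>y. B r' (C y), B (C p'), B (C r')]. lin f" if "C \<in> set Cl" for C
      using lin_comp[OF lin_B, of C] lin_B Cl that by simp
    then show ?thesis by (simp add: fs_def)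
  qed
  have "length fs = 4 * length Cl" unfolding fs_def by (induction Cl) auto
  then have len: "D + 12 * length Cl * m + 3 * length fs = D + 12 * length Cl * Suc m" by simp
  from cut[OF H(1) fs] obtain J' a' b' where S1: "hsys (D + 12 * length Cl * Suc m) J' a' b'"
    "hspan J' a' b' \<subseteq> hspan J a b" and zero: "\<forall>f\<in>set fs. \<forall>y\<in>hspan J' a' b'. f y = 0"
    unfolding len by (elim exE conjE)
  have onew: "orth Cl x y" if x: "x \<in> {p', r'}" and y: "y \<in> hspan J' a' b'" for x y
    unfolding orth_def
  proof (intro ballI conjI)
    fix C assume C: "C \<in> set Cl"
    have yV: "y \<in> V" using y hsys_V(2)[OF S1(1)] by auto
    have z: "B p' (C y) = 0 \<and> B r' (C y) = 0 \<and> B (C p') y = 0 \<and> B (C r') y = 0"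
      using zero y C by (auto simp: fs_def)
    then show "B x (C y) = 0" using x by auto
    have "C x \<in> V" using V_linop[of C x] Cl C x sing_V pr' by auto
    then show "B y (C x) = 0" using B_refl[of "C x" y] z x yV by auto
  qed
  define p1 r1 where "p1 = p(m := p')" and "r1 = r(m := r')"
  have "\<forall>i<Suc m. p1 i \<in> ?S0 \<and> r1 i \<in> ?S0 \<and> sing (p1 i) \<and> sing (r1 i) \<and>
      B (p1 i) (c i (r1 i)) \<noteq> 0 \<and> (cr i \<longrightarrow> B (p1 i) (r1 i) = 0)"
    using good pr' H(2) by (auto simp: p1_def r1_def less_Suc_eq)
  moreover have "\<forall>i<Suc m. \<forall>x\<in>{p1 i, r1 i}. \<forall>y\<in>hspan J' a' b'. orth Cl x y"
  proof (intro allI impI ballI)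
    fix i x y assume i: "i < Suc m" "x \<in> {p1 i, r1 i}" "y \<in> hspan J' a' b'"
    show "orth Cl x y"
      using onew[of x y] o1[rule_format, of i x y] i S1(2) by (cases "i = m") (auto simp: p1_def r1_def)
  qed
  moreover have "\<forall>i<Suc m. \<forall>j<Suc m. i \<noteq> j \<longrightarrow> (\<forall>x\<in>{p1 i, r1 i}. \<forall>y\<in>{p1 j, r1 j}. orth Cl x y)"
  proof (intro allI impI ballI)
    fix i j x y assume ij: "i < Suc m" "j < Suc m" "i \<noteq> j" "x \<in> {p1 i, r1 i}" "y \<in> {p1 j, r1 j}"
    consider "i < m" "j < m" | "i = m" "j < m" | "j = m" "i < m" using ij by linarith
    then show "orth Cl x y"
    proof cases
      case 1
      then show ?thesis using o2[rule_format, of i j x y] ij by (auto simp: p1_def r1_def)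
    next
      case 2
      have "x \<in> hspan J a b" using ij 2 pr' by (auto simp: p1_def r1_def)
      then show ?thesis using o1[rule_format, of j y x] ij 2 orth_sym by (auto simp: p1_def r1_def)
    next
      case 3
      have "y \<in> hspan J a b" using ij 3 pr' by (auto simp: p1_def r1_def)
      then show ?thesis using o1[rule_format, of i x y] ij 3 by (auto simp: p1_def r1_def)
    qed
  qed
  moreover have "hspan J' a' b' \<subseteq> ?S0" using S1(2) H(2) by auto
  ultimately show ?case using S1(1)
    by (intro exI[of _ p1] exI[of _ r1] exI[of _ J'] exI[of _ a'] exI[of _ b'] conjI)
qed

end

text \<open>The composite of \<open>c m\<close> up to \<open>c (m + n - 1)\<close>: what a vector
  undergoes on the way if the letters in between leave it unchanged.\<close>

fun interval_comp :: "(nat \<Rightarrow> 'x \<Rightarrow> 'x) \<Rightarrow> nat \<Rightarrow> nat \<Rightarrow> 'x \<Rightarrow> 'x" where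
  "interval_comp c m 0 z = z"
| "interval_comp c m (Suc n) z = interval_comp c m n (c (m + n) z)"

section \<open>Following a vector through a word\<close>

context hyp_space
begin

lemma linop_interval_comp:
  assumes "\<And>i. i < N \<Longrightarrow> linop (c i)" "m + n \<le> N"
  shows "linop (interval_comp c m n)"
  using assms(2)
proof (induction n)
  case 0
  then show ?case by (simp add: linop_def)
next
  case (Suc n)
  then have "linop (interval_comp c m n)" "linop (c (m + n))" using assms(1) by auto
  then show ?case by (simp add: linop_def)
qed

text \<open>The values of the letters are products of the commuting transvections along \<open>p\<^sub>a\<close> and
  \<open>r\<^sub>a\<^sub>-\<^sub>1\<close>, where \<open>a\<close> runs over the positions of the letter.  Followed from right to left, the image of
  \<open>r\<^sub>L\<close> is seen by \<open>p\<^sub>L, p\<^sub>L\<^sub>-\<^sub>1, \<dots>, p\<^sub>0\<close> in turn.\<close>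

lemma path_argument:
  fixes lt :: "nat \<Rightarrow> letter" and c :: "nat \<Rightarrow> 'v \<Rightarrow> 'v"
  assumes c: "\<And>i. i \<le> L \<Longrightarrow> linop (c i)"
    and Cl: "\<And>m n. m + n \<le> L + 1 \<Longrightarrow> interval_comp c m n \<in> set Cl"
    and pr: "\<And>i. i \<le> L \<Longrightarrow> p i \<in> S \<and> r i \<in> S \<and> sing (p i) \<and> sing (r i) \<and> B (p i) (c i (r i)) \<noteq> 0"
    and o: "\<And>i j x y. i \<le> L \<Longrightarrow> j \<le> L \<Longrightarrow> i \<noteq> j \<Longrightarrow> x \<in> {p i, r i} \<Longrightarrow> y \<in> {p j, r j} \<Longrightarrow> orth Cl x y"
    and cr: "\<And>i. 1 \<le> i \<Longrightarrow> i < L \<Longrightarrow> fst (lt i) = fst (lt (Suc i)) \<Longrightarrow> B (p i) (r i) = 0"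
    and L: "1 \<le> L"
  shows "\<exists>\<rho>\<in>vals S. \<forall>y. y L = r L \<longrightarrow> (\<forall>a\<in>{1..L}. y (a - 1) = \<rho> (lt a) (c a (y a))) \<longrightarrow>
    B (p 0) (c 0 (y 0)) \<noteq> 0"
proof -
  have o1: "B x y = 0" if "i \<le> L" "j \<le> L" "i \<noteq> j" "x \<in> {p i, r i}" "y \<in> {p j, r j}" for i j x y
  proof -
    have "interval_comp c 0 0 \<in> set Cl" by (rule Cl) simp
    then have "B x (interval_comp c 0 0 y) = 0" using o[OF that] unfolding orth_def by blast
    then show ?thesis by simp
  qed
  have oC: "B x (interval_comp c m n y) = 0"
    if "m + n \<le> L + 1" "i \<le> L" "j \<le> L" "i \<noteq> j" "x \<in> {p i, r i}" "y \<in> {p j, r j}" for i j x y m n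
    using o[OF that(2-6)] Cl[OF that(1)] unfolding orth_def by blast
  define A where "A i = {a \<in> {1..L}. fst (lt a) = i}" for i
  have finA: "finite (A i)" for i by (simp add: A_def)
  define N where "N a z = B (p a) z *s r (a - 1) - (eps * B (r (a - 1)) z) *s p a" for a z
  have pV: "p i \<in> V" and rV: "r i \<in> V" if "i \<le> L" for i using pr[OF that] sing_V by auto
  \<comment> \<open>All vectors attached to one index must be mutually orthogonal. Selection and
    isotropy give this except for \<open>p a\<close> against \<open>r (b - 1)\<close> with
    \<open>b = a + 1\<close>; these are neighbouring positions with the same index, where
    \<open>cr\<close> applies.\<close>
  have kill: "B x y = 0" if ab: "a \<in> A i" "b \<in> A i" and "x \<in> {p a, r (a - 1)}" "y \<in> {p b, r (b - 1)}" for i a b x y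
  proof -
    have a: "1 \<le> a" "a \<le> L" "b \<le> L" "1 \<le> b" using ab by (auto simp: A_def)
    have pp: "B (p a) (p b) = 0" using o1[of a b "p a" "p b"] a sing_iso[of "p a"] pr by (cases "a = b") auto
    have rr: "B (r (a - 1)) (r (b - 1)) = 0"
      using o1[of "a - 1" "b - 1"] a sing_iso[of "r (a - 1)"] pr[of "a - 1"] by (cases "a = b") auto
    have pr0: "B (p a) (r (b - 1)) = 0" if "1 \<le> a" "a \<le> L" "1 \<le> b" "b \<le> L" "fst (lt a) = fst (lt b)" for a b
    proof (cases "b = Suc a")
      case True
      then show ?thesis using cr[of a] that by auto
    next
      case False
      then show ?thesis using o1[of a "b - 1" "p a" "r (b - 1)"] that by auto
    qed
    have "B (p a) (r (b - 1)) = 0" "B (p b) (r (a - 1)) = 0"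
      using pr0[of a b] pr0[of b a] ab a by (auto simp: A_def)
    moreover have "B (r (a - 1)) (p b) = 0"
      using calculation(2) B_refl[of "p b" "r (a - 1)"] pV rV a by auto
    ultimately show ?thesis using pp rr that(3,4) by auto
  qed
  have NN: "N a (N b z) = 0" if "a \<in> A i" "b \<in> A i" for i a b z
    using kill[OF that] by (simp add: N_def B_simps)
  have N_add: "N a (x + y) = N a x + N a y" and N_scale: "N a (t *s x) = t *s N a x" for a x y t
    by (simp_all add: N_def B_add2 B_scale2 algebra_simps)
  define X where "X s i z = z + s *s (\<Sum>a\<in>A i. N a z)" for s i z
  have N_sum: "N a (\<Sum>b\<in>T. f b) = (\<Sum>b\<in>T. N a (f b))" if "finite T" for a T and f :: "nat \<Rightarrow> 'v"
    using that N_scale[of a 0 0] by (induction T) (auto simp: N_add)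
  have XX: "X s i (X (- s) i z) = z" for s i z
  proof -
    have "(\<Sum>a\<in>A i. N a (X (- s) i z)) = (\<Sum>a\<in>A i. N a z)"
      by (rule sum.cong) (auto simp: X_def N_add N_scale N_sum[OF finA] NN simp del: scale_minus_left)
    then show ?thesis by (simp add: X_def)
  qed
  \<comment> \<open>Along the path it only matters that a coefficient is nonzero, so the sign
    belonging to the exponent of the letter does no harm.\<close>
  define \<rho> where "\<rho> x = X (if snd x then 1 else - 1) (fst x)" for x :: letter
  have Xgrp: "(\<lambda>z. z + s *s (\<Sum>a\<in>T. N a z)) \<in> grp S" if "s = 1 \<or> s = - 1" "T \<subseteq> A i" for s T i
  proof -
    have "finite T" using that(2) finA finite_subset by auto
    then show ?thesis using that(2)
    proof (induction T)
      case empty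
      show ?case using grp.id by simp
    next
      case (insert a T)
      let ?g = "\<lambda>z. z + s *s (\<Sum>a\<in>T. N a z)"
      have a: "a \<in> A i" "1 \<le> a" "a \<le> L" using insert by (auto simp: A_def)
      have "N a (?g z) = N a z" for z
      proof -
        have "N a (\<Sum>b\<in>T. N b z) = (\<Sum>b\<in>T. 0)"
          unfolding N_sum[OF insert(1)] by (rule sum.cong) (use NN[OF a(1)] insert in auto)
        then show ?thesis by (simp add: N_add N_scale)
      qed
      moreover have "transv s (p a) (r (a - 1)) w = w + s *s N a w" for w
        by (simp only: transv_def N_def)
      ultimately have "transv s (p a) (r (a - 1)) (?g z) = z + s *s (\<Sum>a\<in>insert a T. N a z)" for z
        using insert(1,2) by (simp add: scale_right_distrib add_ac)
      moreover have IH: "?g \<in> grp S" using insert by auto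
      have "(\<lambda>z. transv s (p a) (r (a - 1)) (?g z)) \<in> grp S"
        by (rule grp.step[OF IH]) (use a pr[of a] pr[of "a - 1"] kill[OF a(1) a(1)] that(1) in auto)
      ultimately show ?case by simp
    qed
  qed
  have "\<rho> x \<in> grp S" for x
    using Xgrp[of "if snd x then 1 else - 1" "A (fst x)" "fst x"]
    unfolding \<rho>_def X_def[abs_def] by (cases "snd x") simp_all
  moreover have "\<rho> x (\<rho> (inv_letter x) z) = z" for x z
    using XX[of 1 "fst x" z] XX[of "- 1" "fst x" z] by (auto simp: \<rho>_def inv_letter_def)
  ultimately have \<rho>: "\<rho> \<in> vals S" by (simp add: vals_def)
  have "B (p 0) (c 0 (y 0)) \<noteq> 0"
    if yL: "y L = r L" and step: "\<And>a. a \<in> {1..L} \<Longrightarrow> y (a - 1) = \<rho> (lt a) (c a (y a))" for y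
  proof -
    \<comment> \<open>The invariant: vectors of positions still ahead do not see the current vector,
      even through a run of constants ending with \<open>c j\<close>, whereas \<open>p j\<close>
      sees it through \<open>c j\<close>. Runs of all lengths are included so that the statement
      survives the passage through the next constant.\<close>
    have "(\<forall>a<j. \<forall>m n. m + n = j + 1 \<longrightarrow> (\<forall>x\<in>{p a, r a}. B x (interval_comp c m n (y j)) = 0))
      \<and> B (p j) (c j (y j)) \<noteq> 0" if "j \<le> L" for j
      using that
    proof (induction rule: inc_induct)
      case base
      have b: "B x (interval_comp c m n (y L)) = 0"
        if "a < L" "m + n = L + 1" "x \<in> {p a, r a}" for a m n x
        using oC[of m n a L x "r L"] that by (auto simp: yL)
      have "B (p L) (c L (y L)) \<noteq> 0" using pr[of L] yL by simp
      then show ?case by (intro conjI allI impI ballI b)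
    next
      case (step j)
      define j' where "j' = Suc j"
      have j': "1 \<le> j'" "j' \<le> L" "j = j' - 1" using step by (auto simp: j'_def)
      define s :: 'a where "s = (if snd (lt j') then 1 else - 1)"
      let ?w = "c j' (y j')"
      have IH: "B x (interval_comp c m (Suc n) (y j')) = 0"
        if "a < j'" "m + n = j'" "x \<in> {p a, r a}" for a m n x
        by (rule step.IH[THEN conjunct1, rule_format, folded j'_def]) (use that in simp_all)
      have t: "B (p j') ?w \<noteq> 0" using step.IH[THEN conjunct2] by (simp add: j'_def)
      have IH0: "B x ?w = 0" if "a < j'" "x \<in> {p a, r a}" for a x
        using IH[of a j' 0 x] that by simp
      have IH1: "B x (interval_comp c m n ?w) = 0" if "a < j'" "m + n = j'" "x \<in> {p a, r a}" for a m n x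
        using IH[OF that] that(2) by simp
      have yj: "y j = ?w + s *s (\<Sum>b\<in>A (fst (lt j')). N b ?w)"
        using \<open>\<And>a. a \<in> {1..L} \<Longrightarrow> y (a - 1) = \<rho> (lt a) (c a (y a))\<close>[of j'] j'
        by (simp add: \<rho>_def X_def s_def)
      have lC: "lin (\<lambda>z. B x (interval_comp c m n z))" if "m + n \<le> L + 1" for x m n
        by (rule lin_comp[OF lin_B linop_interval_comp[where N = "L + 1"]]) (use c that in auto)
      have expand: "B x (interval_comp c m n (y j)) = B x (interval_comp c m n ?w) +
        s * (\<Sum>b\<in>A (fst (lt j')). B (p b) ?w * B x (interval_comp c m n (r (b - 1)))
          - eps * B (r (b - 1)) ?w * B x (interval_comp c m n (p b)))"
        if mn: "m + n \<le> L + 1" for x m n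
      proof -
        note l = lC[OF mn, of x]
        have "B x (interval_comp c m n (y j)) = B x (interval_comp c m n ?w) +
          s * (\<Sum>b\<in>A (fst (lt j')). B x (interval_comp c m n (N b ?w)))"
          unfolding yj using l lin_sum[OF l, of "\<lambda>b. N b ?w"] by (simp add: lin_def)
        moreover have "B x (interval_comp c m n (N b ?w)) = B (p b) ?w * B x (interval_comp c m n (r (b - 1)))
          - eps * B (r (b - 1)) ?w * B x (interval_comp c m n (p b))" for b
          unfolding N_def using l lin_diff[OF l] by (simp add: lin_def)
        ultimately show ?thesis by simp
      qed
      have low: "B (p b) ?w = 0 \<and> B (r (b - 1)) ?w = 0" if "b \<in> A i" "b < j'" for b i
        using IH0[of b "p b"] IH0[of "b - 1" "r (b - 1)"] that by (auto simp: A_def)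
      have goal1: "B x (interval_comp c m n (y j)) = 0" if a: "a < j" "m + n = j + 1" "x \<in> {p a, r a}" for a m n x
      proof -
        have "(\<Sum>b\<in>A (fst (lt j')). B (p b) ?w * B x (interval_comp c m n (r (b - 1)))
          - eps * B (r (b - 1)) ?w * B x (interval_comp c m n (p b))) = (\<Sum>b\<in>A (fst (lt j')). 0)"
        proof (rule sum.cong[OF refl])
          fix b assume b: "b \<in> A (fst (lt j'))"
          show "B (p b) ?w * B x (interval_comp c m n (r (b - 1)))
            - eps * B (r (b - 1)) ?w * B x (interval_comp c m n (p b)) = 0"
          proof (cases "b < j'")
            case True
            then show ?thesis using low[OF b] by simp
          next
            case False
            have "B x (interval_comp c m n (r (b - 1))) = 0"
              using oC[of m n a "b - 1" x "r (b - 1)"] a False b j' by (auto simp: A_def)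
            moreover have "B x (interval_comp c m n (p b)) = 0"
              using oC[of m n a b x "p b"] a False b j' by (auto simp: A_def)
            ultimately show ?thesis by simp
          qed
        qed
        moreover have "B x (interval_comp c m n ?w) = 0"
          using IH1[of a m n x] a j' by auto
        ultimately show ?thesis using expand[of m n x] a(2) j' by simp
      qed
      have c1: "interval_comp c j 1 z = c j z" for z by simp
      have "(\<Sum>b\<in>A (fst (lt j')). B (p b) ?w * B (p j) (interval_comp c j 1 (r (b - 1)))
          - eps * B (r (b - 1)) ?w * B (p j) (interval_comp c j 1 (p b))) =
          (\<Sum>b\<in>A (fst (lt j')). if b = j' then B (p j') ?w * B (p j) (c j (r j)) else 0)"
      proof (rule sum.cong[OF refl])
        fix b assume b: "b \<in> A (fst (lt j'))"
        \<comment> \<open>For \<open>b < j'\<close> the coefficients vanish by the invariant. For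
          \<open>b > j'\<close> they may be nonzero, but the added vectors belong to positions
          already passed and are not seen by \<open>p j\<close> through \<open>c j\<close>. Only
          \<open>b = j'\<close> contributes.\<close>
        consider "b < j'" | "b = j'" | "j' < b" by linarith
        then show "B (p b) ?w * B (p j) (interval_comp c j 1 (r (b - 1)))
            - eps * B (r (b - 1)) ?w * B (p j) (interval_comp c j 1 (p b)) =
            (if b = j' then B (p j') ?w * B (p j) (c j (r j)) else 0)"
        proof cases
          case 1
          then show ?thesis using low[OF b] by simp
        next
          case 2
          have "B (r (b - 1)) ?w = 0" using IH0[of j "r j"] 2 j' by simp
          then show ?thesis using 2 j' by simp
        next
          case 3
          have "B (p j) (interval_comp c j 1 (r (b - 1))) = 0"
            using oC[of j 1 j "b - 1" "p j" "r (b - 1)"] 3 b j' by (auto simp: A_def)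
          moreover have "B (p j) (interval_comp c j 1 (p b)) = 0"
            using oC[of j 1 j b "p j" "p b"] 3 b j' by (auto simp: A_def)
          ultimately show ?thesis using 3 by simp
        qed
      qed
      also have "\<dots> = B (p j') ?w * B (p j) (c j (r j))"
        using j' finA by (subst sum.delta) (auto simp: A_def)
      finally have "B (p j) (interval_comp c j 1 (y j)) =
        B (p j) (interval_comp c j 1 ?w) + s * (B (p j') ?w * B (p j) (c j (r j)))"
        using expand[of j 1 "p j"] j' by simp
      moreover have "B (p j) (interval_comp c j 1 ?w) = 0" using IH1[of j j 1 "p j"] j' by simp
      ultimately have eq: "B (p j) (c j (y j)) = s * (B (p j') ?w * B (p j) (c j (r j)))"
        unfolding c1 by simp
      have w: "?w \<in> V"
      proof -
        have "y i \<in> V" if "i \<le> L" for i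
          using that
        proof (induction rule: inc_induct)
          case base
          then show ?case using yL rV by simp
        next
          case (step i)
          have "c (Suc i) (y (Suc i)) \<in> V" using V_linop c step by auto
          then show ?case
            using grp_V[OF \<open>\<And>x. \<rho> x \<in> grp S\<close>] \<open>\<And>a. a \<in> {1..L} \<Longrightarrow> y (a - 1) = \<rho> (lt a) (c a (y a))\<close>[of "Suc i"] step
            by auto
        qed
        then show ?thesis using V_linop c j' by auto
      qed
      have "B (p j') ?w * B (p j) (c j (r j)) \<noteq> 0"
      proof (rule nonzero_mult)
        show "e * B (p j') ?w = B (p j') ?w" by (rule e_field[OF lin_B w])
        show "e * B (p j) (c j (r j)) = B (p j) (c j (r j))"
          by (rule e_field[OF lin_B]) (use V_linop[OF c rV] j' in auto)
      qed (use t pr[of j] j' in auto)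
      then have "B (p j) (c j (y j)) \<noteq> 0" using eq by (auto simp: s_def)
      then show ?case by (intro conjI allI impI ballI goal1)
    qed
    from this[OF le0] show ?thesis by (rule conjunct2)
  qed
  then show ?thesis using \<rho> by blast
qed

end

text \<open>Adding \<open>R + 1\<close> turns the affine recursion for the defect into
  multiplication by at most 14.\<close>

lemma funpow_affine_bound: "((\<lambda>D::nat. 13 * (D + R) + 12) ^^ n) 0 + (R + 1) \<le> 14 ^ n * (R + 1)"
proof (induction n)
  case (Suc n)
  then show ?case by simp
qed simp

section \<open>Long nonsingular words of operators\<close>

context hyp_space
begin

text \<open>The end of the collapse, where all critical constants are far. After splitting,
  \<open>l \<le> 2 * L\<close> letters and the leading constant need \<open>l + 1\<close> pairs, and
  there are at most \<open>(l + 2) * (l + 2)\<close> composites, each costing 12 for each pair; this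
  is where \<open>R\<close> comes from.\<close>

lemma far_word:
  assumes S: "hsys D J a b" and R: "R = 12 * (2 * L + 2) ^ 3" and k: "7 * (D + R) + 7 \<le> k"
    and Cs: "\<And>c. c \<in> Cs \<Longrightarrow> linop c" "\<And>c y. c \<in> Cs \<Longrightarrow> y \<in> V \<Longrightarrow> c y = 0 \<Longrightarrow> y = 0" "(\<lambda>z. z) \<in> Cs"
    and c0: "c0 \<in> Cs" and ys: "snd ` set ys \<subseteq> Cs" "ys \<noteq> []" "length ys \<le> L"
    and suc: "successively (\<lambda>(x, c) (y, d). y = inv_letter x \<longrightarrow> far R D (hspan J a b) c) ys"
  shows "\<exists>\<rho>\<in>vals (hspan J a b). \<exists>p. \<exists>z\<in>V. B p (c0 (wfun \<rho> ys z)) \<noteq> 0 \<and> B p z = 0"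
proof -
  define ws where "ws = split_word ys"
  define l where "l = length ws"
  have l: "l = 2 * length ys" by (simp add: l_def ws_def length_split_word)
  have l1: "1 \<le> l" "l \<le> 2 * L" using ys by (cases ys; simp add: l)+
  define c where "c i = (if i = 0 then c0 else snd (ws ! (i - 1)))" for i :: nat
  define lt where "lt i = fst (ws ! (i - 1))" for i :: nat
  have ws: "snd ` set ws \<subseteq> Cs" 
    unfolding ws_def by (rule order_trans[OF constants_split_word]) (simp add: ys(1) Cs(3))
  have c: "c i \<in> Cs" if "i \<le> l" for i
    using that c0 ws nth_mem[of "i - 1" ws] by (cases i) (auto simp: c_def l_def)
  define Cl where "Cl = map (\<lambda>(m, n). interval_comp c m n) (filter (\<lambda>(m, n). m + n \<le> l + 1) (List.product [0..<l + 2] [0..<l + 2]))"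
  have Cl: "interval_comp c m n \<in> set Cl" if "m + n \<le> l + 1" for m n
    using that by (force simp: Cl_def)
  have lin_Cl: "\<forall>C\<in>set Cl. linop C"
  proof
    fix C assume "C \<in> set Cl"
    then obtain m n where "C = interval_comp c m n" "m + n \<le> l + 1" by (auto simp: Cl_def)
    then show "linop C" using linop_interval_comp[of "l + 1" c m n] Cs(1) c by auto
  qed
  have "length Cl \<le> (l + 2) * (l + 2)"
    unfolding Cl_def length_map by (rule order_trans[OF length_filter_le]) simp
  then have "12 * length Cl * (l + 1) \<le> 12 * ((l + 2) * (l + 2)) * (l + 2)"
    by (intro mult_le_mono) auto
  also have "\<dots> = 12 * (l + 2) ^ 3" by (simp only: power3_eq_cube mult.assoc)
  also have "\<dots> \<le> R" using l1(2) unfolding R by (intro mult_le_mono power_mono) auto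
  finally have lenR: "12 * length Cl * (l + 1) \<le> R" .
  define cr where "cr i \<longleftrightarrow> 1 \<le> i \<and> i < l \<and> fst (lt i) = fst (lt (Suc i))" for i
  have cr: "far R D (hspan J a b) (c i)" if cri: "cr i" for i
  proof -
    have suc': "successively (\<lambda>(x, c) (y, d). fst x = fst y \<longrightarrow> y = inv_letter x \<and> far R D (hspan J a b) c) ws"
      unfolding ws_def by (rule successively_split_word[OF suc])
    obtain j where j: "i = Suc j" "Suc j < length ws"
      using cri by (cases i) (auto simp: cr_def l_def)
    show ?thesis
      using successively_nth[OF suc' j(2)] cri j by (simp add: cr_def lt_def c_def case_prod_beta)
  qed
  have "\<exists>p r J' a' b'. hsys (D + 12 * length Cl * (l + 1)) J' a' b' \<and> hspan J' a' b' \<subseteq> hspan J a b \<and>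
    (\<forall>i<l + 1. p i \<in> hspan J a b \<and> r i \<in> hspan J a b \<and> sing (p i) \<and> sing (r i) \<and>
      B (p i) (c i (r i)) \<noteq> 0 \<and> (cr i \<longrightarrow> B (p i) (r i) = 0)) \<and>
    (\<forall>i<l + 1. \<forall>x\<in>{p i, r i}. \<forall>y\<in>hspan J' a' b'. orth Cl x y) \<and>
    (\<forall>i<l + 1. \<forall>j<l + 1. i \<noteq> j \<longrightarrow> (\<forall>x\<in>{p i, r i}. \<forall>y\<in>{p j, r j}. orth Cl x y))"
  proof (rule select_pairs[OF S lin_Cl _ _ _ lenR k order_refl])
    show "linop (c i)" if "i < l + 1" for i using Cs(1) c that by simp
    show "y = 0" if "i < l + 1" "y \<in> V" "c i y = 0" for i y using Cs(2)[of "c i" y] c that by simp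
  qed (rule cr)
  then obtain p r where pr: "\<forall>i<l + 1. p i \<in> hspan J a b \<and> r i \<in> hspan J a b \<and> sing (p i) \<and> sing (r i) \<and>
      B (p i) (c i (r i)) \<noteq> 0 \<and> (cr i \<longrightarrow> B (p i) (r i) = 0)"
    and o: "\<forall>i<l + 1. \<forall>j<l + 1. i \<noteq> j \<longrightarrow> (\<forall>x\<in>{p i, r i}. \<forall>y\<in>{p j, r j}. orth Cl x y)"
    by (elim exE conjE)
  have "\<exists>\<rho>\<in>vals (hspan J a b). \<forall>y. y l = r l \<longrightarrow> (\<forall>a\<in>{1..l}. y (a - 1) = \<rho> (lt a) (c a (y a))) \<longrightarrow>
    B (p 0) (c 0 (y 0)) \<noteq> 0"
  proof (rule path_argument[where Cl = Cl])
    show "linop (c i)" if "i \<le> l" for i using Cs(1) c that by simp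
    show "interval_comp c m n \<in> set Cl" if "m + n \<le> l + 1" for m n using Cl that .
    show "p i \<in> hspan J a b \<and> r i \<in> hspan J a b \<and> sing (p i) \<and> sing (r i) \<and> B (p i) (c i (r i)) \<noteq> 0"
      if "i \<le> l" for i using pr[rule_format, of i] that by simp
    show "orth Cl x y" if "i \<le> l" "j \<le> l" "i \<noteq> j" "x \<in> {p i, r i}" "y \<in> {p j, r j}" for i j x y
      using o[rule_format, of i j x y] that by simp
    show "B (p i) (r i) = 0" if "1 \<le> i" "i < l" "fst (lt i) = fst (lt (Suc i))" for i
      using pr[rule_format, of i] that by (simp add: cr_def)
  qed (rule l1(1))
  then obtain \<rho> where \<rho>: "\<rho> \<in> vals (hspan J a b)" and path: "\<forall>y. y l = r l \<longrightarrow>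
    (\<forall>a\<in>{1..l}. y (a - 1) = \<rho> (lt a) (c a (y a))) \<longrightarrow> B (p 0) (c 0 (y 0)) \<noteq> 0"
    by (elim bexE)
  define y where "y i = wfun \<rho> (drop i ws) (r l)" for i
  have yl: "y l = r l" by (simp add: y_def l_def)
  have ystep: "y (i - 1) = \<rho> (lt i) (c i (y i))" if i: "i \<in> {1..l}" for i
  proof -
    obtain j where j: "i = Suc j" "j < length ws" using i by (cases i) (auto simp: l_def)
    have "drop j ws = ws ! j # drop i ws" using Cons_nth_drop_Suc[OF j(2)] j(1) by simp
    then show ?thesis by (cases "ws ! j") (simp add: y_def j(1) lt_def c_def)
  qed
  have "B (p 0) (c 0 (y 0)) \<noteq> 0" by (rule path[rule_format, OF yl ystep])
  then have *: "B (p 0) (c0 (wfun (merge_val \<rho>) ys (r l))) \<noteq> 0"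
    by (simp add: c_def y_def ws_def wfun_split_word)
  \<comment> \<open>The positions \<open>0\<close> and \<open>l\<close> differ, so the starting
    vector \<open>r l\<close> is itself orthogonal to \<open>p 0\<close>; together with the end of
    the path this excludes a scalar.\<close>
  have "orth Cl (p 0) (r l)"
    by (rule o[rule_format, where i = 0 and j = l]) (use l1(1) in simp_all)
  moreover have "interval_comp c 0 0 \<in> set Cl" by (rule Cl) simp
  ultimately have "B (p 0) (interval_comp c 0 0 (r l)) = 0" unfolding orth_def by blast
  then have "B (p 0) (r l) = 0" by (simp only: interval_comp.simps)
  moreover have "r l \<in> V" by (rule sing_V) (use pr[rule_format, of l] in simp)
  ultimately show ?thesis using merge_vals[OF \<rho>] * by blast
qed

text \<open>A projective group determines its values only up to scalars, hence this form of the
  conclusion: a scalar would send \<open>z\<close> to a vector orthogonal to \<open>p\<close>. The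
  factor \<open>14 ^ L\<close> bounds the defect over all collapses.\<close>

theorem nonsingular_word_not_scalar:
  assumes S: "hsys 0 J a b" and k: "14 ^ L * (12 * (2 * L + 2) ^ 3 + 1) \<le> k"
    and Cs: "\<And>c. c \<in> Cs \<Longrightarrow> linop c" "\<And>c y. c \<in> Cs \<Longrightarrow> y \<in> V \<Longrightarrow> c y = 0 \<Longrightarrow> y = 0" "(\<lambda>z. z) \<in> Cs"
      "\<And>c d. c \<in> Cs \<Longrightarrow> d \<in> Cs \<Longrightarrow> (\<lambda>z. c (d z)) \<in> Cs"
    and c0: "c0 \<in> Cs" and ys: "snd ` set ys \<subseteq> Cs" "length ys = L" and nc: "\<not> cancels (map fst ys)"
  shows "\<exists>\<rho>\<in>vals (hspan J a b). \<exists>p. \<exists>z\<in>V. B p (c0 (wfun \<rho> ys z)) \<noteq> 0 \<and> B p z = 0"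
proof -
  define R :: nat where "R = 12 * (2 * L + 2) ^ 3"
  define g where "g D = 13 * (D + R) + 12" for D :: nat
  let ?ok = "\<lambda>D S. \<exists>J a b. hsys D J a b \<and> S = hspan J a b"
  show ?thesis
  proof (rule collapse_induct[where X = V and val = vals and ok = ?ok and g = g and M = k and Cs = Cs
        and L = L and far = "far R" and good = "\<lambda>f. \<exists>p. \<exists>z\<in>V. B p (f z) \<noteq> 0 \<and> B p z = 0" and D = 0])
    show "(\<lambda>z. c (d z)) \<in> Cs" if "c \<in> Cs" "d \<in> Cs" for c d using Cs(4) that .
    show "c z \<in> V" if "c \<in> Cs" "z \<in> V" for c z using Cs(1) V_linop that by blast
    show "\<rho> x (\<rho> (inv_letter x) z) = z" if "\<rho> \<in> vals S" for S \<rho> x z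
      using that unfolding vals_def by blast
    show "\<rho> x z \<in> V" if "\<rho> \<in> vals S" "z \<in> V" for S \<rho> x z
      using that grp_V unfolding vals_def by blast
    show "mono g" by (auto simp: g_def mono_def)
    show "D \<le> g D" for D by (simp add: g_def)
    show "?ok 0 (hspan J a b)" using S by blast
    have "(g ^^ L) 0 + (R + 1) \<le> 14 ^ L * (R + 1)"
      unfolding g_def[abs_def] by (rule funpow_affine_bound)
    then have "(g ^^ L) 0 \<le> 14 ^ L * (R + 1)" by linarith
    also have "\<dots> \<le> k" using k by (simp only: R_def)
    finally show "(g ^^ length ys) 0 \<le> k" by (simp only: ys(2))
    show "\<exists>p. \<exists>z\<in>V. B p (h z) \<noteq> 0 \<and> B p z = 0"
      if "\<And>z. z \<in> V \<Longrightarrow> f z = h z" "\<exists>p. \<exists>z\<in>V. B p (f z) \<noteq> 0 \<and> B p z = 0" for f h :: "'v \<Rightarrow> 'v"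
      using that(2) by (elim exE bexE) (use that(1) in auto)
    show "\<exists>S'. ?ok (g D) S' \<and> vals S' \<subseteq> vals S \<and> (\<forall>\<rho>\<in>vals S'. \<forall>x. \<forall>z\<in>V. \<rho> x (c z) = c (\<rho> x z))"
      if ok: "?ok D S" and gD: "g D \<le> k" and c: "c \<in> Cs" and nf: "\<not> far R D S c" for D S c
    proof -
      obtain J a b where "hsys (D + R) J a b" and sub: "hspan J a b \<subseteq> S" and "\<not> lone_pair c (hspan J a b)"
        using nf unfolding far_def by blast
      then have "\<exists>lam J' a' b'. hsys (13 * (D + R) + 12) J' a' b' \<and> hspan J' a' b' \<subseteq> hspan J a b \<and>
        (\<forall>y\<in>hspan J' a' b'. c y = lam *s y \<and> (\<forall>z\<in>V. B y (c z) = lam * B y z))"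
        using gD Cs(1)[OF c] by (intro near_scalar) (auto simp: g_def)
      then obtain lam J' a' b' where n: "hsys (g D) J' a' b'" "hspan J' a' b' \<subseteq> hspan J a b"
        "\<forall>y\<in>hspan J' a' b'. c y = lam *s y \<and> (\<forall>z\<in>V. B y (c z) = lam * B y z)"
        unfolding g_def by (elim exE conjE)
      have "vals (hspan J' a' b') \<subseteq> vals S" using n(2) sub by (intro vals_mono) auto
      moreover have "\<rho> x (c z) = c (\<rho> x z)" if "\<rho> \<in> vals (hspan J' a' b')" "z \<in> V" for \<rho> x z
      proof (rule grp_commute[OF Cs(1)[OF c] _ _ _ that(2)])
        show "\<rho> x \<in> grp (hspan J' a' b')" using that(1) unfolding vals_def by blast
      qed (use n(3) in auto)
      ultimately show ?thesis using n(1) by (intro exI[of _ "hspan J' a' b'"]) blast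
    qed
    show "\<exists>\<rho>\<in>vals S. \<exists>p. \<exists>z\<in>V. B p (c0 (wfun \<rho> ys z)) \<noteq> 0 \<and> B p z = 0"
      if ok: "?ok D S" and gD: "g D \<le> k" and w: "c0 \<in> Cs" "snd ` set ys \<subseteq> Cs" "ys \<noteq> []" "length ys \<le> L"
        and suc: "successively (\<lambda>(x, c) (y, d). y = inv_letter x \<longrightarrow> far R D S c) ys" for D S c0 ys
    proof -
      obtain J a b where S: "hsys D J a b" "S = hspan J a b" using ok by blast
      have k7: "7 * (D + R) + 7 \<le> k" using gD by (simp add: g_def)
      show ?thesis
        unfolding S(2)
      proof (rule far_word[OF S(1) R_def k7 _ _ Cs(3) w])
        show "linop c" if "c \<in> Cs" for c using Cs(1) that .
        show "y = 0" if "c \<in> Cs" "y \<in> V" "c y = 0" for c y using Cs(2) that .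
      qed (use suc S(2) in simp)
    qed
  qed (use c0 ys nc in auto)
qed

end

section \<open>Alternating groups\<close>

text \<open>\<open>S\<close> collects the supports of the constants discarded so far; permutations
  that fix it pointwise commute with these constants. It takes the place of the hyperbolic system,
  but grows instead of shrinking.\<close>

definition alt_vals :: "nat \<Rightarrow> nat set \<Rightarrow> (letter \<Rightarrow> nat \<Rightarrow> nat) set" where
  "alt_vals n S = {\<rho>. (\<forall>x. \<rho> x \<in> carrier (alt_group n) \<and> (\<forall>z\<in>S. \<rho> x z = z)) \<and>
     (\<forall>x z. \<rho> x (\<rho> (inv_letter x) z) = z)}"

lemma alt_group_comp: "p \<in> carrier (alt_group n) \<Longrightarrow> q \<in> carrier (alt_group n) \<Longrightarrow> p \<circ> q \<in> carrier (alt_group n)"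
  using monoid.m_closed[OF group.is_monoid[OF alt_group_is_group], of p n q] by (simp add: alt_group_mult)

lemma alt_inv_apply:
  assumes "p \<in> carrier (alt_group n)"
  shows "inv' p (p z) = z" "p (inv' p z) = z"
proof -
  have "p permutes {1..n}" using assms by (simp add: alt_group_carrier)
  then show "inv' p (p z) = z" "p (inv' p z) = z" by (simp_all add: permutes_inverses)
qed

lemma merge_alt_vals:
  assumes "\<rho> \<in> alt_vals n S"
  shows "merge_val \<rho> \<in> alt_vals n S"
proof -
  have g: "\<rho> x \<in> carrier (alt_group n)" and f: "z \<in> S \<Longrightarrow> \<rho> x z = z"
    and i: "\<rho> x (\<rho> (inv_letter x) z) = z" for x z
    using assms unfolding alt_vals_def by blast+
  have "merge_val \<rho> x \<in> carrier (alt_group n)" for x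
    using alt_group_comp[OF g g] by (cases x) (simp add: merge_val_def comp_def)
  moreover have "merge_val \<rho> x z = z" if "z \<in> S" for x z
    using f[OF that] by (cases x) (simp add: merge_val_def)
  moreover have "merge_val \<rho> x (merge_val \<rho> (inv_letter x) z) = z" for x z
    using i[of "(2 * fst x, True)"] i[of "(2 * fst x, False)"]
      i[of "(2 * fst x + 1, True)"] i[of "(2 * fst x + 1, False)"]
    by (cases x) (simp add: merge_val_def inv_letter_def)
  ultimately show ?thesis by (simp add: alt_vals_def)
qed

text \<open>Transpositions taking \<open>x a\<close> to \<open>y a\<close> could multiply to an odd
  permutation; the third point \<open>w a\<close> allows 3-cycles instead.\<close>

lemma disjoint_three_cycles:
  assumes "finite T" "\<And>a. a \<in> T \<Longrightarrow> distinct [x a, y a, w a] \<and> {x a, y a, w a} \<subseteq> {1..n}"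
    and "\<And>a b. a \<in> T \<Longrightarrow> b \<in> T \<Longrightarrow> a \<noteq> b \<Longrightarrow> {x a, y a, w a} \<inter> {x b, y b, w b} = {}"
  shows "\<exists>\<pi>\<in>carrier (alt_group n). (\<forall>a\<in>T. \<pi> (x a) = y a) \<and>
    (\<forall>v. (\<forall>a\<in>T. v \<notin> {x a, y a, w a}) \<longrightarrow> \<pi> v = v)"
  using assms
proof (induction T)
  case empty
  show ?case
    by (intro bexI[of _ id]) (auto simp: alt_group_carrier permutes_id evenperm_id)
next
  case (insert a T)
  then obtain \<pi> where \<pi>: "\<pi> \<in> carrier (alt_group n)" "\<And>a. a \<in> T \<Longrightarrow> \<pi> (x a) = y a"
    "\<And>v. (\<And>a. a \<in> T \<Longrightarrow> v \<notin> {x a, y a, w a}) \<Longrightarrow> \<pi> v = v" by (metis insertCI)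
  define t where "t = transpose (x a) (y a) \<circ> transpose (y a) (w a)"
  have d: "distinct [x a, y a, w a]" "{x a, y a, w a} \<subseteq> {1..n}" using insert.prems by auto
  have "evenperm t" unfolding t_def using d
    by (subst evenperm_comp) (auto simp: evenperm_swap permutation_swap_id)
  moreover have "t permutes {1..n}" unfolding t_def using d
    by (intro permutes_compose permutes_swap_id) auto
  ultimately have t: "t \<in> carrier (alt_group n)" by (simp add: alt_group_carrier)
  have disj: "{x a, y a, w a} \<inter> {x b, y b, w b} = {}" if "b \<in> T" for b
    by (rule insert.prems(2)) (use that insert.hyps in auto)
  have "\<pi> (x a) = x a" using disj by (intro \<pi>(3)) blast
  then have "(t \<circ> \<pi>) (x a) = y a" using d by (simp add: t_def transpose_def)
  moreover have "(t \<circ> \<pi>) (x b) = y b" if "b \<in> T" for b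
    using \<pi>(2)[OF that] disj[OF that] by (simp add: t_def transpose_def)
  moreover have "(t \<circ> \<pi>) v = v" if "\<forall>b\<in>insert a T. v \<notin> {x b, y b, w b}" for v
  proof -
    have "\<pi> v = v" using that by (intro \<pi>(3)) blast
    then show ?thesis using that by (simp add: t_def transpose_def)
  qed
  moreover have "t \<circ> \<pi> \<in> carrier (alt_group n)" by (rule alt_group_comp[OF t \<pi>(1)])
  ultimately show ?case by (intro bexI[of _ "t \<circ> \<pi>"]) blast+
qed

text \<open>A count: at most \<open>D + 3 * m\<close> points are in use, and the next
  \<open>r\<close> has to avoid these and their preimages under the constant, at most
  \<open>2 * D + 6 * m\<close> points. A critical constant moves more points than that; in the other
  cases all \<open>n\<close> points are available.\<close>

lemma select_points:
  assumes S: "finite S" "card S \<le> D" and c: "\<And>i. i < N \<Longrightarrow> c i permutes {1..n}"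
    and cr: "\<And>i. i < N \<Longrightarrow> cr i \<Longrightarrow> 2 * D + 6 * N < card {z. c i z \<noteq> z}"
    and n: "2 * D + 6 * N + 2 < n" and m: "m \<le> N"
  shows "\<exists>r s. \<forall>i<m. {r i, c i (r i), s i} \<subseteq> {1..n} - S \<and> s i \<notin> {r i, c i (r i)} \<and>
    (cr i \<longrightarrow> c i (r i) \<noteq> r i) \<and>
    (\<forall>j<i. {r i, c i (r i), s i} \<inter> {r j, c j (r j), s j} = {})"
  using m
proof (induction m)
  case (Suc m)
  then have "m \<le> N" and mN: "m < N" by simp_all
  from Suc.IH[OF this(1)] obtain r s where rs: "\<forall>i<m. {r i, c i (r i), s i} \<subseteq> {1..n} - S \<and> s i \<notin> {r i, c i (r i)} \<and>
    (cr i \<longrightarrow> c i (r i) \<noteq> r i) \<and>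
    (\<forall>j<i. {r i, c i (r i), s i} \<inter> {r j, c j (r j), s j} = {})" by (elim exE)
  define U where "U = S \<union> (\<Union>i<m. {r i, c i (r i), s i})"
  have finU: "finite U" using S by (simp add: U_def)
  have "card (\<Union>i<m. {r i, c i (r i), s i}) \<le> (\<Sum>i<m. card {r i, c i (r i), s i})"
    by (rule card_UN_le) simp
  also have "\<dots> \<le> (\<Sum>i<m. 3)" by (intro sum_mono) (simp add: card_insert_if)
  finally have cardU: "card U \<le> D + 3 * m"
    using card_Un_le[of S "\<Union>i<m. {r i, c i (r i), s i}"] S(2) by (simp add: U_def)
  note cm = c[OF mN]
  have bij: "bij (c m)" using cm by (rule permutes_bij)
  define Bad where "Bad = U \<union> inv' (c m) ` U"
  have finB: "finite Bad" using finU by (simp add: Bad_def)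
  have cardB: "card Bad \<le> 2 * D + 6 * m"
    using card_Un_le[of U "inv' (c m) ` U"] card_image_le[OF finU, of "inv' (c m)"] cardU by (simp add: Bad_def)
  define W where "W = (if cr m then {z. c m z \<noteq> z} else {1..n})"
  have WX: "W \<subseteq> {1..n}" using permutes_not_in[OF cm]
    unfolding W_def by (auto simp del: atLeastAtMost_iff)
  have "card Bad < card W" using cardB cr[OF mN] n mN by (auto simp: W_def)
  then have "\<not> W \<subseteq> Bad" using card_mono[OF finB, of W] by linarith
  then obtain r' where r': "r' \<in> W" "r' \<notin> Bad" by blast
  have r'X: "r' \<in> {1..n}" using r' WX by auto
  then have cr'X: "c m r' \<in> {1..n}" using permutes_in_image[OF cm] by simp
  have cr'U: "c m r' \<notin> U"
  proof
    assume "c m r' \<in> U"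
    then have "inv' (c m) (c m r') \<in> Bad" by (auto simp: Bad_def)
    then show False using r' bij by (simp add: inv_f_f bij_is_inj)
  qed
  have r'U: "r' \<notin> U" using r' by (auto simp: Bad_def)
  have "card (U \<union> {r', c m r'}) < card {1..n}"
    using card_Un_le[of U "{r', c m r'}"] cardU n mN by (simp add: card_insert_if split: if_splits)
  then have "\<not> {1..n} \<subseteq> U \<union> {r', c m r'}" using card_mono[of "U \<union> {r', c m r'}" "{1..n}"] finU by fastforce
  then obtain s' where s': "s' \<in> {1..n}" "s' \<notin> U" "s' \<notin> {r', c m r'}" by blast
  have SU: "S \<subseteq> U" and U': "{r j, c j (r j), s j} \<subseteq> U" if "j < m" for j using that by (auto simp: U_def)
  have SU: "S \<subseteq> U" by (auto simp: U_def)
  define r1 s1 where "r1 = r(m := r')" and "s1 = s(m := s')"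
  have "{r1 i, c i (r1 i), s1 i} \<subseteq> {1..n} - S \<and> s1 i \<notin> {r1 i, c i (r1 i)} \<and>
    (cr i \<longrightarrow> c i (r1 i) \<noteq> r1 i) \<and>
    (\<forall>j<i. {r1 i, c i (r1 i), s1 i} \<inter> {r1 j, c j (r1 j), s1 j} = {})" if i: "i < Suc m" for i
  proof (cases "i = m")
    case True
    have "cr m \<longrightarrow> c m r' \<noteq> r'" using r' by (auto simp: W_def)
    moreover have "{r', c m r', s'} \<inter> {r j, c j (r j), s j} = {}" if "j < m" for j
      using U'[OF that] r'U cr'U s' by blast
    moreover have "{r', c m r', s'} \<subseteq> {1..n} - S" using r'X cr'X s' r'U cr'U SU by blast
    ultimately show ?thesis using s'(3) True by (simp add: r1_def s1_def)
  next
    case False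
    then have "i < m" using i by simp
    then show ?thesis using rs[rule_format, of i] by (simp add: r1_def s1_def)
  qed
  then show ?case by blast
qed simp

text \<open>Position \<open>a\<close> owns a 3-cycle on \<open>c a (r a)\<close>,
  \<open>r (a - 1)\<close> and \<open>s a\<close>, so \<open>r l\<close> travels exactly through
  \<open>r (l - 1)\<close> down to \<open>r 0\<close>. Composites of constants do not enter, since a
  point is moved without additional terms. \<open>R\<close> is \<open>6 * (l + 1) + 2\<close> for
  the largest length \<open>l = 2 * L\<close>.\<close>

lemma alt_far_word:
  assumes S: "finite S" "card S \<le> D" and R: "R = 12 * L + 8" and n: "3 * D + R + 1 \<le> n"
    and c0: "c0 permutes {1..n}" and ys: "\<forall>c\<in>snd ` set ys. c permutes {1..n}" "ys \<noteq> []" "length ys \<le> L"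
    and suc: "successively (\<lambda>(x, c) (y, d). y = inv_letter x \<longrightarrow> 2 * D + R < card {z. c z \<noteq> z}) ys"
  shows "\<exists>\<rho>\<in>alt_vals n S. \<exists>z\<in>{1..n}. c0 (wfun \<rho> ys z) \<noteq> z"
proof -
  define ws where "ws = split_word ys"
  define l where "l = length ws"
  have l: "l = 2 * length ys" by (simp add: l_def ws_def length_split_word)
  have l1: "1 \<le> l" "l \<le> 2 * L" using ys by (cases ys; simp add: l)+
  define c where "c i = (if i = 0 then c0 else snd (ws ! (i - 1)))" for i :: nat
  define lt where "lt i = fst (ws ! (i - 1))" for i :: nat
  have "\<forall>c\<in>insert (\<lambda>z. z) (snd ` set ys). c permutes {1..n}" using ys(1) permutes_id by (auto simp: id_def)
  then have ws: "\<forall>c\<in>snd ` set ws. c permutes {1..n}" using constants_split_word[of ys] unfolding ws_def by blast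
  have c: "c i permutes {1..n}" if "i \<le> l" for i
    using that c0 ws nth_mem[of "i - 1" ws] by (cases i) (auto simp: c_def l_def)
  define cr where "cr i \<longleftrightarrow> 1 \<le> i \<and> i < l \<and> fst (lt i) = fst (lt (Suc i))" for i
  have cr: "2 * D + R < card {z. c i z \<noteq> z}" if cri: "cr i" for i
  proof -
    have suc': "successively (\<lambda>(x, c) (y, d). fst x = fst y \<longrightarrow> y = inv_letter x \<and> 2 * D + R < card {z. c z \<noteq> z}) ws"
      unfolding ws_def by (rule successively_split_word[OF suc])
    obtain j where j: "i = Suc j" "Suc j < length ws"
      using cri by (cases i) (auto simp: cr_def l_def)
    show ?thesis
      using successively_nth[OF suc' j(2)] cri j by (simp add: cr_def lt_def c_def case_prod_beta)
  qed
  have "\<exists>r s. \<forall>i<l + 1. {r i, c i (r i), s i} \<subseteq> {1..n} - S \<and> s i \<notin> {r i, c i (r i)} \<and>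
    (cr i \<longrightarrow> c i (r i) \<noteq> r i) \<and>
    (\<forall>j<i. {r i, c i (r i), s i} \<inter> {r j, c j (r j), s j} = {})"
  proof (rule select_points[OF S _ _ _ order_refl])
    show "c i permutes {1..n}" if "i < l + 1" for i using c that by simp
    show "2 * D + 6 * (l + 1) < card {z. c i z \<noteq> z}" if "cr i" for i
      using cr[OF that] l1(2) R by simp
    show "2 * D + 6 * (l + 1) + 2 < n" using l1(2) R n by simp
  qed
  then obtain r s where rs: "\<And>i. i \<le> l \<Longrightarrow> {r i, c i (r i), s i} \<subseteq> {1..n} - S"
    "\<And>i. i \<le> l \<Longrightarrow> s i \<notin> {r i, c i (r i)}" "\<And>i. i \<le> l \<Longrightarrow> cr i \<Longrightarrow> c i (r i) \<noteq> r i"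
    and "\<And>i j. i \<le> l \<Longrightarrow> j < i \<Longrightarrow> {r i, c i (r i), s i} \<inter> {r j, c j (r j), s j} = {}"
    by (metis less_Suc_eq_le Suc_eq_plus1)
  then have disj: "{r i, c i (r i), s i} \<inter> {r j, c j (r j), s j} = {}" if "i \<le> l" "j \<le> l" "i \<noteq> j" for i j
    using that by (metis Int_commute linorder_neqE_nat)
  define A where "A i = {a \<in> {1..l}. fst (lt a) = i}" for i
  define p where "p a = c a (r a)" for a
  \<comment> \<open>For an inverse letter the cycle is written backwards, so that the letter itself
    still takes \<open>p a\<close> to \<open>r (a - 1)\<close>.\<close>
  define x where "x a = (if snd (lt a) then p a else r (a - 1))" for a
  define y where "y a = (if snd (lt a) then r (a - 1) else p a)" for a
  have set_xy: "{x a, y a, s a} = {p a, r (a - 1), s a}" for a by (auto simp: x_def y_def)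
  have dist: "distinct [x a, y a, s a] \<and> {x a, y a, s a} \<subseteq> {1..n} - S" if "a \<in> A i" for a i
  proof -
    have a: "1 \<le> a" "a \<le> l" using that by (auto simp: A_def)
    then have "{r a, c a (r a), s a} \<inter> {r (a - 1), c (a - 1) (r (a - 1)), s (a - 1)} = {}"
      by (intro disj) auto
    then have "distinct [p a, r (a - 1), s a]" using rs(2)[OF a(2)] by (auto simp: p_def)
    then have "distinct [x a, y a, s a]" by (auto simp: x_def y_def)
    moreover have "{p a, r (a - 1), s a} \<subseteq> {1..n} - S" using rs(1)[OF a(2)] rs(1)[of "a - 1"] a by (auto simp: p_def)
    ultimately show ?thesis unfolding set_xy by blast
  qed
  have disjA: "{x a, y a, s a} \<inter> {x b, y b, s b} = {}" if ab: "a \<in> A i" "b \<in> A i" "a \<noteq> b" for a b i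
  proof -
    \<comment> \<open>Only for \<open>b = a + 1\<close> does \<open>r (b - 1)\<close> belong to the
      same position as \<open>p a\<close> and \<open>s a\<close>; then \<open>c a\<close> is
      critical and moves \<open>r a\<close>.\<close>
    have step: "p a \<noteq> r (b - 1) \<and> s a \<noteq> r (b - 1)" if "1 \<le> a" "a \<le> l" "1 \<le> b" "b \<le> l" "fst (lt a) = fst (lt b)" for a b
    proof (cases "b = Suc a")
      case True
      then show ?thesis using rs(2)[of a] rs(3)[of a] that by (auto simp: p_def cr_def)
    next
      case False
      then have "b - 1 \<le> l" "a \<noteq> b - 1" using that by auto
      from disj[OF that(2) this] show ?thesis by (auto simp: p_def)
    qed
    have a: "1 \<le> a" "a \<le> l" "1 \<le> b" "b \<le> l" "fst (lt a) = fst (lt b)" using ab by (auto simp: A_def)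
    have "{r a, p a, s a} \<inter> {r b, p b, s b} = {}" using disj[of a b] a ab by (simp add: p_def)
    moreover have "a - 1 \<le> l" "b - 1 \<le> l" "a - 1 \<noteq> b - 1" using a ab(3) by auto
    from disj[OF this] have "r (a - 1) \<noteq> r (b - 1)" by auto
    ultimately show ?thesis unfolding set_xy using step[of a b] step[of b a] a by auto
  qed
  have "\<exists>\<pi>\<in>carrier (alt_group n). (\<forall>a\<in>A i. \<pi> (x a) = y a) \<and>
    (\<forall>v. (\<forall>a\<in>A i. v \<notin> {x a, y a, s a}) \<longrightarrow> \<pi> v = v)" for i
  proof (rule disjoint_three_cycles)
    show "distinct [x a, y a, s a] \<and> {x a, y a, s a} \<subseteq> {1..n}" if "a \<in> A i" for a using dist[OF that] by blast
    show "{x a, y a, s a} \<inter> {x b, y b, s b} = {}" if "a \<in> A i" "b \<in> A i" "a \<noteq> b" for a b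
      using disjA[OF that] .
  qed (simp add: A_def)
  then obtain \<pi> where \<pi>: "\<And>i. \<pi> i \<in> carrier (alt_group n)" "\<And>i a. a \<in> A i \<Longrightarrow> \<pi> i (x a) = y a"
    "\<And>i v. \<forall>a\<in>A i. v \<notin> {x a, y a, s a} \<Longrightarrow> \<pi> i v = v" by metis
  define \<rho> where "\<rho> z = (if snd z then \<pi> (fst z) else inv' (\<pi> (fst z)))" for z :: letter
  have fix_S: "\<pi> i v = v" if "v \<in> S" for i v
    by (rule \<pi>(3)) (use dist that in blast)
  have "\<rho> z \<in> carrier (alt_group n)" for z
    using \<pi>(1) alt_group_inv_closed by (simp add: \<rho>_def)
  moreover have "\<rho> z v = v" if "v \<in> S" for z v
    using fix_S[OF that] alt_inv_apply[OF \<pi>(1)] by (simp add: \<rho>_def) metis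
  moreover have "\<rho> z (\<rho> (inv_letter z) v) = v" for z v
    using alt_inv_apply[OF \<pi>(1)] by (simp add: \<rho>_def inv_letter_def)
  ultimately have \<rho>: "\<rho> \<in> alt_vals n S" by (simp add: alt_vals_def)
  have move: "\<rho> (lt a) (p a) = r (a - 1)" if "a \<in> {1..l}" for a
  proof -
    have "a \<in> A (fst (lt a))" using that by (simp add: A_def)
    from \<pi>(2)[OF this] show ?thesis
      using alt_inv_apply[OF \<pi>(1)] by (auto simp: \<rho>_def x_def y_def) metis
  qed
  have path: "wfun \<rho> (drop i ws) (r l) = r i" if "i \<le> l" for i
    using that
  proof (induction rule: inc_induct)
    case base
    show ?case by (simp add: l_def)
  next
    case (step i)
    have d: "drop i ws = ws ! i # drop (Suc i) ws" using step by (simp add: Cons_nth_drop_Suc l_def)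
    have "wfun \<rho> (drop i ws) (r l) = \<rho> (lt (Suc i)) (c (Suc i) (wfun \<rho> (drop (Suc i) ws) (r l)))"
      unfolding d by (cases "ws ! i") (simp add: lt_def c_def)
    also have "\<dots> = r i" using step move[of "Suc i"] by (simp add: p_def)
    finally show ?case .
  qed
  have "c0 (wfun (merge_val \<rho>) ys (r l)) = c 0 (r 0)"
    using path[of 0] by (simp add: ws_def[symmetric] wfun_split_word[symmetric] c_def)
  also have "\<dots> \<noteq> r l" using disj[of 0 l] l1(1) by auto
  finally have "c0 (wfun (merge_val \<rho>) ys (r l)) \<noteq> r l" .
  moreover have "r l \<in> {1..n}" using rs(1)[of l] by blast
  ultimately show ?thesis using merge_alt_vals[OF \<rho>] by blast
qed

lemma funpow_affine_bound3: "((\<lambda>D::nat. 3 * D + R + 1) ^^ n) 0 + (R + 1) \<le> 4 ^ n * (R + 1)"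
  by (induction n) simp_all

theorem nonsingular_word_alt:
  assumes n: "4 ^ L * (12 * L + 9) \<le> n"
    and c0: "c0 permutes {1..n}" and ys: "\<forall>c\<in>snd ` set ys. c permutes {1..n}" "length ys = L"
    and nc: "\<not> cancels (map fst ys)"
  shows "\<exists>\<rho>\<in>alt_vals n {}. \<exists>z\<in>{1..n}. c0 (wfun \<rho> ys z) \<noteq> z"
proof -
  define R :: nat where "R = 12 * L + 8"
  define g where "g D = 3 * D + R + 1" for D :: nat
  let ?ok = "\<lambda>D S::nat set. finite S \<and> card S \<le> D"
  let ?far = "\<lambda>D S c::nat \<Rightarrow> nat. 2 * D + R < card {z. c z \<noteq> z}"
  show ?thesis
  proof (rule collapse_induct[where X = UNIV and val = "alt_vals n" and ok = ?ok and g = g and M = n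
        and Cs = "{c. c permutes {1..n}}" and L = L and far = ?far
        and good = "\<lambda>f. \<exists>z\<in>{1..n}. f z \<noteq> z" and D = 0 and s = "{}"])
    show "(\<lambda>z. c (d z)) \<in> {c. c permutes {1..n}}" if "c \<in> {c. c permutes {1..n}}" "d \<in> {c. c permutes {1..n}}" for c d
      using permutes_compose[of d _ c] that by (simp add: comp_def)
    show "\<rho> x (\<rho> (inv_letter x) z) = z" if "\<rho> \<in> alt_vals n S" for S \<rho> x z
      using that unfolding alt_vals_def by blast
    show "mono g" by (auto simp: g_def mono_def)
    show "D \<le> g D" for D by (simp add: g_def)
    have "(g ^^ L) 0 + (R + 1) \<le> 4 ^ L * (R + 1)"
      unfolding g_def[abs_def] by (rule funpow_affine_bound3)
    then have "(g ^^ L) 0 \<le> 4 ^ L * (R + 1)" by linarith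
    also have "\<dots> = 4 ^ L * (12 * L + 9)" by (simp add: R_def)
    also note n
    finally show "(g ^^ length ys) 0 \<le> n" by (simp only: ys(2))
    show "\<exists>z\<in>{1..n}. h z \<noteq> z" if "\<And>z. z \<in> UNIV \<Longrightarrow> f z = h z" "\<exists>z\<in>{1..n}. f z \<noteq> z" for f h
      using that by simp
    show "\<exists>S'. ?ok (g D) S' \<and> alt_vals n S' \<subseteq> alt_vals n S \<and>
        (\<forall>\<rho>\<in>alt_vals n S'. \<forall>x. \<forall>z\<in>UNIV. \<rho> x (c z) = c (\<rho> x z))"
      if S: "?ok D S" and c: "c \<in> {c. c permutes {1..n}}" and nf: "\<not> ?far D S c" for D S c
    proof -
      \<comment> \<open>A constant that is not far moves at most \<open>2 * D + R\<close> points.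
        They are added to \<open>S\<close>, which explains the recursion
        \<open>3 * D + R + 1\<close>.\<close>
      let ?supp = "{z. c z \<noteq> z}"
      have fin: "finite ?supp"
        by (rule finite_subset[of _ "{1..n}"]) (use permutes_not_in[of c "{1..n}"] c in \<open>auto simp del: atLeastAtMost_iff\<close>)
      have "card (S \<union> ?supp) \<le> g D" using card_Un_le[of S ?supp] S nf by (simp add: g_def)
      moreover have "\<rho> x (c z) = c (\<rho> x z)" if \<rho>: "\<rho> \<in> alt_vals n (S \<union> ?supp)" for \<rho> x z
      proof -
        have fixed: "\<rho> y v = v" if "c v \<noteq> v" for y v using \<rho> that unfolding alt_vals_def by blast
        have inv: "\<rho> y (\<rho> (inv_letter y) v) = v" for y v using \<rho> unfolding alt_vals_def by blast
        have inj: "inj c" using c permutes_inj by auto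
        show ?thesis
        proof (cases "c z = z")
          case True
          have "c (\<rho> x z) = \<rho> x z"
          proof (rule ccontr)
            assume "c (\<rho> x z) \<noteq> \<rho> x z"
            then have "\<rho> (inv_letter x) (\<rho> x z) = \<rho> x z" by (rule fixed)
            then have "\<rho> x z = z" using inv[of "inv_letter x" z] by simp
            then show False using True \<open>c (\<rho> x z) \<noteq> \<rho> x z\<close> by simp
          qed
          then show ?thesis using True by simp
        next
          case False
          then have "c (c z) \<noteq> c z" using inj by (simp add: inj_eq)
          then show ?thesis using fixed False by simp
        qed
      qed
      moreover have "alt_vals n (S \<union> ?supp) \<subseteq> alt_vals n S" by (auto simp: alt_vals_def)
      ultimately show ?thesis using S fin by (intro exI[of _ "S \<union> ?supp"]) blast
    qed
    show "\<exists>\<rho>\<in>alt_vals n S. \<exists>z\<in>{1..n}. c0 (wfun \<rho> ys z) \<noteq> z"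
      if "?ok D S" "g D \<le> n" "c0 \<in> {c. c permutes {1..n}}" "snd ` set ys \<subseteq> {c. c permutes {1..n}}" "ys \<noteq> []" "length ys \<le> L"
        "successively (\<lambda>(x, c) (y, d). y = inv_letter x \<longrightarrow> ?far D S c) ys" for D S c0 ys
      by (rule alt_far_word[OF _ _ R_def]) (use that in \<open>auto simp: g_def\<close>)
  qed (use c0 ys nc in auto)
qed

section \<open>All rings inside one ring\<close>

text \<open>The product of all commutative rings with carrier in \<^typ>\<open>nat\<close> is a type-class ring, in which
  every such ring occurs as a corner \<open>e * univ\<close>.\<close>

typedef univ = "{f :: nat ring \<Rightarrow> nat. \<forall>F. if cring F then f F \<in> carrier F else f F = 0}"
  morphisms coord Abs_univ
proof
  show "(\<lambda>F :: nat ring. if cring F then \<zero>\<^bsub>F\<^esub> else 0) \<in>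
    {f. \<forall>F. if cring F then f F \<in> carrier F else f F = 0}"
    by (auto intro: abelian_monoid.zero_closed dest!: cring.axioms(1) ring.is_abelian_group abelian_group.axioms(1))
qed

definition mk_univ :: "(nat ring \<Rightarrow> nat) \<Rightarrow> univ" where
  "mk_univ h = Abs_univ (\<lambda>F. if cring F then h F else 0)"

lemma coord_closed [simp]: "cring F \<Longrightarrow> coord x F \<in> carrier F"
  using coord[of x] by (auto split: if_splits)

lemma coord_mk: "(\<And>F. cring F \<Longrightarrow> h F \<in> carrier F) \<Longrightarrow> cring F \<Longrightarrow> coord (mk_univ h) F = h F"
  unfolding mk_univ_def by (subst Abs_univ_inverse) auto

lemma univ_eqI: "(\<And>F. cring F \<Longrightarrow> coord x F = coord y F) \<Longrightarrow> x = y"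
proof -
  assume eq: "\<And>F. cring F \<Longrightarrow> coord x F = coord y F"
  have "coord x F = coord y F" for F
    using eq[of F] coord[of x] coord[of y] by (cases "cring F") auto
  then show "x = y" by (simp add: coord_inject[symmetric] fun_eq_iff)
qed

text \<open>A coordinate in which zero and one differ, as the class \<open>comm_ring_1\<close>
  demands.\<close>

definition ring_mod2 :: "nat ring" where
  "ring_mod2 = \<lparr>carrier = {0, 1}, mult = (*), one = 1, zero = 0, add = (\<lambda>x y. (x + y) mod 2)\<rparr>"

lemma cring_mod2: "cring ring_mod2"
proof (rule cringI)
  show "abelian_group ring_mod2"
    by (rule abelian_groupI) (auto simp: ring_mod2_def)
  show "comm_monoid ring_mod2"
    by (rule comm_monoidI) (auto simp: ring_mod2_def)
qed (auto simp: ring_mod2_def)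

instantiation univ :: comm_ring_1
begin

definition "0 = mk_univ (\<lambda>F. \<zero>\<^bsub>F\<^esub>)"
definition "1 = mk_univ (\<lambda>F. \<one>\<^bsub>F\<^esub>)"
definition "x + y = mk_univ (\<lambda>F. coord x F \<oplus>\<^bsub>F\<^esub> coord y F)"
definition "x * y = mk_univ (\<lambda>F. coord x F \<otimes>\<^bsub>F\<^esub> coord y F)"
definition "- x = mk_univ (\<lambda>F. \<ominus>\<^bsub>F\<^esub> coord x F)"
definition "x - (y :: univ) = x + - y"

lemma coord_ops:
  assumes "cring F"
  shows "coord 0 F = \<zero>\<^bsub>F\<^esub>" "coord 1 F = \<one>\<^bsub>F\<^esub>" "coord (x + y) F = coord x F \<oplus>\<^bsub>F\<^esub> coord y F"
    "coord (x * y) F = coord x F \<otimes>\<^bsub>F\<^esub> coord y F" "coord (- x) F = \<ominus>\<^bsub>F\<^esub> coord x F"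
proof -
  have *: "\<zero>\<^bsub>F\<^esub> \<in> carrier F" "\<one>\<^bsub>F\<^esub> \<in> carrier F" "coord x F \<oplus>\<^bsub>F\<^esub> coord y F \<in> carrier F"
    "coord x F \<otimes>\<^bsub>F\<^esub> coord y F \<in> carrier F" "\<ominus>\<^bsub>F\<^esub> coord x F \<in> carrier F" if "cring F" for F and x y :: univ
  proof -
    interpret cring F by fact
    show "\<zero>\<^bsub>F\<^esub> \<in> carrier F" "\<one>\<^bsub>F\<^esub> \<in> carrier F" "coord x F \<oplus>\<^bsub>F\<^esub> coord y F \<in> carrier F"
      "coord x F \<otimes>\<^bsub>F\<^esub> coord y F \<in> carrier F" "\<ominus>\<^bsub>F\<^esub> coord x F \<in> carrier F" using that by simp_all
  qed
  show "coord 0 F = \<zero>\<^bsub>F\<^esub>" "coord 1 F = \<one>\<^bsub>F\<^esub>" "coord (x + y) F = coord x F \<oplus>\<^bsub>F\<^esub> coord y F"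
    "coord (x * y) F = coord x F \<otimes>\<^bsub>F\<^esub> coord y F" "coord (- x) F = \<ominus>\<^bsub>F\<^esub> coord x F"
    unfolding zero_univ_def one_univ_def plus_univ_def times_univ_def uminus_univ_def
    by (subst coord_mk[OF _ assms]; simp add: *)+
qed

instance
proof
  fix x y z :: univ
  have c: "comm_monoid F" "abelian_group F" if "cring F" for F :: "nat ring"
    using that by (auto simp: cring_def ring_def)
  show "x + y + z = x + (y + z)" by (rule univ_eqI)
      (simp add: coord_ops abelian_monoid.a_assoc[OF abelian_group.axioms(1)[OF c(2)]])
  show "x + y = y + x" by (rule univ_eqI)
      (simp add: coord_ops abelian_monoid.a_comm[OF abelian_group.axioms(1)[OF c(2)]])
  show "0 + x = x" by (rule univ_eqI)
      (simp add: coord_ops abelian_monoid.l_zero[OF abelian_group.axioms(1)[OF c(2)]])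
  show "- x + x = 0" by (rule univ_eqI) (simp add: coord_ops abelian_group.l_neg[OF c(2)])
  show "x - y = x + - y" by (rule minus_univ_def)
  show "x * y * z = x * (y * z)" by (rule univ_eqI)
      (simp add: coord_ops monoid.m_assoc[OF comm_monoid.axioms(1)[OF c(1)]])
  show "x * y = y * x" by (rule univ_eqI) (simp add: coord_ops comm_monoid.m_comm[OF c(1)])
  show "1 * x = x" by (rule univ_eqI)
      (simp add: coord_ops monoid.l_one[OF comm_monoid.axioms(1)[OF c(1)]])
  show "(x + y) * z = x * z + y * z"
  proof (rule univ_eqI)
    fix F :: "nat ring" assume "cring F"
    then interpret cring F .
    show "coord ((x + y) * z) F = coord (x * z + y * z) F"
      using \<open>cring F\<close> by (simp add: coord_ops l_distr)
  qed
  show "(0::univ) \<noteq> 1"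
  proof
    assume "(0::univ) = 1"
    then have "coord 0 ring_mod2 = coord 1 ring_mod2" by simp
    then show False by (simp add: coord_ops[OF cring_mod2]) (simp add: ring_mod2_def)
  qed
qed

end

locale embedded_field = field F for F :: "nat ring" (structure)
begin

text \<open>Additive and multiplicative but not unital: \<open>\<one>\<close> goes to the idempotent
  \<open>e\<close>. This is the source of the factor \<open>e\<close> in formulas whose products may
  be empty.\<close>

definition emb :: "nat \<Rightarrow> univ" where
  "emb a = mk_univ (\<lambda>F'. if F' = F then a else \<zero>\<^bsub>F'\<^esub>)"

abbreviation e where "e \<equiv> emb \<one>"

lemma cringF: "cring F" by (rule cring_axioms)

lemma coord_emb:
  assumes "a \<in> carrier F" "cring F'"
  shows "coord (emb a) F' = (if F' = F then a else \<zero>\<^bsub>F'\<^esub>)"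
proof -
  have "\<zero>\<^bsub>F'\<^esub> \<in> carrier F'" if "cring F'" for F' :: "nat ring"
  proof -
    interpret R: cring F' by fact
    show ?thesis by simp
  qed
  then show ?thesis unfolding emb_def using assms by (subst coord_mk) auto
qed

lemma coord_emb_F [simp]: "a \<in> carrier F \<Longrightarrow> coord (emb a) F = a"
  by (simp add: coord_emb cringF)

lemma emb_inj: "a \<in> carrier F \<Longrightarrow> b \<in> carrier F \<Longrightarrow> emb a = emb b \<longleftrightarrow> a = b"
  by (metis coord_emb_F)

lemma emb_cong:
  assumes "coord x F = a" "\<And>F'. cring F' \<Longrightarrow> F' \<noteq> F \<Longrightarrow> coord x F' = \<zero>\<^bsub>F'\<^esub>"
  shows "x = emb a"
proof (rule univ_eqI)
  fix F' :: "nat ring" assume F': "cring F'"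
  have "a \<in> carrier F" using assms(1) cringF by auto
  then show "coord x F' = coord (emb a) F'" using assms F' by (simp add: coord_emb)
qed

lemma emb_zero [simp]: "emb \<zero> = 0"
  by (rule emb_cong[symmetric]) (simp_all add: coord_ops cringF)

lemma emb_add: "a \<in> carrier F \<Longrightarrow> b \<in> carrier F \<Longrightarrow> emb (a \<oplus> b) = emb a + emb b"
proof (rule emb_cong[symmetric])
  fix F' :: "nat ring" assume ab: "a \<in> carrier F" "b \<in> carrier F" and F': "cring F'" "F' \<noteq> F"
  interpret R: cring F' by fact
  show "coord (emb a + emb b) F' = \<zero>\<^bsub>F'\<^esub>" using ab F' by (simp add: coord_ops coord_emb)
qed (simp add: coord_ops cringF)

lemma emb_mult: "a \<in> carrier F \<Longrightarrow> b \<in> carrier F \<Longrightarrow> emb (a \<otimes> b) = emb a * emb b"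
proof (rule emb_cong[symmetric])
  fix F' :: "nat ring" assume ab: "a \<in> carrier F" "b \<in> carrier F" and F': "cring F'" "F' \<noteq> F"
  interpret R: cring F' by fact
  show "coord (emb a * emb b) F' = \<zero>\<^bsub>F'\<^esub>" using ab F' by (simp add: coord_ops coord_emb)
qed (simp add: coord_ops cringF)

text \<open>Multiplication by \<open>e\<close> projects to the coordinate \<open>F\<close>, so the
  solutions of \<open>e * t = t\<close> are exactly the embedded field elements.\<close>

lemma e_mult: "e * x = emb (coord x F)"
proof (rule emb_cong)
  show "coord (e * x) F = coord x F" by (simp add: coord_ops cringF)
  fix F' :: "nat ring" assume F': "cring F'" "F' \<noteq> F"
  interpret R: cring F' by fact
  show "coord (e * x) F' = \<zero>\<^bsub>F'\<^esub>" using F' by (simp add: coord_ops coord_emb)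
qed

lemma e_emb [simp]: "a \<in> carrier F \<Longrightarrow> e * emb a = emb a"
  by (simp add: e_mult)

lemma e_emb_left [simp]: "a \<in> carrier F \<Longrightarrow> e * (emb a * x) = emb a * x"
  by (simp add: mult.assoc[symmetric])

lemma emb_minus: "a \<in> carrier F \<Longrightarrow> emb (\<ominus> a) = - emb a"
  by (metis a_inv_closed add_eq_0_iff emb_add emb_zero r_neg)

lemma emb_diff: "a \<in> carrier F \<Longrightarrow> b \<in> carrier F \<Longrightarrow> emb (a \<ominus> b) = emb a - emb b"
  by (simp add: a_minus_def emb_add emb_minus)

lemma emb_finsum:
  assumes "finite A" "\<And>i. i \<in> A \<Longrightarrow> f i \<in> carrier F"
  shows "emb (\<Oplus>i\<in>A. f i) = (\<Sum>i\<in>A. emb (f i))"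
  using assms
proof (induction A)
  case (insert a A)
  then have "f \<in> A \<rightarrow> carrier F" "f a \<in> carrier F" by auto
  then show ?case using insert by (simp add: emb_add)
qed simp

lemma emb_sum_mult:
  assumes "finite A" "\<And>i. i \<in> A \<Longrightarrow> f i \<in> carrier F" "\<And>i. i \<in> A \<Longrightarrow> g i \<in> carrier F"
  shows "emb (\<Oplus>i\<in>A. f i \<otimes> g i) = (\<Sum>i\<in>A. emb (f i) * emb (g i))"
  using assms by (subst emb_finsum) (auto simp: emb_mult)

lemma emb_finprod:
  assumes "finite A" "\<And>i. i \<in> A \<Longrightarrow> f i \<in> carrier F"
  shows "emb (\<Otimes>i\<in>A. f i) = e * (\<Prod>i\<in>A. emb (f i))"
  using assms
proof (induction A)
  case (insert a A)
  then have "f \<in> A \<rightarrow> carrier F" "f a \<in> carrier F" by auto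
  then show ?case using insert by (simp add: emb_mult mult.left_commute)
qed simp

lemma emb_pow: "a \<in> carrier F \<Longrightarrow> emb (a [^] (n::nat)) = e * emb a ^ n"
  by (induction n) (simp_all add: emb_mult mult_ac)

lemma e_nz: "e \<noteq> 0"
proof
  assume "e = 0"
  then have "emb \<one> = emb \<zero>" by simp
  then show False using emb_inj[of \<one> \<zero>] by simp
qed

lemma e_inverse:
  assumes "e * t = t" "t \<noteq> 0"
  shows "\<exists>s. s * t = e"
proof -
  define a where "a = coord t F"
  have a: "a \<in> carrier F" "t = emb a" using assms e_mult[of t] by (simp_all add: a_def cringF)
  then have "a \<noteq> \<zero>" using assms by auto
  then have "inv a \<in> carrier F" "inv a \<otimes> a = \<one>" using a field_Units by auto
  then have "emb (inv a) * t = e" using a emb_mult[of "inv a" a] by simp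
  then show ?thesis by blast
qed

end

section \<open>Matrices as operators\<close>

definition vscale :: "univ \<Rightarrow> (nat \<Rightarrow> univ) \<Rightarrow> nat \<Rightarrow> univ" where
  "vscale t v = (\<lambda>i. t * v i)"

interpretation vs: Modules.module vscale
  by standard (auto simp: vscale_def fun_eq_iff algebra_simps)

locale matrix_space = embedded_field F for F :: "nat ring" (structure) + fixes m :: nat
begin

text \<open>Functions on all of \<open>nat\<close> make the pointwise type-class operations
  available; the support encodes the dimension, and the first condition keeps the entries in the
  field.\<close>

definition V :: "(nat \<Rightarrow> univ) set" where
  "V = {v. (\<forall>i. e * v i = v i) \<and> (\<forall>i\<ge>m. v i = 0)}"

definition vemb :: "nat vec \<Rightarrow> nat \<Rightarrow> univ" where
  "vemb x = (\<lambda>i. if i < m then emb (x $ i) else 0)"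

definition opr :: "nat mat \<Rightarrow> (nat \<Rightarrow> univ) \<Rightarrow> nat \<Rightarrow> univ" where
  "opr A v = (\<lambda>i. if i < m then \<Sum>k<m. emb (A $$ (i, k)) * v k else 0)"

definition unitv :: "nat \<Rightarrow> nat \<Rightarrow> univ" where
  "unitv j = (\<lambda>i. if i = j then e else 0)"

definition of_opr :: "((nat \<Rightarrow> univ) \<Rightarrow> nat \<Rightarrow> univ) \<Rightarrow> nat mat" where
  "of_opr T = mat m m (\<lambda>(i, j). coord (T (unitv j) i) F)"

abbreviation Mn where "Mn \<equiv> mat_monoid F m"

definition vlinear :: "((nat \<Rightarrow> univ) \<Rightarrow> nat \<Rightarrow> univ) \<Rightarrow> bool" where
  "vlinear c \<longleftrightarrow> (\<forall>x y. c (x + y) = c x + c y) \<and> (\<forall>a x. c (vscale a x) = vscale a (c x)) \<and> (\<forall>x\<in>V. c x \<in> V)"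

lemma V_subspace: "vs.subspace V"
  by (auto simp: vs.subspace_def V_def vscale_def algebra_simps)

lemma V_e: "x \<in> V \<Longrightarrow> vscale e x = x"
  by (auto simp: V_def vscale_def)

lemma carrier_Mn: "A \<in> carrier Mn \<longleftrightarrow> A \<in> carrier_mat m m \<and> (\<forall>i<m. \<forall>j<m. A $$ (i, j) \<in> carrier F)"
  by (simp add: mat_monoid_def)

lemma vemb_V: "x \<in> vecs F m \<Longrightarrow> vemb x \<in> V"
  by (auto simp: vecs_def vemb_def V_def)

lemma opr_vlinear: "A \<in> carrier Mn \<Longrightarrow> vlinear (opr A)"
  unfolding vlinear_def
  by (auto simp: opr_def fun_eq_iff vscale_def V_def carrier_Mn algebra_simps sum.distrib sum_distrib_left
      intro!: sum.cong)

lemma opr_vemb: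
  assumes "A \<in> carrier Mn" "x \<in> vecs F m"
  shows "opr A (vemb x) = vemb (mat_vec F m A x)"
proof
  fix i
  show "opr A (vemb x) i = vemb (mat_vec F m A x) i"
  proof (cases "i < m")
    case True
    have "emb (\<Oplus>k\<in>{..<m}. A $$ (i, k) \<otimes> x $ k) = (\<Sum>k<m. emb (A $$ (i, k)) * emb (x $ k))"
      by (rule emb_sum_mult) (use assms True in \<open>auto simp: carrier_Mn vecs_def\<close>)
    then show ?thesis using True by (simp add: opr_def vemb_def mat_vec_def)
  qed (simp add: opr_def vemb_def)
qed

lemma mult_Mn_closed: "A \<in> carrier Mn \<Longrightarrow> B \<in> carrier Mn \<Longrightarrow> A \<otimes>\<^bsub>Mn\<^esub> B \<in> carrier Mn"
  unfolding carrier_Mn by (auto simp: mat_monoid_def intro!: finsum_closed)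

lemma opr_mult:
  assumes A: "A \<in> carrier Mn" and B: "B \<in> carrier Mn"
  shows "opr (A \<otimes>\<^bsub>Mn\<^esub> B) v = opr A (opr B v)"
proof
  fix i
  show "opr (A \<otimes>\<^bsub>Mn\<^esub> B) v i = opr A (opr B v) i"
  proof (cases "i < m")
    case True
    have AB: "emb ((A \<otimes>\<^bsub>Mn\<^esub> B) $$ (i, k)) = (\<Sum>j<m. emb (A $$ (i, j)) * emb (B $$ (j, k)))" if "k < m" for k
    proof -
      have "emb (\<Oplus>j\<in>{..<m}. A $$ (i, j) \<otimes> B $$ (j, k)) = (\<Sum>j<m. emb (A $$ (i, j)) * emb (B $$ (j, k)))"
        by (rule emb_sum_mult) (use A B True that in \<open>auto simp: carrier_Mn\<close>)
      then show ?thesis using True that by (simp add: mat_monoid_def)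
    qed
    have "opr (A \<otimes>\<^bsub>Mn\<^esub> B) v i = (\<Sum>k<m. \<Sum>j<m. emb (A $$ (i, j)) * (emb (B $$ (j, k)) * v k))"
      using True AB by (simp add: opr_def sum_distrib_right mult.assoc)
    also have "\<dots> = (\<Sum>j<m. \<Sum>k<m. emb (A $$ (i, j)) * (emb (B $$ (j, k)) * v k))" by (rule sum.swap)
    also have "\<dots> = opr A (opr B v) i" using True by (simp add: opr_def sum_distrib_left)
    finally show ?thesis .
  qed (simp add: opr_def)
qed

lemma one_Mn: "\<one>\<^bsub>Mn\<^esub> \<in> carrier Mn"
  unfolding carrier_Mn by (auto simp: mat_monoid_def)

lemma opr_scalar:
  assumes "v \<in> V" "a \<in> carrier F"
  shows "opr (mat m m (\<lambda>(i, j). if i = j then a else \<zero>)) v = vscale (emb a) v"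
proof
  fix i
  show "opr (mat m m (\<lambda>(i, j). if i = j then a else \<zero>)) v i = vscale (emb a) v i"
  proof (cases "i < m")
    case True
    have "(\<Sum>k<m. emb (if i = k then a else \<zero>) * v k) = (\<Sum>k<m. if i = k then emb a * v k else 0)"
      by (rule sum.cong) auto
    then show ?thesis using True by (simp add: opr_def vscale_def)
  qed (use assms in \<open>simp add: opr_def vscale_def V_def\<close>)
qed

lemma opr_one: "v \<in> V \<Longrightarrow> opr \<one>\<^bsub>Mn\<^esub> v = v"
  using opr_scalar[of v \<one>] V_e by (simp add: mat_monoid_def)

lemma unitv_V: "j < m \<Longrightarrow> unitv j \<in> V"
  by (auto simp: unitv_def V_def)

lemma V_expand:
  assumes "v \<in> V"
  shows "v = (\<Sum>k<m. vscale (v k) (unitv k))"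
proof
  fix i
  have "(\<Sum>k<m. vscale (v k) (unitv k)) i = (\<Sum>k<m. v k * (if i = k then e else 0))"
    by (induction m) (auto simp: vscale_def unitv_def)
  also have "\<dots> = (\<Sum>k<m. if i = k then v i * e else 0)"
    by (rule sum.cong) auto
  also have "\<dots> = v i" using assms by (auto simp: V_def mult.commute[of _ e])
  finally show "v i = (\<Sum>k<m. vscale (v k) (unitv k)) i" by simp
qed

lemma vlinear_sum: "vlinear c \<Longrightarrow> c (\<Sum>k\<in>A. f k) = (\<Sum>k\<in>A. c (f k))"
proof -
  assume c: "vlinear c"
  then have "c 0 = 0" unfolding vlinear_def by (metis vs.scale_zero_left)
  moreover have "c (x + y) = c x + c y" for x y using c by (simp add: vlinear_def)
  ultimately show ?thesis by (induction A rule: infinite_finite_induct) simp_all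
qed

lemma vlinear_eqI:
  assumes "vlinear c" "vlinear d" "\<And>j. j < m \<Longrightarrow> c (unitv j) = d (unitv j)" "v \<in> V"
  shows "c v = d v"
proof -
  have "c v = (\<Sum>k<m. vscale (v k) (c (unitv k)))" if "vlinear c" for c
  proof -
    have "c v = c (\<Sum>k<m. vscale (v k) (unitv k))" using V_expand[OF assms(4)] by simp
    also have "\<dots> = (\<Sum>k<m. vscale (v k) (c (unitv k)))"
      unfolding vlinear_sum[OF that] using that by (simp add: vlinear_def)
    finally show ?thesis .
  qed
  then show ?thesis using assms by simp
qed

lemma opr_unitv:
  assumes "A \<in> carrier Mn" "i < m" "j < m"
  shows "opr A (unitv j) i = emb (A $$ (i, j))"
proof -
  have "(\<Sum>k<m. emb (A $$ (i, k)) * unitv j k) = (\<Sum>k<m. if j = k then emb (A $$ (i, k)) else 0)"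
    by (rule sum.cong) (use assms in \<open>auto simp: unitv_def carrier_Mn mult.commute[of _ e]\<close>)
  then show ?thesis using assms by (simp add: opr_def)
qed

lemma opr_inj:
  assumes "A \<in> carrier Mn" "B \<in> carrier Mn" "\<And>v. v \<in> V \<Longrightarrow> opr A v = opr B v"
  shows "A = B"
proof (rule eq_matI)
  show "dim_row A = dim_row B" "dim_col A = dim_col B" using assms by (auto simp: carrier_Mn)
  fix i j assume "i < dim_row B" "j < dim_col B"
  then have ij: "i < m" "j < m" using assms by (auto simp: carrier_Mn)
  then have "emb (A $$ (i, j)) = emb (B $$ (i, j))"
    using opr_unitv[OF assms(1) ij] opr_unitv[OF assms(2) ij] assms(3)[OF unitv_V] by simp
  then show "A $$ (i, j) = B $$ (i, j)" using ij assms by (simp add: emb_inj carrier_Mn)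
qed

lemma of_opr_carrier: "of_opr T \<in> carrier Mn"
  by (auto simp: carrier_Mn of_opr_def cringF)

lemma opr_of_opr:
  assumes "vlinear T" "v \<in> V"
  shows "opr (of_opr T) v = T v"
proof (rule vlinear_eqI[OF opr_vlinear[OF of_opr_carrier] assms(1) _ assms(2)])
  fix j assume j: "j < m"
  have T: "T (unitv j) \<in> V" using assms unitv_V[OF j] by (simp add: vlinear_def)
  show "opr (of_opr T) (unitv j) = T (unitv j)"
  proof
    fix i
    show "opr (of_opr T) (unitv j) i = T (unitv j) i"
    proof (cases "i < m")
      case True
      then show ?thesis using opr_unitv[OF of_opr_carrier True j] T j
        by (simp add: of_opr_def e_mult[symmetric]) (simp add: V_def)
    next
      case False
      then show ?thesis using T by (simp add: opr_def V_def)
    qed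
  qed
qed

text \<open>Matrices are determined by their operators on \<open>V\<close>, so the monoid laws come
  from the composition of functions.\<close>

lemma monoid_Mn: "monoid Mn"
proof (rule monoidI)
  fix A B C assume M: "A \<in> carrier Mn" "B \<in> carrier Mn" "C \<in> carrier Mn"
  show "A \<otimes>\<^bsub>Mn\<^esub> B \<otimes>\<^bsub>Mn\<^esub> C = A \<otimes>\<^bsub>Mn\<^esub> (B \<otimes>\<^bsub>Mn\<^esub> C)"
    by (rule opr_inj) (use M in \<open>simp_all add: mult_Mn_closed opr_mult\<close>)
next
  fix A assume M: "A \<in> carrier Mn"
  have V: "opr A v \<in> V" if "v \<in> V" for v using opr_vlinear[OF M] that by (simp add: vlinear_def)
  show "\<one>\<^bsub>Mn\<^esub> \<otimes>\<^bsub>Mn\<^esub> A = A"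
    by (rule opr_inj) (use M V in \<open>simp_all add: mult_Mn_closed one_Mn opr_mult opr_one\<close>)
  show "A \<otimes>\<^bsub>Mn\<^esub> \<one>\<^bsub>Mn\<^esub> = A"
    by (rule opr_inj) (use M in \<open>simp_all add: mult_Mn_closed one_Mn opr_mult opr_one\<close>)
qed (simp_all add: mult_Mn_closed one_Mn)

abbreviation GLn where "GLn \<equiv> GL F m"

sublocale GL: group "GLn"
  unfolding GL_def by (rule monoid.units_group[OF monoid_Mn])

lemma GL_simps:
  "A \<in> carrier GLn \<Longrightarrow> A \<in> carrier Mn" "x \<otimes>\<^bsub>GLn\<^esub> y = x \<otimes>\<^bsub>Mn\<^esub> y" "\<one>\<^bsub>GLn\<^esub> = \<one>\<^bsub>Mn\<^esub>"
  by (auto simp: GL_def units_of_def Units_def)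

lemma opr_GL:
  assumes "A \<in> carrier GLn"
  shows "vlinear (opr A)" "v \<in> V \<Longrightarrow> opr A v \<in> V"
    "v \<in> V \<Longrightarrow> opr (inv\<^bsub>GLn\<^esub> A) (opr A v) = v" "v \<in> V \<Longrightarrow> opr A (opr (inv\<^bsub>GLn\<^esub> A) v) = v"
proof -
  show l: "vlinear (opr A)" by (rule opr_vlinear) (simp add: GL_simps assms)
  show "v \<in> V \<Longrightarrow> opr A v \<in> V" using l by (simp add: vlinear_def)
  have i: "inv\<^bsub>GLn\<^esub> A \<in> carrier GLn" using assms by simp
  have "opr (inv\<^bsub>GLn\<^esub> A) (opr A v) = opr (inv\<^bsub>GLn\<^esub> A \<otimes>\<^bsub>GLn\<^esub> A) v"
    "opr A (opr (inv\<^bsub>GLn\<^esub> A) v) = opr (A \<otimes>\<^bsub>GLn\<^esub> inv\<^bsub>GLn\<^esub> A) v"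
    unfolding GL_simps(2) using assms i by (simp_all add: opr_mult GL_simps(1))
  then show "v \<in> V \<Longrightarrow> opr (inv\<^bsub>GLn\<^esub> A) (opr A v) = v" "v \<in> V \<Longrightarrow> opr A (opr (inv\<^bsub>GLn\<^esub> A) v) = v"
    using assms by (simp_all add: GL_simps(3) opr_one)
qed

lemma opr_GL_mult: "A \<in> carrier GLn \<Longrightarrow> B \<in> carrier GLn \<Longrightarrow> opr (A \<otimes>\<^bsub>GLn\<^esub> B) v = opr A (opr B v)"
  by (simp add: GL_simps opr_mult)

lemma of_opr_GL:
  assumes T: "vlinear T" and T': "vlinear T'" and "\<And>v. v \<in> V \<Longrightarrow> T (T' v) = v" "\<And>v. v \<in> V \<Longrightarrow> T' (T v) = v"
  shows "of_opr T \<in> carrier GLn"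
proof -
  have TV: "T v \<in> V" "T' v \<in> V" if "v \<in> V" for v using T T' that by (auto simp: vlinear_def)
  have "of_opr T \<otimes>\<^bsub>Mn\<^esub> of_opr T' = \<one>\<^bsub>Mn\<^esub>"
    by (rule opr_inj) (use assms TV in \<open>simp_all add: mult_Mn_closed one_Mn of_opr_carrier opr_mult opr_one opr_of_opr\<close>)
  moreover have "of_opr T' \<otimes>\<^bsub>Mn\<^esub> of_opr T = \<one>\<^bsub>Mn\<^esub>"
    by (rule opr_inj) (use assms TV in \<open>simp_all add: mult_Mn_closed one_Mn of_opr_carrier opr_mult opr_one opr_of_opr\<close>)
  ultimately show ?thesis
    unfolding GL_def units_of_def Units_def using of_opr_carrier by auto
qed

lemma scalars_iff:
  assumes A: "A \<in> carrier Mn"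
  shows "A \<in> scalars F m \<longleftrightarrow> (\<exists>t. \<forall>v\<in>V. opr A v = vscale t v)"
proof
  assume "A \<in> scalars F m"
  then show "\<exists>t. \<forall>v\<in>V. opr A v = vscale t v" using opr_scalar by (auto simp: scalars_def)
next
  assume "\<exists>t. \<forall>v\<in>V. opr A v = vscale t v"
  then obtain t where t: "\<And>v. v \<in> V \<Longrightarrow> opr A v = vscale t v" by blast
  \<comment> \<open>\<open>t\<close> is an arbitrary element of \<open>univ\<close>, but only its
    component in \<open>F\<close> acts on \<open>V\<close>.\<close>
  define a where "a = coord t F"
  have a: "a \<in> carrier F" by (simp add: a_def cringF)
  have "opr A v = opr (mat m m (\<lambda>(i, j). if i = j then a else \<zero>)) v" if v: "v \<in> V" for v
  proof -
    have "vscale t v = vscale (emb a) v"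
      using v by (auto simp: a_def e_mult[symmetric] vscale_def V_def fun_eq_iff) (metis mult.assoc mult.commute)
    then show ?thesis using opr_scalar[OF v a] t[OF v] by simp
  qed
  then have "A = mat m m (\<lambda>(i, j). if i = j then a else \<zero>)"
    by (intro opr_inj[OF A]) (auto simp: carrier_Mn a)
  then show "A \<in> scalars F m" using a by (auto simp: scalars_def)
qed

end

section \<open>Mixed identities and words of operators\<close>

lemma cancels_content:
  assumes "cancels xs" "\<forall>x\<in>set xs. fst x < r"
  shows "foldr (letter_act (singleton_group ())) xs ((), []) = ((), [])"
  using assms
proof (induction rule: cancels.induct)
  case (Cons us vs x)
  interpret S: group "singleton_group ()" by simp
  have one: "((), []) \<in> reduced_words (singleton_group ()) r"
    using S.one_reduced[of r] by (simp add: singleton_group_def)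
  have "foldr (letter_act (singleton_group ())) vs ((), []) \<in> reduced_words (singleton_group ()) r"
    if "\<forall>x\<in>set vs. fst x < r" for vs
    using that one by (induction vs) (auto intro: S.letter_act_closed)
  then have "foldr (letter_act (singleton_group ())) vs ((), []) \<in> reduced_words (singleton_group ()) r"
    using Cons.prems by simp
  then have "foldr (letter_act (singleton_group ())) (us @ x # inv_letter x # vs) ((), []) =
    foldr (letter_act (singleton_group ())) (us @ vs) ((), [])"
    by (simp add: S.letter_act_cancel)
  then show ?case using Cons by simp
qed simp

lemma nonsingular_not_cancels:
  assumes "nonsingular r w" "\<forall>(y, d)\<in>set (snd w). fst y < r \<and> d \<in> X"
  shows "\<not> cancels (map fst (snd w))"
proof
  assume c: "cancels (map fst (snd w))"
  have "Defs.content w = ((), [])"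
    unfolding Defs.content_def by (rule cancels_content[OF c]) (use assms(2) in auto)
  then show False using assms(1) by (simp add: nonsingular_def free_prod_def singleton_group_def)
qed

lemma mixed_identityD:
  assumes "mixed_identity G r w"
  shows "fst w \<in> carrier G" "\<forall>(y, d)\<in>set (snd w). fst y < r \<and> d \<in> carrier G"
    "g \<in> {..<r} \<rightarrow> carrier G \<Longrightarrow> word_val G g w = \<one>\<^bsub>G\<^esub>"
  using assms reduced_wordsD[of w G r] by (auto simp: mixed_identity_def free_prod_def)

lemma alt_mixed_identity_length:
  assumes w: "mixed_identity (alt_group n) r w" "nonsingular r w"
  shows "n < 4 ^ word_length w * (12 * word_length w + 9)"
proof (rule ccontr)
  let ?G = "alt_group n"
  assume "\<not> ?thesis"
  then have n: "4 ^ word_length w * (12 * word_length w + 9) \<le> n" by simp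
  note D = mixed_identityD[OF w(1)]
  have perm: "c permutes {1..n}" if "c \<in> carrier ?G" for c using that by (simp add: alt_group_carrier)
  have "\<exists>\<rho>\<in>alt_vals n {}. \<exists>z\<in>{1..n}. fst w (wfun \<rho> (snd w) z) \<noteq> z"
  proof (rule nonsingular_word_alt[OF n])
    show "fst w permutes {1..n}" by (rule perm[OF D(1)])
    show "\<forall>c\<in>snd ` set (snd w). c permutes {1..n}" using D(2) perm by auto
    show "\<not> cancels (map fst (snd w))" by (rule nonsingular_not_cancels[OF w(2) D(2)])
  qed (simp add: word_length_def)
  then obtain \<rho> z where \<rho>: "\<rho> \<in> alt_vals n {}" and z: "fst w (wfun \<rho> (snd w) z) \<noteq> z" by blast
  have g: "\<rho> x \<in> carrier ?G" and inv: "\<rho> x (\<rho> (inv_letter x) v) = v" for x v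
    using \<rho> unfolding alt_vals_def by blast+
  define g where "g i = \<rho> (i, True)" for i :: nat
  have val: "letter_val ?G g x = \<rho> x" for x
  proof (cases "snd x")
    case True
    then show ?thesis by (cases x) (simp add: letter_val_def g_def)
  next
    case False
    then obtain i where x: "x = (i, False)" by (cases x) auto
    have "\<rho> x v = inv' (g i) v" for v
      using alt_inv_apply(1)[OF g[of "(i, True)"], of "\<rho> x v"] inv[of "(i, True)" v]
      by (simp add: g_def x inv_letter_def)
    then show ?thesis using alt_group_inv_equality[OF g[of "(i, True)"]]
      by (simp add: letter_val_def x g_def fun_eq_iff)
  qed
  have "foldr (\<lambda>(x, d) h. letter_val ?G g x \<otimes>\<^bsub>?G\<^esub> (d \<otimes>\<^bsub>?G\<^esub> h)) ys \<one>\<^bsub>?G\<^esub> = wfun \<rho> ys" for ys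
    by (induction ys) (auto simp: alt_group_one alt_group_mult val fun_eq_iff)
  then have "word_val ?G g w = fst w \<circ> wfun \<rho> (snd w)"
    by (simp add: word_val_def alt_group_mult)
  moreover have "word_val ?G g w = id"
    using D(3)[of g] g by (simp add: g_def alt_group_one)
  ultimately show False using z by (metis comp_apply id_apply)
qed

text \<open>All that is asked of the group \<open>H\<close> is that it contains the transvections of
  \<open>B\<close>. Its elements need not preserve \<open>B\<close>, which admits the special linear
  groups.\<close>

locale classical_space = matrix_space F m +
    hyp_space vscale "embedded_field.emb F \<one>\<^bsub>F\<^esub>" eps "matrix_space.V F m" E E' B k
  for F :: "nat ring" (structure) and m eps E E' B k +
  fixes H :: "nat mat set" and J a b
  assumes m: "0 < m" and H: "subgroup H (GL F m)"
    and S: "hsys 0 J a b"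
    and transv_H: "\<And>p r s. sing p \<Longrightarrow> sing r \<Longrightarrow> B p r = 0 \<Longrightarrow> s = 1 \<or> s = - 1 \<Longrightarrow>
      \<exists>A\<in>H. \<forall>v\<in>V. opr A v = transv s p r v"
begin

definition Hgrp where "Hgrp = GLn\<lparr>carrier := H\<rparr>"
definition Z where "Z = H \<inter> scalars F m"

lemma group_Hgrp: "group Hgrp"
  unfolding Hgrp_def by (rule GL.subgroup_imp_group[OF H])

lemma Hgrp_simps: "carrier Hgrp = H" "x \<otimes>\<^bsub>Hgrp\<^esub> y = x \<otimes>\<^bsub>GLn\<^esub> y" "\<one>\<^bsub>Hgrp\<^esub> = \<one>\<^bsub>GLn\<^esub>"
  "x \<in> H \<Longrightarrow> inv\<^bsub>Hgrp\<^esub> x = inv\<^bsub>GLn\<^esub> x"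
  using GL.m_inv_consistent[OF H] by (auto simp: Hgrp_def)

lemma H_GL: "A \<in> H \<Longrightarrow> A \<in> carrier GLn"
  using subgroup.subset[OF H] by auto

lemma Z_iff: "A \<in> H \<Longrightarrow> A \<in> Z \<longleftrightarrow> (\<exists>t. \<forall>v\<in>V. opr A v = vscale t v)"
  using scalars_iff[OF GL_simps(1)[OF H_GL]] by (auto simp: Z_def)

lemma H_closed: "A \<in> H \<Longrightarrow> C \<in> H \<Longrightarrow> A \<otimes>\<^bsub>GLn\<^esub> C \<in> H" "A \<in> H \<Longrightarrow> inv\<^bsub>GLn\<^esub> A \<in> H" "\<one>\<^bsub>GLn\<^esub> \<in> H"
  using H by (auto simp: subgroup.m_closed subgroup.m_inv_closed subgroup.one_closed)

lemma vlinear_scale: "vlinear c \<Longrightarrow> c (vscale t v) = vscale t (c v)"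
  by (simp add: vlinear_def)

lemma Z_normal: "Z \<lhd> Hgrp"
proof -
  interpret Hg: group Hgrp by (rule group_Hgrp)
  have sub: "subgroup Z Hgrp"
  proof
    show "Z \<subseteq> carrier Hgrp" by (auto simp: Z_def Hgrp_simps)
    show "\<one>\<^bsub>Hgrp\<^esub> \<in> Z" unfolding Hgrp_simps Z_iff[OF H_closed(3)]
      by (rule exI[of _ 1]) (simp add: GL_simps opr_one)
  next
    fix x y assume xy: "x \<in> Z" "y \<in> Z"
    then have H: "x \<in> H" "y \<in> H" by (auto simp: Z_def)
    obtain t where t: "\<And>v. v \<in> V \<Longrightarrow> opr x v = vscale t v" using Z_iff[OF H(1)] xy(1) by blast
    obtain u where u: "\<And>v. v \<in> V \<Longrightarrow> opr y v = vscale u v" using Z_iff[OF H(2)] xy(2) by blast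
    have "opr (x \<otimes>\<^bsub>GLn\<^esub> y) v = vscale (u * t) v" if v: "v \<in> V" for v
      using t[OF v] u[OF v] H by (simp add: opr_GL_mult H_GL vlinear_scale[OF opr_GL(1)])
    then show "x \<otimes>\<^bsub>Hgrp\<^esub> y \<in> Z" unfolding Hgrp_simps Z_iff[OF H_closed(1)[OF H]] by blast
  next
    fix x assume x: "x \<in> Z"
    then have xH: "x \<in> H" by (auto simp: Z_def)
    obtain t where t: "\<And>v. v \<in> V \<Longrightarrow> opr x v = vscale t v" using Z_iff[OF xH] x by blast
    have u0: "unitv 0 \<in> V" "unitv 0 0 = e" using unitv_V[OF m] by (simp_all add: unitv_def[of 0])
    \<comment> \<open>The scalar of an invertible matrix is nonzero in the field; seeing this takes
      a nonzero vector, hence \<open>0 < m\<close>.\<close>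
    have "e * t \<noteq> 0"
    proof
      assume "e * t = 0"
      then have "vscale t (unitv 0) = 0" by (auto simp: vscale_def unitv_def fun_eq_iff mult.commute)
      then have "opr x (unitv 0) = 0" using t[OF u0(1)] by simp
      then have "opr (inv\<^bsub>GLn\<^esub> x) 0 = unitv 0" using opr_GL(3)[OF H_GL[OF xH] u0(1)] by simp
      moreover have "opr (inv\<^bsub>GLn\<^esub> x) 0 = 0" by (auto simp: opr_def fun_eq_iff)
      ultimately have "unitv 0 0 = 0" by simp
      then show False using u0(2) e_nz by simp
    qed
    then obtain s where s: "s * (e * t) = e" using e_inverse[of "e * t"] by (auto simp: mult.assoc[symmetric])
    have "opr (inv\<^bsub>GLn\<^esub> x) v = vscale s v" if v: "v \<in> V" for v
    proof -
      let ?y = "opr (inv\<^bsub>GLn\<^esub> x) v"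
      have y: "?y \<in> V" using opr_GL(2)[of "inv\<^bsub>GLn\<^esub> x"] H_GL H_closed(2)[OF xH] v by auto
      have "v = vscale t ?y" using opr_GL(4)[OF H_GL[OF xH] v] t[OF y] by simp
      then have "vscale s v = vscale s (vscale t (vscale e ?y))" using V_e[OF y] by simp
      also have "\<dots> = vscale e ?y" using s by (simp add: mult_ac)
      finally show ?thesis using V_e[OF y] by simp
    qed
    then show "inv\<^bsub>Hgrp\<^esub> x \<in> Z" unfolding Hgrp_simps(4)[OF xH] Z_iff[OF H_closed(2)[OF xH]] by blast
  qed
  have "x \<otimes>\<^bsub>Hgrp\<^esub> h \<otimes>\<^bsub>Hgrp\<^esub> inv\<^bsub>Hgrp\<^esub> x \<in> Z" if x: "x \<in> carrier Hgrp" and h: "h \<in> Z" for x h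
  proof -
    have H: "x \<in> H" "h \<in> H" "inv\<^bsub>GLn\<^esub> x \<in> H" using x h H_closed by (auto simp: Z_def Hgrp_simps)
    obtain t where t: "\<And>v. v \<in> V \<Longrightarrow> opr h v = vscale t v" using Z_iff[OF H(2)] h by blast
    have "opr (x \<otimes>\<^bsub>GLn\<^esub> h \<otimes>\<^bsub>GLn\<^esub> inv\<^bsub>GLn\<^esub> x) v = vscale t v" if v: "v \<in> V" for v
      using H v t by (simp add: opr_GL_mult H_GL opr_GL vlinear_scale[OF opr_GL(1)])
    then show ?thesis using H H_closed Z_iff by (auto simp: Hgrp_simps)
  qed
  then show ?thesis using sub by (simp add: Hg.normal_inv_iff)
qed

definition PG where "PG = projective F m H"

lemma PG_eq: "PG = Hgrp Mod Z"
  by (simp add: PG_def projective_def Hgrp_def Z_def)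

definition coset where "coset A = Z #>\<^bsub>Hgrp\<^esub> A"

lemma coset_hom: "coset \<in> hom Hgrp PG"
  unfolding PG_eq coset_def[abs_def] by (rule normal.r_coset_hom_Mod[OF Z_normal])

lemma group_PG: "group PG"
  unfolding PG_eq by (rule normal.factorgroup_is_group[OF Z_normal])

lemma coset_mult: "A \<in> H \<Longrightarrow> C \<in> H \<Longrightarrow> coset A \<otimes>\<^bsub>PG\<^esub> coset C = coset (A \<otimes>\<^bsub>GLn\<^esub> C)"
  using hom_mult[OF coset_hom, of A C] by (simp add: Hgrp_simps)

lemma coset_closed: "A \<in> H \<Longrightarrow> coset A \<in> carrier PG"
  using hom_in_carrier[OF coset_hom, of A] by (simp add: Hgrp_simps)

lemma coset_one: "coset \<one>\<^bsub>GLn\<^esub> = \<one>\<^bsub>PG\<^esub>"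
  using hom_one[OF coset_hom group_Hgrp group_PG] by (simp add: Hgrp_simps)

lemma coset_inv: "A \<in> H \<Longrightarrow> inv\<^bsub>PG\<^esub> coset A = coset (inv\<^bsub>GLn\<^esub> A)"
  using group_hom.hom_inv[of Hgrp PG coset A] group_Hgrp group_PG coset_hom
  by (simp add: group_hom_def group_hom_axioms_def Hgrp_simps)

lemma coset_eq_one:
  assumes "A \<in> H" "coset A = \<one>\<^bsub>PG\<^esub>"
  shows "A \<in> Z"
proof -
  have "A \<in> Z #>\<^bsub>Hgrp\<^esub> A"
    using group.rcos_self[OF group_Hgrp, of A Z] normal_imp_subgroup[OF Z_normal] assms(1)
    by (simp add: Hgrp_simps)
  then show ?thesis using assms(2) by (simp add: coset_def PG_eq FactGroup_def)
qed

lemma PG_rep: "c \<in> carrier PG \<Longrightarrow> \<exists>A\<in>H. c = coset A"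
  by (auto simp: PG_eq FactGroup_def RCOSETS_def coset_def Hgrp_simps)

lemma grp_matrix:
  assumes "g \<in> grp X"
  shows "\<exists>A\<in>H. \<forall>v\<in>V. opr A v = g v"
  using assms
proof (induction rule: grp.induct)
  case id
  show ?case using H_closed(3) by (intro bexI[of _ "\<one>\<^bsub>GLn\<^esub>"]) (auto simp: GL_simps opr_one)
next
  case (step g p r s)
  from step.IH obtain A where A: "A \<in> H" "\<And>v. v \<in> V \<Longrightarrow> opr A v = g v" by blast
  obtain A' where A': "A' \<in> H" "\<And>v. v \<in> V \<Longrightarrow> opr A' v = transv s p r v"
    using transv_H[OF step.hyps(4-7)] by blast
  have "opr (A' \<otimes>\<^bsub>GLn\<^esub> A) v = transv s p r (g v)" if v: "v \<in> V" for v
    using A A' v opr_GL(2)[OF H_GL[OF A(1)] v] by (simp add: opr_GL_mult H_GL)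
  then show ?case using H_closed(1)[OF A'(1) A(1)] by blast
qed

text \<open>Lifting the constants to matrices turns an identity of the projective group into a word
  of operators whose values lie in \<open>Z\<close>, that is, act as scalars; this contradicts
  \<open>nonsingular_word_not_scalar\<close>. Any choice of lifts will do.\<close>

theorem projective_identity_length:
  assumes w: "mixed_identity PG r w" "nonsingular r w"
  shows "k < 14 ^ word_length w * (12 * (2 * word_length w + 2) ^ 3 + 1)"
proof (rule ccontr)
  assume "\<not> ?thesis"
  then have k: "14 ^ word_length w * (12 * (2 * word_length w + 2) ^ 3 + 1) \<le> k" by simp
  note D = mixed_identityD[OF w(1)]
  define rep where "rep c = (SOME A. A \<in> H \<and> c = coset A)" for c
  have rep: "rep c \<in> H" "coset (rep c) = c" if "c \<in> carrier PG" for c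
    using someI_ex[of "\<lambda>A. A \<in> H \<and> c = coset A"] PG_rep[OF that] by (auto simp: rep_def)
  \<comment> \<open>Agreement is asked on \<open>V\<close> only: \<open>Cs\<close> must contain the
    identity function, whereas a matrix operator has zero entries from coordinate \<open>m\<close>
    on.\<close>
  define Cs where "Cs = {c. linop c \<and> (\<exists>A\<in>H. \<forall>v\<in>V. c v = opr A v)}"
  have lv: "linop c \<longleftrightarrow> vlinear c" for c by (simp add: linop_def vlinear_def)
  have opr_Cs: "opr A \<in> Cs" if "A \<in> H" for A
    using that opr_GL(1)[OF H_GL] by (auto simp: Cs_def lv)
  define ys where "ys = map (\<lambda>(x, d). (x, opr (rep d))) (snd w)"
  have fst_ys: "map fst ys = map fst (snd w)" by (auto simp: ys_def)
  have "\<exists>\<rho>\<in>vals (hspan J a b). \<exists>p. \<exists>z\<in>V. B p (opr (rep (fst w)) (wfun \<rho> ys z)) \<noteq> 0 \<and> B p z = 0"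
  proof (rule nonsingular_word_not_scalar[OF S k, where Cs = Cs])
    show "linop c" if "c \<in> Cs" for c using that by (simp add: Cs_def)
    show "y = 0" if cy: "c \<in> Cs" "y \<in> V" "c y = 0" for c y
    proof -
      obtain A where A: "A \<in> H" "\<forall>v\<in>V. c v = opr A v" using cy(1) by (auto simp: Cs_def)
      then have "y = opr (inv\<^bsub>GLn\<^esub> A) 0" using opr_GL(3)[OF H_GL[OF A(1)] cy(2)] cy by simp
      also have "\<dots> = 0" by (auto simp: opr_def fun_eq_iff)
      finally show ?thesis .
    qed
    have "linop (\<lambda>z. z)" by (simp add: linop_def)
    moreover have "\<forall>v\<in>V. v = opr \<one>\<^bsub>GLn\<^esub> v" by (simp add: GL_simps opr_one)
    ultimately show "(\<lambda>z. z) \<in> Cs" using H_closed(3) unfolding Cs_def by blast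
    show "(\<lambda>z. c (d z)) \<in> Cs" if cd: "c \<in> Cs" "d \<in> Cs" for c d
    proof -
      obtain A A' where A: "A \<in> H" "\<forall>v\<in>V. c v = opr A v" "A' \<in> H" "\<forall>v\<in>V. d v = opr A' v"
        using cd by (auto simp: Cs_def)
      have l: "linop c" "linop d" using cd by (auto simp: Cs_def)
      then have "linop (\<lambda>z. c (d z))" by (simp add: linop_def)
      moreover have "\<forall>v\<in>V. c (d v) = opr (A \<otimes>\<^bsub>GLn\<^esub> A') v"
        using A V_linop[OF l(2)] by (simp add: opr_GL_mult H_GL)
      ultimately show ?thesis using H_closed(1)[OF A(1,3)] unfolding Cs_def by blast
    qed
    show "opr (rep (fst w)) \<in> Cs" by (rule opr_Cs[OF rep(1)[OF D(1)]])
    show "snd ` set ys \<subseteq> Cs" using D(2) opr_Cs rep(1) by (auto simp: ys_def)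
    show "\<not> cancels (map fst ys)" unfolding fst_ys by (rule nonsingular_not_cancels[OF w(2) D(2)])
  qed (simp add: ys_def word_length_def)
  then obtain \<rho> p z where \<rho>: "\<rho> \<in> vals (hspan J a b)" and z: "z \<in> V"
    and nz: "B p (opr (rep (fst w)) (wfun \<rho> ys z)) \<noteq> 0" and Bz: "B p z = 0" by blast
  have \<rho>_grp: "\<rho> x \<in> grp (hspan J a b)" and inv: "\<rho> x (\<rho> (inv_letter x) v) = v" for x v
    using \<rho> unfolding vals_def by blast+
  obtain M where M: "\<And>x. M x \<in> H" "\<And>x v. v \<in> V \<Longrightarrow> opr (M x) v = \<rho> x v"
    using grp_matrix[OF \<rho>_grp] by metis
  define g where "g i = coset (M (i, True))" for i :: nat
  have val: "\<exists>A\<in>H. letter_val PG g x = coset A \<and> (\<forall>v\<in>V. opr A v = \<rho> x v)" for x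
  proof (cases "snd x")
    case True
    then show ?thesis using M by (intro bexI[of _ "M x"]) (cases x, auto simp: letter_val_def g_def)
  next
    case False
    then obtain i where x: "x = (i, False)" by (cases x) auto
    let ?A = "M (i, True)"
    have "opr (inv\<^bsub>GLn\<^esub> ?A) v = \<rho> x v" if v: "v \<in> V" for v
    proof -
      have r: "\<rho> x v \<in> V" by (rule grp_V[OF \<rho>_grp v])
      have "opr ?A (\<rho> x v) = v" using M(2)[OF r] inv[of "(i, True)" v] by (simp add: x inv_letter_def)
      then show ?thesis using opr_GL(3)[OF H_GL[OF M(1)] r, of "(i, True)"] by simp
    qed
    then show ?thesis using M(1) coset_inv[OF M(1)] H_closed(2)[OF M(1)]
      by (intro bexI[of _ "inv\<^bsub>GLn\<^esub> ?A"]) (auto simp: letter_val_def g_def x)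
  qed
  have "\<exists>A\<in>H. foldr (\<lambda>(x, d) h. letter_val PG g x \<otimes>\<^bsub>PG\<^esub> (d \<otimes>\<^bsub>PG\<^esub> h)) us \<one>\<^bsub>PG\<^esub> = coset A \<and>
    (\<forall>v\<in>V. opr A v = wfun \<rho> (map (\<lambda>(x, d). (x, opr (rep d))) us) v)"
    if "\<forall>(y, d)\<in>set us. d \<in> carrier PG" for us
    using that
  proof (induction us)
    case Nil
    show ?case using H_closed(3) coset_one by (intro bexI[of _ "\<one>\<^bsub>GLn\<^esub>"]) (auto simp: GL_simps opr_one)
  next
    case (Cons yd us)
    obtain x d where yd: "yd = (x, d)" by (cases yd)
    obtain A where A: "A \<in> H" "foldr (\<lambda>(x, d) h. letter_val PG g x \<otimes>\<^bsub>PG\<^esub> (d \<otimes>\<^bsub>PG\<^esub> h)) us \<one>\<^bsub>PG\<^esub> = coset A"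
      "\<forall>v\<in>V. opr A v = wfun \<rho> (map (\<lambda>(x, d). (x, opr (rep d))) us) v" using Cons by auto
    obtain A' where A': "A' \<in> H" "letter_val PG g x = coset A'" "\<forall>v\<in>V. opr A' v = \<rho> x v"
      using val by blast
    have d: "rep d \<in> H" "coset (rep d) = d" using rep Cons.prems yd by auto
    let ?A = "A' \<otimes>\<^bsub>GLn\<^esub> (rep d \<otimes>\<^bsub>GLn\<^esub> A)"
    have rd: "rep d \<otimes>\<^bsub>GLn\<^esub> A \<in> H" by (rule H_closed(1)[OF d(1) A(1)])
    have AH: "?A \<in> H" by (rule H_closed(1)[OF A'(1) rd])
    have "coset A' \<otimes>\<^bsub>PG\<^esub> (d \<otimes>\<^bsub>PG\<^esub> coset A) = coset ?A"
      using coset_mult[OF d(1) A(1)] coset_mult[OF A'(1) rd] d(2) by simp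
    moreover have "opr ?A v = \<rho> x (opr (rep d) (wfun \<rho> (map (\<lambda>(x, d). (x, opr (rep d))) us) v))" if v: "v \<in> V" for v
    proof -
      have 1: "opr A v \<in> V" by (rule opr_GL(2)[OF H_GL[OF A(1)] v])
      have 2: "opr (rep d) (opr A v) \<in> V" by (rule opr_GL(2)[OF H_GL[OF d(1)] 1])
      show ?thesis
        using A(3) v A'(3) 2 by (simp add: opr_GL_mult H_GL A(1) A'(1) d(1) rd)
    qed
    ultimately show ?case using AH A(2) A'(2) by (intro bexI[of _ ?A]) (auto simp: yd)
  qed
  from this[of "snd w"] obtain A where A: "A \<in> H"
    "foldr (\<lambda>(x, d) h. letter_val PG g x \<otimes>\<^bsub>PG\<^esub> (d \<otimes>\<^bsub>PG\<^esub> h)) (snd w) \<one>\<^bsub>PG\<^esub> = coset A"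
    "\<forall>v\<in>V. opr A v = wfun \<rho> ys v" using D(2) unfolding ys_def by blast
  let ?A = "rep (fst w) \<otimes>\<^bsub>GLn\<^esub> A"
  have c0: "rep (fst w) \<in> H" "coset (rep (fst w)) = fst w" using rep[OF D(1)] by auto
  have AH: "?A \<in> H" by (rule H_closed(1)[OF c0(1) A(1)])
  have "word_val PG g w = coset ?A"
    unfolding word_val_def A(2) using coset_mult[OF c0(1) A(1)] c0(2) by simp
  moreover have "word_val PG g w = \<one>\<^bsub>PG\<^esub>"
    by (rule D(3)) (use M(1) coset_closed in \<open>auto simp: g_def\<close>)
  ultimately have "?A \<in> Z" using coset_eq_one[OF AH] by simp
  then obtain t where "\<forall>v\<in>V. opr ?A v = vscale t v" using Z_iff[OF AH] by blast
  then have "opr (rep (fst w)) (wfun \<rho> ys z) = vscale t z"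
    using A(3) z by (simp add: opr_GL_mult H_GL A(1) c0(1))
  then show False using nz Bz by (simp add: B_scale2)
qed

end

section \<open>Isometries\<close>

text \<open>\<open>\<sigma>\<close> stands for the companion automorphism of the form: the identity
  for alternating and symmetric forms, the power map with exponent \<open>q\<close> for Hermitian
  ones.\<close>

locale sesqui_space = matrix_space F m +
    hyp_space vscale "embedded_field.emb F \<one>\<^bsub>F\<^esub>" eps "matrix_space.V F m" E E' B k
  for F :: "nat ring" (structure) and m eps E E' B k +
  fixes \<sigma> :: "univ \<Rightarrow> univ" and J a b
  assumes m: "0 < m" and eps_cases: "eps = 1 \<or> eps = - 1"
    and semilinear: "\<And>x y t. x \<in> V \<Longrightarrow> e * t = t \<Longrightarrow> B (vscale t x) y = \<sigma> t * B x y"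
    and hermitian: "\<And>x y. x \<in> V \<Longrightarrow> y \<in> V \<Longrightarrow> B y x = eps * \<sigma> (B x y)"
    and \<sigma>_minus: "\<And>t. e * t = t \<Longrightarrow> \<sigma> (- t) = - \<sigma> t"
    and S: "hsys 0 J a b"
begin

abbreviation unit_sign :: "univ \<Rightarrow> bool" where "unit_sign s \<equiv> s = 1 \<or> s = - 1"

lemma V_linear_sum: "p \<in> V \<Longrightarrow> r \<in> V \<Longrightarrow> y \<in> V \<Longrightarrow> y + vscale s (vscale t r - vscale u p) \<in> V"
  by (intro V_closed)

lemma transv_vlinear:
  assumes "p \<in> V" "r \<in> V"
  shows "vlinear (transv s p r)"
  unfolding vlinear_def
proof (intro conjI allI ballI)
  show "transv s p r (x + y) = transv s p r x + transv s p r y" for x y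
    by (simp add: transv_def B_add2 algebra_simps vs.scale_left_distrib vs.scale_right_distrib
        vs.scale_right_diff_distrib)
  show "transv s p r (vscale t x) = vscale t (transv s p r x)" for t x
    by (simp add: transv_def B_scale2 algebra_simps vs.scale_right_distrib vs.scale_right_diff_distrib)
  show "transv s p r x \<in> V" if "x \<in> V" for x
    unfolding transv_def using V_linear_sum assms that by blast
qed

lemma transv_inverse:
  assumes "B p p = 0" "B r r = 0" "B p r = 0" "B r p = 0"
  shows "transv s p r (transv (- s) p r y) = y"
proof -
  have *: "B p (transv (- s) p r y) = B p y" "B r (transv (- s) p r y) = B r y"
    using assms by (simp_all add: transv_def B_add2 B_scale2 lin_diff[OF lin_B] del: vs.scale_minus_left)
  show ?thesis unfolding transv_def[of s] * by (simp add: transv_def)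
qed

lemma sing_pair_zero:
  assumes "sing p" "sing r" "B p r = 0"
  shows "B p p = 0" "B r r = 0" "B r p = 0" "p \<in> V" "r \<in> V"
  using assms sing_iso sing_V B_refl[of p r] by auto

definition tmat :: "univ \<Rightarrow> (nat \<Rightarrow> univ) \<Rightarrow> (nat \<Rightarrow> univ) \<Rightarrow> nat mat" where
  "tmat s p r = of_opr (transv s p r)"

lemma tmat:
  assumes "sing p" "sing r" "B p r = 0"
  shows "tmat s p r \<in> carrier GLn" "v \<in> V \<Longrightarrow> opr (tmat s p r) v = transv s p r v"
    "v \<in> V \<Longrightarrow> opr (inv\<^bsub>GLn\<^esub> tmat s p r) v = transv (- s) p r v"
proof -
  note z = sing_pair_zero[OF assms]
  note l = transv_vlinear[OF z(4,5)]
  note i = transv_inverse[OF z(1,2) assms(3) z(3)]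
  show GL: "tmat s p r \<in> carrier GLn"
    unfolding tmat_def by (rule of_opr_GL[OF l l[of "- s"]]) (use i[of s] i[of "- s"] in simp_all)
  show o: "opr (tmat s p r) v = transv s p r v" if "v \<in> V" for v
    unfolding tmat_def by (rule opr_of_opr[OF l that])
  show "opr (inv\<^bsub>GLn\<^esub> tmat s p r) v = transv (- s) p r v" if v: "v \<in> V"
  proof -
    have w: "transv (- s) p r v \<in> V" using l[of "- s"] v by (simp add: vlinear_def)
    have "opr (tmat s p r) (transv (- s) p r v) = v" using o[OF w] i[of s] by simp
    then show ?thesis using opr_GL(3)[OF GL w] by simp
  qed
qed

text \<open>The commutator relation $[1 + M, 1 + N] = 1 + M N - N M$ of nilpotent operators, applied to a
  hyperbolic pair orthogonal to \<open>p\<close> and \<open>r\<close>.\<close>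

lemma transv_commutator:
  assumes p: "sing p" and r: "sing r" and pr: "B p r = 0" and s: "unit_sign s" and k: "7 \<le> k"
  shows "\<exists>t w w'. unit_sign t \<and> sing w \<and> sing w' \<and> B p w = 0 \<and> B w' r = 0 \<and>
    (\<forall>v\<in>V. opr (tmat t p w \<otimes>\<^bsub>GLn\<^esub> tmat 1 w' r \<otimes>\<^bsub>GLn\<^esub> inv\<^bsub>GLn\<^esub> tmat t p w \<otimes>\<^bsub>GLn\<^esub> inv\<^bsub>GLn\<^esub> tmat 1 w' r) v
      = transv s p r v)"
proof -
  \<comment> \<open>Two functionals cost at most six pairs, so \<open>7 \<le> k\<close> leaves a
    hyperbolic pair orthogonal to \<open>p\<close> and \<open>r\<close>.\<close>
  have "\<forall>f\<in>set [B p, B r]. lin f" using lin_B by simp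
  from cut[OF S this] obtain J' a' b' where S': "hsys (0 + 3 * length [B p, B r]) J' a' b'"
    and zero: "\<forall>f\<in>set [B p, B r]. \<forall>y\<in>hspan J' a' b'. f y = 0"
    by (elim exE conjE)
  have "J' \<noteq> {}" using S' k by (auto simp: hsys_def)
  then obtain j where j: "j \<in> J'" by blast
  define w w' where "w = a' j" and "w' = b' j"
  have wE: "w \<in> E" "w' \<in> E'" "B w w' = e" "B w' w = eps * e"
    using S' j by (auto simp: hsys_def w_def w'_def)
  have sw: "sing w" "sing w'" using sing_E sing_E' wE by auto
  have wS: "w \<in> hspan J' a' b'" "w' \<in> hspan J' a' b'" using j by (auto simp: w_def w'_def intro: span_base)
  have o: "B p w = 0" "B p w' = 0" "B r w = 0" "B r w' = 0" using zero wS by simp_all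
  note V4 = sing_V[OF p] sing_V[OF r] sing_V[OF sw(1)] sing_V[OF sw(2)]
  have o': "B w p = 0" "B w' p = 0" "B w r = 0" "B w' r = 0" "B r p = 0"
    using o pr B_refl V4 by blast+
  have i: "B p p = 0" "B r r = 0" "B w w = 0" "B w' w' = 0" using sing_iso p r sw by auto
  \<comment> \<open>The commutator is \<open>1 + t (M N - N M)\<close>, and \<open>M N - N M\<close>
    is \<open>- eps\<close> times the nilpotent part of the transvection along \<open>p\<close> and
    \<open>r\<close>; this \<open>t\<close> makes up for the factor.\<close>
  define t where "t = - eps * s"
  have t: "unit_sign t" using s eps_cases by (auto simp: t_def)
  have tt: "t * eps = - s" using s eps_cases by (auto simp: t_def)
  define M where "M z = vscale (B p z) w - vscale (eps * B w z) p" for z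
  define N where "N z = vscale (B w' z) r - vscale (eps * B r z) w'" for z
  have add: "M (x + y) = M x + M y" "N (x + y) = N x + N y" for x y
    by (simp_all add: M_def N_def B_add2 algebra_simps vs.scale_left_distrib)
  have scale: "M (vscale c x) = vscale c (M x)" "N (vscale c x) = vscale c (N x)" for c x
    by (simp_all add: M_def N_def B_scale2 vs.scale_right_diff_distrib mult_ac)
  have diff: "M (x - y) = M x - M y" "N (x - y) = N x - N y" for x y
    using add(1)[of "x - y" y] add(2)[of "x - y" y] by simp_all
  have ep: "vscale (eps * e) p = vscale eps p" "vscale (eps * e) r = vscale eps r"
    using V_e[OF V4(1)] V_e[OF V4(2)] by (metis vs.scale_scale)+
  have base: "M p = 0" "M w = 0" "M r = 0" "M w' = vscale (- eps) p" "N p = 0" "N r = 0" "N w' = 0" "N w = vscale eps r"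
    by (simp_all add: M_def N_def o o' pr i wE(3,4) ep)
  have MN: "M (N z) = vscale (B r z) p" for z
  proof -
    have "M (N z) = vscale (eps * B r z * eps) p" by (simp add: N_def[of z] diff scale base)
    also have "eps * B r z * eps = B r z" using eps by (metis mult.assoc mult.commute mult_1)
    finally show ?thesis .
  qed
  have NM: "N (M z) = vscale (eps * B p z) r" for z
    by (simp add: M_def[of z] diff scale base mult.commute)
  have MM: "M (M z) = 0" for z by (simp add: M_def[of z] diff scale base)
  have NN: "N (N z) = 0" for z by (simp add: N_def[of z] diff scale base)
  have T1: "transv u p w z = z + vscale u (M z)" and T2: "transv u w' r z = z + vscale u (N z)" for u z
    by (simp_all add: transv_def M_def N_def)
  have comm: "transv t p w (transv 1 w' r (transv (- t) p w (transv (- 1) w' r z))) = transv s p r z" for z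
  proof -
    have "transv t p w (transv 1 w' r (transv (- t) p w (transv (- 1) w' r z))) =
      z + vscale t (M (N z)) - vscale t (N (M z))"
      unfolding T1 T2
      by (simp add: add diff scale MM NN MN NM base algebra_simps del: vs.scale_minus_left)
         (simp add: add diff scale MM NN MN NM base algebra_simps)
    also have "\<dots> = transv s p r z"
      using tt s eps_cases by (auto simp: MN NM transv_def t_def algebra_simps)
    finally show ?thesis .
  qed
  let ?A = "tmat t p w" and ?C = "tmat 1 w' r"
  note A = tmat[OF p sw(1) o(1)] and C = tmat[OF sw(2) r o'(4)]
  have lV: "v \<in> V \<Longrightarrow> transv u p w v \<in> V" "v \<in> V \<Longrightarrow> transv u w' r v \<in> V" for u v
    using transv_vlinear V4 by (auto simp: vlinear_def)
  have "opr (?A \<otimes>\<^bsub>GLn\<^esub> ?C \<otimes>\<^bsub>GLn\<^esub> inv\<^bsub>GLn\<^esub> ?A \<otimes>\<^bsub>GLn\<^esub> inv\<^bsub>GLn\<^esub> ?C) v = transv s p r v" if v: "v \<in> V" for v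
  proof -
    have "opr (?A \<otimes>\<^bsub>GLn\<^esub> ?C \<otimes>\<^bsub>GLn\<^esub> inv\<^bsub>GLn\<^esub> ?A \<otimes>\<^bsub>GLn\<^esub> inv\<^bsub>GLn\<^esub> ?C) v =
      opr ?A (opr ?C (opr (inv\<^bsub>GLn\<^esub> ?A) (opr (inv\<^bsub>GLn\<^esub> ?C) v)))"
      using A(1) C(1) by (simp add: opr_GL_mult)
    also have "\<dots> = transv t p w (transv 1 w' r (transv (- t) p w (transv (- 1) w' r v)))"
      using v lV by (simp add: A C)
    finally show ?thesis by (simp only: comm)
  qed
  then show ?thesis using t sw o(1) o'(4) by blast
qed

text \<open>It suffices that the linear group contains all commutators of some set of matrices which contains
  the transvections.\<close>

theorem commutator_identity_length:
  assumes k: "7 \<le> k" and H: "subgroup H GLn"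
    and I: "\<And>t p r. unit_sign t \<Longrightarrow> sing p \<Longrightarrow> sing r \<Longrightarrow> B p r = 0 \<Longrightarrow> tmat t p r \<in> I"
    and comm: "\<And>A C. A \<in> I \<Longrightarrow> C \<in> I \<Longrightarrow> A \<otimes>\<^bsub>GLn\<^esub> C \<otimes>\<^bsub>GLn\<^esub> inv\<^bsub>GLn\<^esub> A \<otimes>\<^bsub>GLn\<^esub> inv\<^bsub>GLn\<^esub> C \<in> H"
    and w: "mixed_identity (projective F m H) r w" "nonsingular r w"
  shows "k < 14 ^ word_length w * (12 * (2 * word_length w + 2) ^ 3 + 1)"
proof -
  interpret C: classical_space F m eps E E' B k H J a b
  proof (intro_locales, rule classical_space_axioms.intro[OF m H S])
    show "\<exists>A\<in>H. \<forall>v\<in>V. opr A v = transv s p r v"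
      if pr: "sing p" "sing r" "B p r = 0" and s: "unit_sign s" for p r s
    proof -
      obtain t w w' where t: "unit_sign t" "sing w" "sing w'" "B p w = 0" "B w' r = 0"
        and c: "\<forall>v\<in>V. opr (tmat t p w \<otimes>\<^bsub>GLn\<^esub> tmat 1 w' r \<otimes>\<^bsub>GLn\<^esub> inv\<^bsub>GLn\<^esub> tmat t p w \<otimes>\<^bsub>GLn\<^esub> inv\<^bsub>GLn\<^esub> tmat 1 w' r) v
          = transv s p r v"
        using transv_commutator[OF pr s k] by (elim exE conjE)
      have "tmat t p w \<in> I" "tmat 1 w' r \<in> I" using I t pr by auto
      then show ?thesis using comm c by blast
    qed
  qed
  show ?thesis using C.projective_identity_length w by (simp add: C.PG_def)
qed

text \<open>The two mixed terms cancel by the symmetry in \<open>hermitian\<close>, and the term of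
  second order vanishes because \<open>p\<close> and \<open>r\<close> span a totally isotropic
  space.\<close>

lemma transv_preserves_B:
  assumes pr: "sing p" "sing r" "B p r = 0" and s: "unit_sign s" and xy: "x \<in> V" "y \<in> V"
  shows "B (transv s p r x) (transv s p r y) = B x y"
proof -
  note z = sing_pair_zero[OF pr]
  define N where "N y = vscale (B p y) r - vscale (eps * B r y) p" for y
  have T: "transv s p r y = y + vscale s (N y)" for y by (simp add: transv_def N_def)
  have NV: "N y \<in> V" "vscale s (N y) \<in> V" for y using z V_closed by (simp_all add: N_def)
  have e1: "e * (s * B p x) = s * B p x" "e * (s * (eps * B r x)) = s * (eps * B r x)"
    using e_field[OF lin_B xy(1)] by (simp_all add: mult.left_commute)
  have \<sigma>s: "\<sigma> (s * B p x) = s * \<sigma> (B p x)" "\<sigma> (s * (eps * B r x)) = s * (eps * \<sigma> (B r x))"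
    using s eps_cases \<sigma>_minus e_field[OF lin_B xy(1)] by auto
  have Nx: "B (vscale s (N x)) u = s * \<sigma> (B p x) * B r u - s * (eps * \<sigma> (B r x)) * B p u" for u
  proof -
    have eq: "vscale s (N x) = vscale (s * B p x) r + vscale (- (s * (eps * B r x))) p"
      by (simp add: N_def vs.scale_right_diff_distrib)
    have "e * - (s * (eps * B r x)) = - (s * (eps * B r x))" using e1(2) by simp
    then show ?thesis
      unfolding eq using z e1 V_closed
      by (simp add: B_add1 semilinear \<sigma>s \<sigma>_minus del: vs.scale_minus_left)
  qed
  have "B x (vscale s (N y)) = s * (B p y * B x r - eps * B r y * B x p)"
    by (simp add: N_def B_scale2 lin_diff[OF lin_B])
  also have "\<dots> = s * (B p y * (eps * \<sigma> (B r x)) - eps * B r y * (eps * \<sigma> (B p x)))"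
    using hermitian[OF z(5) xy(1)] hermitian[OF z(4) xy(1)] by simp
  also have "eps * B r y * (eps * \<sigma> (B p x)) = B r y * \<sigma> (B p x)"
    using eps by (metis mult.assoc mult.left_commute mult_1)
  finally have xN: "B x (vscale s (N y)) = s * (B p y * (eps * \<sigma> (B r x)) - B r y * \<sigma> (B p x))" .
  have "B r (N y) = 0" "B p (N y) = 0" using z pr by (simp_all add: N_def B_scale2 lin_diff[OF lin_B])
  then have NNz: "B (vscale s (N x)) (vscale s (N y)) = 0" by (simp add: Nx B_scale2)
  have "B (transv s p r x) (transv s p r y) = B x y + B x (vscale s (N y)) + B (vscale s (N x)) y"
    unfolding T using NNz by (simp add: B_add1[OF xy(1) NV(2)] B_add2)
  then show ?thesis unfolding xN Nx by (simp add: algebra_simps)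
qed

end

section \<open>Isometry groups and the determinant\<close>

context matrix_space
begin

lemma vemb_inj: "x \<in> vecs F m \<Longrightarrow> y \<in> vecs F m \<Longrightarrow> vemb x = vemb y \<Longrightarrow> x = y"
  by (intro eq_vecI) (auto simp: vecs_def vemb_def fun_eq_iff emb_inj split: if_splits)

lemma mat_vec_closed: "A \<in> carrier Mn \<Longrightarrow> x \<in> vecs F m \<Longrightarrow> mat_vec F m A x \<in> vecs F m"
  by (auto simp: vecs_def mat_vec_def carrier_Mn intro!: finsum_closed)

lemma mat_vec_mult:
  assumes "A \<in> carrier GLn" "C \<in> carrier GLn" "x \<in> vecs F m"
  shows "mat_vec F m (A \<otimes>\<^bsub>GLn\<^esub> C) x = mat_vec F m A (mat_vec F m C x)"
proof (rule vemb_inj)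
  note M = GL_simps(1)[OF assms(1)] GL_simps(1)[OF assms(2)] GL_simps(1)[OF GL.m_closed[OF assms(1,2)]]
  show "mat_vec F m (A \<otimes>\<^bsub>GLn\<^esub> C) x \<in> vecs F m" "mat_vec F m A (mat_vec F m C x) \<in> vecs F m"
    using M assms(3) mat_vec_closed by blast+
  show "vemb (mat_vec F m (A \<otimes>\<^bsub>GLn\<^esub> C) x) = vemb (mat_vec F m A (mat_vec F m C x))"
    using opr_vemb[OF M(3) assms(3)] opr_vemb[OF M(2) assms(3)] opr_GL_mult[OF assms(1,2)]
      opr_vemb[OF M(1) mat_vec_closed[OF M(2) assms(3)]] by simp
qed

lemma mat_vec_one: "x \<in> vecs F m \<Longrightarrow> mat_vec F m \<one>\<^bsub>GLn\<^esub> x = x"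
proof (rule vemb_inj)
  assume x: "x \<in> vecs F m"
  have M: "\<one>\<^bsub>GLn\<^esub> \<in> carrier Mn" by (simp add: GL_simps one_Mn)
  show "mat_vec F m \<one>\<^bsub>GLn\<^esub> x \<in> vecs F m" "x \<in> vecs F m" using mat_vec_closed[OF M x] x by auto
  show "vemb (mat_vec F m \<one>\<^bsub>GLn\<^esub> x) = vemb x"
    using opr_vemb[OF M x] opr_one[OF vemb_V[OF x]] by (simp add: GL_simps)
qed

lemma isometries_subgroup: "subgroup (isometries F m b) GLn"
proof (rule GL.subgroupI)
  show "isometries F m b \<subseteq> carrier GLn" by (auto simp: isometries_def)
  have "\<one>\<^bsub>GLn\<^esub> \<in> isometries F m b" by (simp add: isometries_def mat_vec_one)
  then show "isometries F m b \<noteq> {}" by blast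
next
  fix A assume A: "A \<in> isometries F m b"
  then have GL: "A \<in> carrier GLn" "inv\<^bsub>GLn\<^esub> A \<in> carrier GLn" by (auto simp: isometries_def)
  have "b (mat_vec F m (inv\<^bsub>GLn\<^esub> A) u) (mat_vec F m (inv\<^bsub>GLn\<^esub> A) v) = b u v"
    if uv: "u \<in> vecs F m" "v \<in> vecs F m" for u v
  proof -
    have c: "mat_vec F m (inv\<^bsub>GLn\<^esub> A) u \<in> vecs F m" "mat_vec F m (inv\<^bsub>GLn\<^esub> A) v \<in> vecs F m"
      using mat_vec_closed[OF GL_simps(1)[OF GL(2)]] uv by auto
    have "mat_vec F m A (mat_vec F m (inv\<^bsub>GLn\<^esub> A) u) = u" if "u \<in> vecs F m" for u
      using mat_vec_mult[OF GL that] mat_vec_one[OF that] GL by simp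
    from this[OF uv(1)] this[OF uv(2)] show ?thesis
      using A c unfolding isometries_def by (metis (mono_tags, lifting) mem_Collect_eq)
  qed
  then show "inv\<^bsub>GLn\<^esub> A \<in> isometries F m b" using GL by (simp add: isometries_def)
next
  fix A C assume "A \<in> isometries F m b" "C \<in> isometries F m b"
  then show "A \<otimes>\<^bsub>GLn\<^esub> C \<in> isometries F m b"
    using mat_vec_closed[OF GL_simps(1)] by (auto simp: isometries_def mat_vec_mult)
qed

text \<open>Multiplicativity of the determinant is inherited from the type-class determinant over \<^typ>\<open>univ\<close>.\<close>

definition emat :: "nat mat \<Rightarrow> univ mat" where
  "emat A = map_mat emb A"

lemma finprod_entries:
  assumes "A \<in> carrier Mn" "p permutes {..<m}"
  shows "(\<Otimes>i\<in>{..<m}. A $$ (i, p i)) \<in> carrier F"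
    "emb (\<Otimes>i\<in>{..<m}. A $$ (i, p i)) = e * (\<Prod>i<m. emb (A $$ (i, p i)))"
proof -
  have c: "A $$ (i, p i) \<in> carrier F" if "i < m" for i
    using assms that permutes_in_image[OF assms(2), of i] by (auto simp: carrier_Mn)
  then show "(\<Otimes>i\<in>{..<m}. A $$ (i, p i)) \<in> carrier F" by (intro finprod_closed) auto
  show "emb (\<Otimes>i\<in>{..<m}. A $$ (i, p i)) = e * (\<Prod>i<m. emb (A $$ (i, p i)))"
    by (rule emb_finprod) (use c in auto)
qed

lemma ring_det_closed: "A \<in> carrier Mn \<Longrightarrow> ring_det F m A \<in> carrier F"
  unfolding ring_det_def Let_def using finprod_entries(1) by (intro finsum_closed) auto

lemma emb_ring_det:
  assumes A: "A \<in> carrier Mn"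
  shows "emb (ring_det F m A) = e * det (emat A)"
proof -
  have "emb (ring_det F m A) = (\<Sum>p | p permutes {..<m}. emb (let t = (\<Otimes>i\<in>{..<m}. A $$ (i, p i)) in
    if evenperm p then t else \<ominus> t))"
    unfolding ring_det_def
    by (rule emb_finsum) (use finprod_entries(1)[OF A] in \<open>auto simp: Let_def finite_permutations\<close>)
  also have "\<dots> = (\<Sum>p | p permutes {..<m}. e * (signof p * (\<Prod>i<m. emb (A $$ (i, p i)))))"
    by (rule sum.cong) (auto simp: Let_def finprod_entries[OF A] emb_minus sign_def)
  also have "\<dots> = e * (\<Sum>p | p permutes {..<m}. signof p * (\<Prod>i<m. emb (A $$ (i, p i))))"
    by (simp add: sum_distrib_left)
  also have "(\<Sum>p | p permutes {..<m}. signof p * (\<Prod>i<m. emb (A $$ (i, p i)))) = det (emat A)"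
  proof -
    have "emat A \<in> carrier_mat m m" using A by (simp add: emat_def carrier_Mn)
    moreover have "(\<Prod>i<m. emb (A $$ (i, p i))) = (\<Prod>i = 0..<m. emat A $$ (i, p i))"
      if "p permutes {..<m}" for p
      unfolding lessThan_atLeast0
      by (rule prod.cong) (use A permutes_in_image[OF that] in \<open>auto simp: emat_def carrier_Mn\<close>)
    ultimately show ?thesis by (simp add: det_def' lessThan_atLeast0)
  qed
  finally show ?thesis .
qed

lemma ring_det_mult:
  assumes A: "A \<in> carrier Mn" and C: "C \<in> carrier Mn"
  shows "ring_det F m (A \<otimes>\<^bsub>Mn\<^esub> C) = ring_det F m A \<otimes> ring_det F m C"
proof -
  have c: "emat A \<in> carrier_mat m m" "emat C \<in> carrier_mat m m"
    using A C by (simp_all add: emat_def carrier_Mn)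
  have "emat (A \<otimes>\<^bsub>Mn\<^esub> C) = emat A * emat C"
  proof (rule eq_matI)
    fix i j assume "i < dim_row (emat A * emat C)" "j < dim_col (emat A * emat C)"
    then have ij: "i < m" "j < m" using c by auto
    have "emb (\<Oplus>k\<in>{..<m}. A $$ (i, k) \<otimes> C $$ (k, j)) = (\<Sum>k<m. emb (A $$ (i, k)) * emb (C $$ (k, j)))"
      by (rule emb_sum_mult) (use A C ij in \<open>auto simp: carrier_Mn\<close>)
    moreover have "(emat A * emat C) $$ (i, j) = (\<Sum>k<m. emb (A $$ (i, k)) * emb (C $$ (k, j)))"
      using ij A C by (auto simp: emat_def carrier_Mn scalar_prod_def lessThan_atLeast0 intro!: sum.cong)
    ultimately show "emat (A \<otimes>\<^bsub>Mn\<^esub> C) $$ (i, j) = (emat A * emat C) $$ (i, j)"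
      using ij by (simp add: emat_def mat_monoid_def)
  qed (use A C in \<open>auto simp: emat_def mat_monoid_def\<close>)
  then have "emb (ring_det F m (A \<otimes>\<^bsub>Mn\<^esub> C)) = e * (det (emat A) * det (emat C))"
    by (simp add: emb_ring_det[OF mult_Mn_closed[OF A C]] det_mult[OF c])
  also have "\<dots> = (e * e) * (det (emat A) * det (emat C))" by simp
  also have "\<dots> = (e * det (emat A)) * (e * det (emat C))" by (simp only: mult_ac)
  also have "\<dots> = emb (ring_det F m A \<otimes> ring_det F m C)"
    by (simp add: emb_ring_det[OF A, symmetric] emb_ring_det[OF C, symmetric] emb_mult ring_det_closed A C)
  finally show ?thesis using A C by (simp add: emb_inj ring_det_closed mult_Mn_closed)
qed

lemma ring_det_one: "ring_det F m \<one>\<^bsub>Mn\<^esub> = \<one>"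
proof -
  have "emat \<one>\<^bsub>Mn\<^esub> = e \<cdot>\<^sub>m 1\<^sub>m m"
    by (rule eq_matI) (auto simp: emat_def mat_monoid_def)
  then have "emb (ring_det F m \<one>\<^bsub>Mn\<^esub>) = e * e ^ m" by (simp add: emb_ring_det[OF one_Mn])
  also have "e * e ^ m = e" by (induction m) simp_all
  finally show ?thesis by (simp add: emb_inj ring_det_closed one_Mn)
qed

lemma ring_det_inv:
  assumes A: "A \<in> carrier GLn"
  shows "ring_det F m A \<otimes> ring_det F m (inv\<^bsub>GLn\<^esub> A) = \<one>"
proof -
  have "ring_det F m (A \<otimes>\<^bsub>GLn\<^esub> inv\<^bsub>GLn\<^esub> A) = ring_det F m A \<otimes> ring_det F m (inv\<^bsub>GLn\<^esub> A)"
    using A by (simp add: GL_simps ring_det_mult)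
  then show ?thesis using A by (simp add: GL_simps(3) ring_det_one)
qed

lemma SL_subgroup: "subgroup (SL F m) GLn"
proof (rule GL.subgroupI)
  show "SL F m \<subseteq> carrier GLn" by (auto simp: SL_def)
  have "\<one>\<^bsub>GLn\<^esub> \<in> SL F m" using GL.one_closed by (simp add: SL_def GL_simps(3) ring_det_one)
  then show "SL F m \<noteq> {}" by blast
next
  fix A assume A: "A \<in> SL F m"
  then have GL: "A \<in> carrier GLn" "ring_det F m A = \<one>" by (auto simp: SL_def)
  then have "ring_det F m (inv\<^bsub>GLn\<^esub> A) = \<one>"
    using ring_det_inv[OF GL(1)] ring_det_closed[OF GL_simps(1)[of "inv\<^bsub>GLn\<^esub> A"]] by simp
  then show "inv\<^bsub>GLn\<^esub> A \<in> SL F m" using GL by (simp add: SL_def)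
next
  fix A C assume "A \<in> SL F m" "C \<in> SL F m"
  then show "A \<otimes>\<^bsub>GLn\<^esub> C \<in> SL F m"
    using GL.m_closed[of A C] by (auto simp: SL_def GL_simps(1,2) ring_det_mult)
qed

lemma commutator_SL:
  assumes A: "A \<in> carrier GLn" and C: "C \<in> carrier GLn"
  shows "A \<otimes>\<^bsub>GLn\<^esub> C \<otimes>\<^bsub>GLn\<^esub> inv\<^bsub>GLn\<^esub> A \<otimes>\<^bsub>GLn\<^esub> inv\<^bsub>GLn\<^esub> C \<in> SL F m"
proof -
  let ?d = "ring_det F m"
  have cl: "?d A \<in> carrier F" "?d C \<in> carrier F" "?d (inv\<^bsub>GLn\<^esub> A) \<in> carrier F" "?d (inv\<^bsub>GLn\<^esub> C) \<in> carrier F"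
    using A C by (auto intro!: ring_det_closed GL_simps(1))
  have mult: "?d (X \<otimes>\<^bsub>GLn\<^esub> Y) = ?d X \<otimes> ?d Y" if "X \<in> carrier GLn" "Y \<in> carrier GLn" for X Y
    using that by (simp add: GL_simps ring_det_mult)
  have "?d (A \<otimes>\<^bsub>GLn\<^esub> C \<otimes>\<^bsub>GLn\<^esub> inv\<^bsub>GLn\<^esub> A \<otimes>\<^bsub>GLn\<^esub> inv\<^bsub>GLn\<^esub> C) =
    ?d A \<otimes> ?d C \<otimes> ?d (inv\<^bsub>GLn\<^esub> A) \<otimes> ?d (inv\<^bsub>GLn\<^esub> C)"
    using A C by (simp add: mult)
  also have "\<dots> = (?d A \<otimes> ?d (inv\<^bsub>GLn\<^esub> A)) \<otimes> (?d C \<otimes> ?d (inv\<^bsub>GLn\<^esub> C))"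
    using cl by (simp add: m_ac)
  also have "\<dots> = \<one>" using ring_det_inv[OF A] ring_det_inv[OF C] by simp
  finally show ?thesis using A C by (simp add: SL_def)
qed

end

section \<open>Linear, symplectic and orthogonal groups\<close>

context sesqui_space
begin

lemma tmat_isometries:
  assumes t: "unit_sign t" and pr: "sing p" "sing r" "B p r = 0"
    and form: "\<And>x y. x \<in> vecs F m \<Longrightarrow> y \<in> vecs F m \<Longrightarrow> f x y \<in> carrier F \<and> emb (f x y) = B (vemb x) (vemb y)"
  shows "tmat t p r \<in> isometries F m f"
proof -
  let ?A = "tmat t p r"
  note A = tmat[OF pr, where s = t]
  have "f (mat_vec F m ?A u) (mat_vec F m ?A v) = f u v" if uv: "u \<in> vecs F m" "v \<in> vecs F m" for u v
  proof -
    have c: "mat_vec F m ?A u \<in> vecs F m" "mat_vec F m ?A v \<in> vecs F m"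
      using mat_vec_closed[OF GL_simps(1)[OF A(1)]] uv by auto
    have o: "vemb (mat_vec F m ?A u) = transv t p r (vemb u)" if "u \<in> vecs F m" for u
      using opr_vemb[OF GL_simps(1)[OF A(1)] that] A(2)[OF vemb_V[OF that]] by simp
    have "emb (f (mat_vec F m ?A u) (mat_vec F m ?A v)) = emb (f u v)"
      using form[OF c] form[OF uv] o[OF uv(1)] o[OF uv(2)]
        transv_preserves_B[OF pr t vemb_V[OF uv(1)] vemb_V[OF uv(2)]] by simp
    then show ?thesis
      by (rule emb_inj[THEN iffD1, OF conjunct1[OF form[OF c]] conjunct1[OF form[OF uv]]])
  qed
  then show ?thesis using A(1) unfolding isometries_def by blast
qed

end

text \<open>For the special linear groups, the transvections preserve an auxiliary alternating form; the
  constants need not respect it.\<close>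

locale coord_space = matrix_space F m for F :: "nat ring" (structure) and m +
  fixes eps :: univ and k :: nat
  assumes eps1: "eps = 1 \<or> eps = - 1" and m_pos: "0 < m" and km: "2 * k \<le> m" "m \<le> 2 * k + 2"
begin

text \<open>For \<open>eps = - 1\<close> the standard alternating form on the first
  \<open>2 * k\<close> coordinates, for \<open>eps = 1\<close> the polar form of the hyperbolic part
  of a quadratic form. The remaining coordinates, at most two, form its radical.\<close>

definition hform :: "(nat \<Rightarrow> univ) \<Rightarrow> (nat \<Rightarrow> univ) \<Rightarrow> univ" where
  "hform x z = (\<Sum>i<k. x (2 * i) * z (2 * i + 1) + eps * (x (2 * i + 1) * z (2 * i)))"

definition E0 where "E0 = {v \<in> V. \<forall>i. odd i \<or> 2 * k \<le> i \<longrightarrow> v i = 0}"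
definition E1 where "E1 = {v \<in> V. \<forall>i. even i \<or> 2 * k \<le> i \<longrightarrow> v i = 0}"

lemma hform_unitv:
  assumes "i < k" "z \<in> V"
  shows "hform (unitv (2 * i)) z = z (2 * i + 1)" "hform (unitv (2 * i + 1)) z = eps * z (2 * i)"
proof -
  have p: "2 * j \<noteq> Suc (2 * i)" "Suc (2 * j) \<noteq> 2 * i" for i j :: nat by presburger+
  have z: "e * z j = z j" for j using assms(2) by (simp add: V_def)
  have "hform (unitv (2 * i)) z = (\<Sum>j<k. if j = i then z (2 * i + 1) else 0)"
    unfolding hform_def by (rule sum.cong) (auto simp: unitv_def p z)
  then show "hform (unitv (2 * i)) z = z (2 * i + 1)" using assms(1) by simp
  have "hform (unitv (2 * i + 1)) z = (\<Sum>j<k. if j = i then eps * z (2 * i) else 0)"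
    unfolding hform_def by (rule sum.cong) (auto simp: unitv_def p z)
  then show "hform (unitv (2 * i + 1)) z = eps * z (2 * i)" using assms(1) by simp
qed

lemma hform_swap: "hform y x = eps * hform x y"
proof -
  have "eps * eps = 1" using eps1 by auto
  then have *: "eps * (a + eps * b) = b + eps * a" for a b :: univ
    by (simp add: distrib_left mult.assoc[symmetric])
  show ?thesis
    unfolding hform_def sum_distrib_left * by (intro sum.cong refl) (simp add: mult.commute)
qed

sublocale hyp_space vscale e eps V E0 E1 hform k
proof
  show "e \<noteq> 0" by (rule e_nz)
  show "\<exists>s. s * t = e" if "e * t = t" "t \<noteq> 0" for t using e_inverse that .
  show "eps * eps = 1" using eps1 by auto
  show "vs.subspace V" by (rule V_subspace)
  show "vscale e x = x" if "x \<in> V" for x using V_e that .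
  show "vs.subspace E0" "vs.subspace E1"
    using V_subspace by (auto simp: E0_def E1_def vs.subspace_def vscale_def)
  show "E0 \<subseteq> V" "E1 \<subseteq> V" by (auto simp: E0_def E1_def)
  show "hform x (y + z) = hform x y + hform x z" for x y z
    by (simp add: hform_def algebra_simps sum.distrib)
  show "hform x (vscale a y) = a * hform x y" for x a y
    by (simp add: hform_def vscale_def algebra_simps sum_distrib_left)
  show "hform (x + y) z = hform x z + hform y z" for x y z
    by (simp add: hform_def algebra_simps sum.distrib)
  show "hform y x = 0" if "hform x y = 0" for x y using hform_swap[of x y] hform_swap[of y x] that by simp
  show "hform x y = 0" if "x \<in> E0" "y \<in> E0" for x y using that by (auto simp: hform_def E0_def intro!: sum.neutral)
  show "hform x y = 0" if "x \<in> E1" "y \<in> E1" for x y using that by (auto simp: hform_def E1_def intro!: sum.neutral)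
qed

lemma hsys0: "hsys 0 {..<k} (\<lambda>j. unitv (2 * j)) (\<lambda>j. unitv (2 * j + 1))"
proof -
  let ?a = "\<lambda>j. unitv (2 * j)" and ?b = "\<lambda>j. unitv (2 * j + 1)"
  have uV: "unitv i \<in> V" if "i < 2 * k" for i using unitv_V[of i] that km(1) by simp
  have aE: "?a ` {..<k} \<subseteq> E0" "?b ` {..<k} \<subseteq> E1" using uV by (auto simp: E0_def E1_def unitv_def)
  have dual: "hform (?a i) (?b j) = (if i = j then e else 0) \<and> hform (?b i) (?a j) = (if i = j then eps * e else 0)"
    if "i \<in> {..<k}" "j \<in> {..<k}" for i j
    using that hform_unitv[of i "?b j"] hform_unitv[of i "?a j"] uV by (auto simp: unitv_def)
  \<comment> \<open>The coordinates outside the form, at most two, are the control data of the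
    initial system; they account for the \<open>+ 2\<close> in \<open>hsys\<close>.\<close>
  define gs where "gs = map (\<lambda>i (v::nat \<Rightarrow> univ). v i) [2 * k..<m]"
  define ws where "ws = map unitv [2 * k..<m]"
  have gs: "length gs \<le> 2 * 0 + 2" "\<forall>g\<in>set gs. lin g" using km(2) by (auto simp: gs_def lin_def vscale_def)
  have zero: "\<forall>z\<in>V. (\<forall>j\<in>{..<k}. hform (?a j) z = 0 \<and> hform (?b j) z = 0) \<longrightarrow> (\<forall>g\<in>set gs. g z = 0) \<longrightarrow> z = 0"
  proof (intro ballI impI)
    fix z assume z: "z \<in> V" and h: "\<forall>j\<in>{..<k}. hform (?a j) z = 0 \<and> hform (?b j) z = 0"
      and g: "\<forall>g\<in>set gs. g z = 0"
    have "z i = 0" for i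
    proof -
      consider "i < 2 * k" "even i" | "i < 2 * k" "odd i" | "2 * k \<le> i" "i < m" | "m \<le> i" by linarith
      then show ?thesis
      proof cases
        case 1
        then obtain j where "i = 2 * j" "j < k" by (auto elim: evenE)
        then show ?thesis using h hform_unitv(2)[of j z] z eps1 by auto
      next
        case 2
        then obtain j where "i = 2 * j + 1" "j < k" by (auto elim: oddE)
        then show ?thesis using h hform_unitv(1)[of j z] z by auto
      next
        case 3
        then show ?thesis using g by (auto simp: gs_def)
      next
        case 4
        then show ?thesis using z by (auto simp: V_def)
      qed
    qed
    then show "z = 0" by auto
  qed
  have ws: "length ws \<le> 2 * 0 + 2" "set ws \<subseteq> V" using km(2) by (auto simp: ws_def unitv_V)
  let ?W = "vs.span (?a ` {..<k} \<union> ?b ` {..<k} \<union> set ws)"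
  have uW: "unitv i \<in> ?W" if "i < m" for i
  proof (rule vs.span_base)
    consider "i < 2 * k" "even i" | "i < 2 * k" "odd i" | "2 * k \<le> i" by linarith
    then show "unitv i \<in> ?a ` {..<k} \<union> ?b ` {..<k} \<union> set ws"
    proof cases
      case 1
      then obtain j where "i = 2 * j" "j < k" by (auto elim: evenE)
      then show ?thesis by auto
    next
      case 2
      then obtain j where "i = 2 * j + 1" "j < k" by (auto elim: oddE)
      then show ?thesis by auto
    next
      case 3
      then show ?thesis using that by (auto simp: ws_def)
    qed
  qed
  have "V \<subseteq> ?W"
  proof
    fix v assume v: "v \<in> V"
    have "(\<Sum>i<m. vscale (v i) (unitv i)) \<in> ?W" by (intro vs.span_sum vs.span_scale uW) simp
    then show "v \<in> ?W" using V_expand[OF v] by simp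
  qed
  then show ?thesis
    unfolding hsys_def
    using aE dual zero gs ws by (intro conjI exI[of _ gs] exI[of _ ws]) auto
qed

sublocale sesqui_space F m eps E0 E1 hform k "\<lambda>t. t" "{..<k}" "\<lambda>j. unitv (2 * j)" "\<lambda>j. unitv (2 * j + 1)"
proof (intro_locales, rule sesqui_space_axioms.intro[OF m_pos eps1])
  show "hform (vscale t x) y = t * hform x y" for t x y
    by (simp add: hform_def vscale_def algebra_simps sum_distrib_left)
  show "hform y x = eps * hform x y" for x y by (rule hform_swap)
qed (simp_all add: hsys0[simplified])

text \<open>Commutators have determinant one, so all invertible matrices may enter them, and the
  form can be chosen freely for the sake of its transvections.\<close>

theorem linear_identity_length:
  assumes "7 \<le> k" "mixed_identity (PSL F m) r w" "nonsingular r w"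
  shows "k < 14 ^ word_length w * (12 * (2 * word_length w + 2) ^ 3 + 1)"
proof (rule commutator_identity_length[OF assms(1) SL_subgroup, where I = "carrier GLn"])
  show "tmat t p r \<in> carrier GLn" if "sing p" "sing r" "hform p r = 0" for t p r
    using tmat(1) that .
  show "mixed_identity (projective F m (SL F m)) r w" using assms(2) by (simp add: PSL_def)
qed (use commutator_SL assms(3) in auto)

theorem isometry_identity_length:
  assumes k: "7 \<le> k"
    and form: "\<And>x y. x \<in> vecs F m \<Longrightarrow> y \<in> vecs F m \<Longrightarrow> f x y \<in> carrier F \<and> emb (f x y) = hform (vemb x) (vemb y)"
    and w: "mixed_identity (projective F m (isometries F m f)) r w" "nonsingular r w"
  shows "k < 14 ^ word_length w * (12 * (2 * word_length w + 2) ^ 3 + 1)"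
proof (rule commutator_identity_length[OF k isometries_subgroup _ _ w, where I = "isometries F m f"])
  interpret I: subgroup "isometries F m f" GLn by (rule isometries_subgroup)
  show "A \<otimes>\<^bsub>GLn\<^esub> C \<otimes>\<^bsub>GLn\<^esub> inv\<^bsub>GLn\<^esub> A \<otimes>\<^bsub>GLn\<^esub> inv\<^bsub>GLn\<^esub> C \<in> isometries F m f"
    if "A \<in> isometries F m f" "C \<in> isometries F m f" for A C
    using that by simp
  show "tmat t p r \<in> isometries F m f"
    if "unit_sign t" "sing p" "sing r" "hform p r = 0" for t p r
    by (rule tmat_isometries[OF that form])
qed

text \<open>The quadratic form itself is followed, not its polar form, so characteristic 2 is
  included. \<open>rest\<close> is its part on the last coordinates: a square, zero, or the form of
  the anisotropic plane. Transvections do not change these coordinates.\<close>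

theorem orthogonal_identity_length:
  assumes k: "7 \<le> k" and eps: "eps = 1"
    and rest: "\<And>x y. (\<And>i. 2 * k \<le> i \<Longrightarrow> y i = 0) \<Longrightarrow> rest (x + y) = rest x"
    and form: "\<And>x. x \<in> vecs F m \<Longrightarrow> Q x \<in> carrier F \<and>
      emb (Q x) = (\<Sum>i<k. vemb x (2 * i) * vemb x (2 * i + 1)) + rest (vemb x)"
    and w: "mixed_identity (POmega F m Q) r w" "nonsingular r w"
  shows "k < 14 ^ word_length w * (12 * (2 * word_length w + 2) ^ 3 + 1)"
proof -
  let ?I = "quad_isometries F m Q"
  define q where "q x = (\<Sum>i<k. x (2 * i) * x (2 * i + 1)) + rest x" for x :: "nat \<Rightarrow> univ"
  have hform1: "hform x z = (\<Sum>i<k. x (2 * i) * z (2 * i + 1) + x (2 * i + 1) * z (2 * i))" for x z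
    unfolding hform_def by (simp add: eps)
  have sym: "hform y x = hform x y" for x y by (subst hform_swap) (simp add: eps)
  have q_add: "q (x + y) = q x + (\<Sum>i<k. y (2 * i) * y (2 * i + 1)) + hform x y"
    if low: "\<And>i. 2 * k \<le> i \<Longrightarrow> y i = 0" for x y
  proof -
    have "rest (x + y) = rest x" by (rule rest) (rule low)
    then show ?thesis by (simp add: q_def hform1 algebra_simps sum.distrib)
  qed
  have preserve: "q (transv t p r x) = q x"
    if t: "unit_sign t" and pr: "sing p" "sing r" "hform p r = 0" for t p r x
  proof -
    have low: "y i = 0" if "sing y" "2 * k \<le> i" for y i
      using that unfolding sing_def by (auto simp: E0_def E1_def)
    \<comment> \<open>The decomposition in \<open>sing\<close> computes the value of the quadratic
      form: it is \<open>hform y0 y1\<close>.\<close>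
    have sq: "(\<Sum>i<k. y (2 * i) * y (2 * i + 1)) = 0" if sy: "sing y" for y
    proof -
      obtain y0 y1 where y: "y0 \<in> E0" "y1 \<in> E1" "y = y0 + y1" "hform y0 y1 = 0"
        using sy unfolding sing_def by blast
      have "(\<Sum>i<k. y (2 * i) * y (2 * i + 1)) = hform y0 y1"
        unfolding hform1 y(3) by (rule sum.cong) (use y(1,2) in \<open>auto simp: E0_def E1_def\<close>)
      then show ?thesis using y by simp
    qed
    \<comment> \<open>The displacement \<open>y\<close> is singular since \<open>p\<close> and
      \<open>r\<close> are singular and orthogonal, and it is orthogonal to \<open>x\<close> because
      its two contributions cancel. Hence \<open>q\<close> is unchanged.\<close>
    define c d where "c = t * hform p x" and "d = - (t * (eps * hform r x))"
    define y where "y = vscale c r + vscale d p"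
    have d_eq: "d = - (t * hform r x)" by (simp add: d_def eps)
    have T: "transv t p r x = x + y"
      by (simp add: transv_def y_def c_def d_def vs.scale_right_diff_distrib)
    have ylow: "y i = 0" if "2 * k \<le> i" for i using low[OF pr(1) that] low[OF pr(2) that]
      by (simp add: y_def vscale_def)
    have "(\<Sum>i<k. y (2 * i) * y (2 * i + 1)) = c * c * (\<Sum>i<k. r (2 * i) * r (2 * i + 1)) +
      d * d * (\<Sum>i<k. p (2 * i) * p (2 * i + 1)) + c * d * hform p r"
      by (simp add: y_def vscale_def hform1 algebra_simps sum.distrib sum_distrib_left)
    then have "(\<Sum>i<k. y (2 * i) * y (2 * i + 1)) = 0" using sq pr by simp
    moreover have "hform x y = 0"
    proof -
      have "hform x y = c * hform x r + d * hform x p" by (simp add: y_def B_add2 B_scale2)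
      also have "\<dots> = 0"
        by (simp add: c_def d_eq sym[of x r] sym[of x p])
      finally show ?thesis .
    qed
    moreover have "q (x + y) = q x + (\<Sum>i<k. y (2 * i) * y (2 * i + 1)) + hform x y"
      by (rule q_add) (rule ylow)
    ultimately show ?thesis unfolding T by simp
  qed
  have IGL: "?I \<subseteq> carrier GLn" by (auto simp: quad_isometries_def)
  show ?thesis
  proof (rule commutator_identity_length[OF k _ _ _ _ w(2), where I = ?I])
    show "subgroup (derived GLn ?I) GLn" by (rule GL.derived_is_subgroup[OF IGL])
    show "A \<otimes>\<^bsub>GLn\<^esub> C \<otimes>\<^bsub>GLn\<^esub> inv\<^bsub>GLn\<^esub> A \<otimes>\<^bsub>GLn\<^esub> inv\<^bsub>GLn\<^esub> C \<in> derived GLn ?I"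
      if "A \<in> ?I" "C \<in> ?I" for A C
      unfolding derived_def by (rule generate.incl) (use that in blast)
    show "mixed_identity (projective F m (derived GLn ?I)) r w" using w(1) by (simp add: POmega_def)
    show "tmat t p r \<in> ?I" if t: "unit_sign t" and pr: "sing p" "sing r" "hform p r = 0" for t p r
    proof -
      let ?A = "tmat t p r"
      note A = tmat[OF pr, where s = t]
      have "Q (mat_vec F m ?A u) = Q u" if u: "u \<in> vecs F m" for u
      proof -
        have c: "mat_vec F m ?A u \<in> vecs F m" using mat_vec_closed[OF GL_simps(1)[OF A(1)] u] .
        have o: "vemb (mat_vec F m ?A u) = transv t p r (vemb u)"
          using opr_vemb[OF GL_simps(1)[OF A(1)] u] A(2)[OF vemb_V[OF u]] by simp
        have "emb (Q (mat_vec F m ?A u)) = q (transv t p r (vemb u))"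
          using form[OF c] o by (simp add: q_def)
        also have "\<dots> = emb (Q u)" using preserve[OF t pr] form[OF u] by (simp add: q_def)
        finally show ?thesis
          by (rule emb_inj[THEN iffD1, OF conjunct1[OF form[OF c]] conjunct1[OF form[OF u]]])
      qed
      then show ?thesis using A(1) unfolding quad_isometries_def by blast
    qed
  qed
qed

end

section \<open>The linear, symplectic and orthogonal families\<close>

context matrix_space
begin

lemma vecs_closed: "x \<in> vecs F m \<Longrightarrow> i < m \<Longrightarrow> x $ i \<in> carrier F"
  by (simp add: vecs_def)

lemma vemb_apply: "i < m \<Longrightarrow> vemb x i = emb (x $ i)"
  by (simp add: vemb_def)

lemma emb_hyperbolic:
  assumes "x \<in> vecs F m" "2 * k \<le> m"
  shows "hyperbolic F k x \<in> carrier F" "emb (hyperbolic F k x) = (\<Sum>i<k. vemb x (2 * i) * vemb x (2 * i + 1))"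
proof -
  have c: "x $ (2 * i) \<in> carrier F" "x $ (2 * i + 1) \<in> carrier F" if "i < k" for i
    using assms that by (auto intro!: vecs_closed)
  show "hyperbolic F k x \<in> carrier F" unfolding hyperbolic_def by (rule finsum_closed) (use c in auto)
  have "emb (hyperbolic F k x) = (\<Sum>i<k. emb (x $ (2 * i)) * emb (x $ (2 * i + 1)))"
    unfolding hyperbolic_def by (rule emb_sum_mult) (use c in auto)
  also have "\<dots> = (\<Sum>i<k. vemb x (2 * i) * vemb x (2 * i + 1))"
    by (rule sum.cong) (use assms(2) in \<open>auto simp: vemb_apply\<close>)
  finally show "emb (hyperbolic F k x) = (\<Sum>i<k. vemb x (2 * i) * vemb x (2 * i + 1))" .
qed

lemma emb_binary_form:
  assumes "a \<in> carrier F" "b \<in> carrier F" "c \<in> carrier F" "x \<in> carrier F" "y \<in> carrier F"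
  shows "binary_form F a b c x y \<in> carrier F"
    "emb (binary_form F a b c x y) = emb a * (emb x * emb x) + emb b * (emb x * emb y) + emb c * (emb y * emb y)"
  using assms by (simp_all add: binary_form_def emb_add emb_mult)

end

lemma coord_spaceI:
  assumes "field (F :: nat ring)" "eps = 1 \<or> eps = - 1" "0 < m" "2 * k \<le> m" "m \<le> 2 * k + 2"
  shows "coord_space F m eps k"
  by (intro coord_space.intro matrix_space.intro embedded_field.intro coord_space_axioms.intro assms)

lemma PSL_identity_length:
  assumes "field (F :: nat ring)" "15 \<le> n" "mixed_identity (PSL F (n + 1)) r w" "nonsingular r w"
  shows "(n + 1) div 2 < 14 ^ word_length w * (12 * (2 * word_length w + 2) ^ 3 + 1)"
proof -
  interpret coord_space F "n + 1" "- 1" "(n + 1) div 2"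
    by (rule coord_spaceI[OF assms(1)]) auto
  show ?thesis by (rule linear_identity_length) (use assms in auto)
qed

lemma PSp_identity_length:
  assumes "field (F :: nat ring)" "7 \<le> n" "mixed_identity (PSp F n) r w" "nonsingular r w"
  shows "n < 14 ^ word_length w * (12 * (2 * word_length w + 2) ^ 3 + 1)"
proof -
  interpret coord_space F "2 * n" "- 1" n
    by (rule coord_spaceI[OF assms(1)]) (use assms(2) in auto)
  show ?thesis
  proof (rule isometry_identity_length[OF assms(2)])
    show "mixed_identity (projective F (2 * n) (isometries F (2 * n) (symplectic F n))) r w"
      using assms(3) by (simp add: PSp_def)
    fix x y assume xy: "x \<in> vecs F (2 * n)" "y \<in> vecs F (2 * n)"
    have c: "x $ (2 * i) \<in> carrier F" "x $ (2 * i + 1) \<in> carrier F" "y $ (2 * i) \<in> carrier F" "y $ (2 * i + 1) \<in> carrier F"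
      if "i < n" for i using xy that by (auto intro!: vecs_closed)
    have "emb (symplectic F n x y) = (\<Sum>i<n. emb ((x $ (2 * i) \<otimes>\<^bsub>F\<^esub> y $ (2 * i + 1)) \<ominus>\<^bsub>F\<^esub> (x $ (2 * i + 1) \<otimes>\<^bsub>F\<^esub> y $ (2 * i))))"
      unfolding symplectic_def by (rule emb_finsum) (use c in auto)
    also have "\<dots> = hform (vemb x) (vemb y)"
      unfolding hform_def by (rule sum.cong) (use c in \<open>auto simp: vemb_apply emb_diff emb_mult\<close>)
    moreover have "symplectic F n x y \<in> carrier F"
      unfolding symplectic_def by (rule finsum_closed) (use c in auto)
    ultimately show "symplectic F n x y \<in> carrier F \<and> emb (symplectic F n x y) = hform (vemb x) (vemb y)"
      by simp
  qed (rule assms(4))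
qed

lemma POmega_odd_identity_length:
  assumes "field (F :: nat ring)" "7 \<le> n" "mixed_identity (POmega_odd F n) r w" "nonsingular r w"
  shows "n < 14 ^ word_length w * (12 * (2 * word_length w + 2) ^ 3 + 1)"
proof -
  interpret coord_space F "2 * n + 1" 1 n
    by (rule coord_spaceI[OF assms(1)]) (use assms(2) in auto)
  show ?thesis
  proof (rule orthogonal_identity_length[OF assms(2) refl, where rest = "\<lambda>v. v (2 * n) * v (2 * n)"])
    show "mixed_identity (POmega F (2 * n + 1) (\<lambda>v. hyperbolic F n v \<oplus>\<^bsub>F\<^esub> (v $ (2 * n) \<otimes>\<^bsub>F\<^esub> v $ (2 * n)))) r w"
      using assms(3) by (simp only: POmega_odd_def)
    show "hyperbolic F n x \<oplus>\<^bsub>F\<^esub> (x $ (2 * n) \<otimes>\<^bsub>F\<^esub> x $ (2 * n)) \<in> carrier F \<and>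
      emb (hyperbolic F n x \<oplus>\<^bsub>F\<^esub> (x $ (2 * n) \<otimes>\<^bsub>F\<^esub> x $ (2 * n))) =
      (\<Sum>i<n. vemb x (2 * i) * vemb x (2 * i + 1)) + vemb x (2 * n) * vemb x (2 * n)"
      if x: "x \<in> vecs F (2 * n + 1)" for x
    proof -
      have i: "2 * n < 2 * n + 1" by simp
      show ?thesis
        unfolding vemb_apply[OF i]
        using emb_hyperbolic[OF x, of n] vecs_closed[OF x i] by (simp add: emb_add emb_mult)
    qed
  qed (use assms(4) in auto)
qed

lemma POmega_plus_identity_length:
  assumes "field (F :: nat ring)" "7 \<le> n" "mixed_identity (POmega_plus F n) r w" "nonsingular r w"
  shows "n < 14 ^ word_length w * (12 * (2 * word_length w + 2) ^ 3 + 1)"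
proof -
  interpret coord_space F "2 * n" 1 n
    by (rule coord_spaceI[OF assms(1)]) (use assms(2) in auto)
  show ?thesis
  proof (rule orthogonal_identity_length[OF assms(2) refl, where rest = "\<lambda>v. 0"])
    show "mixed_identity (POmega F (2 * n) (hyperbolic F n)) r w"
      using assms(3) by (simp only: POmega_plus_def)
    show "hyperbolic F n x \<in> carrier F \<and>
      emb (hyperbolic F n x) = (\<Sum>i<n. vemb x (2 * i) * vemb x (2 * i + 1)) + 0"
      if x: "x \<in> vecs F (2 * n)" for x
      using emb_hyperbolic[OF x, of n] by simp
  qed (use assms(4) in auto)
qed

lemma POmega_minus_identity_length:
  assumes "field (F :: nat ring)" "8 \<le> n" "anisotropic F a b c"
    "mixed_identity (POmega_minus F a b c n) r w" "nonsingular r w"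
  shows "n - 1 < 14 ^ word_length w * (12 * (2 * word_length w + 2) ^ 3 + 1)"
proof -
  interpret coord_space F "2 * n" 1 "n - 1"
    by (rule coord_spaceI[OF assms(1)]) (use assms(2) in auto)
  have abc: "a \<in> carrier F" "b \<in> carrier F" "c \<in> carrier F" using assms(3) by (auto simp: anisotropic_def)
  let ?q = "\<lambda>s t. emb a * (s * s) + emb b * (s * t) + emb c * (t * t)"
  have k: "7 \<le> n - 1" using assms(2) by simp
  show ?thesis
  proof (rule orthogonal_identity_length[OF k refl, where rest = "\<lambda>v. ?q (v (2 * n - 2)) (v (2 * n - 1))"])
    show "mixed_identity (POmega F (2 * n) (\<lambda>v. hyperbolic F (n - 1) v
        \<oplus>\<^bsub>F\<^esub> binary_form F a b c (v $ (2 * n - 2)) (v $ (2 * n - 1)))) r w"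
      using assms(4) by (simp only: POmega_minus_def)
    show "hyperbolic F (n - 1) x \<oplus>\<^bsub>F\<^esub> binary_form F a b c (x $ (2 * n - 2)) (x $ (2 * n - 1)) \<in> carrier F \<and>
      emb (hyperbolic F (n - 1) x \<oplus>\<^bsub>F\<^esub> binary_form F a b c (x $ (2 * n - 2)) (x $ (2 * n - 1))) =
      (\<Sum>i<n - 1. vemb x (2 * i) * vemb x (2 * i + 1)) + ?q (vemb x (2 * n - 2)) (vemb x (2 * n - 1))"
      if x: "x \<in> vecs F (2 * n)" for x
    proof -
      have xc: "x $ (2 * n - 2) \<in> carrier F" "x $ (2 * n - 1) \<in> carrier F"
        using assms(2) by (auto intro!: vecs_closed[OF x])
      note b = emb_binary_form[OF abc xc]
      have "2 * (n - 1) \<le> 2 * n" by simp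
      note h = emb_hyperbolic[OF x this]
      have i: "2 * n - 2 < 2 * n" "2 * n - 1 < 2 * n" using assms(2) by auto
      show ?thesis unfolding vemb_apply[OF i(1)] vemb_apply[OF i(2)] using b h by (simp add: emb_add)
    qed
    show "?q ((x + y) (2 * n - 2)) ((x + y) (2 * n - 1)) = ?q (x (2 * n - 2)) (x (2 * n - 1))"
      if low: "\<And>i. 2 * (n - 1) \<le> i \<Longrightarrow> y i = 0" for x y :: "nat \<Rightarrow> univ"
    proof -
      have "y (2 * n - 2) = 0" "y (2 * n - 1) = 0" by (rule low, simp)+
      then show ?thesis by simp
    qed
  qed (rule assms(5))
qed

section \<open>Unitary groups\<close>

context embedded_field
begin

lemma e_power: "0 < n \<Longrightarrow> e ^ n = e"
  by (induction n rule: nat_induct_non_zero) simp_all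

lemma of_nat_order_e:
  assumes "finite (carrier F)"
  shows "of_nat (Coset.order F) * e = 0"
proof -
  have "emb ([n] \<cdot> \<one>) = of_nat n * e" for n :: nat
    by (induction n) (simp_all add: emb_add algebra_simps)
  moreover have "[Coset.order F] \<cdot> \<one> = \<zero>"
    using group.pow_order_eq_1[OF a_group, of \<one>] by (simp add: Coset.order_def add_pow_def)
  ultimately show ?thesis by (metis emb_zero)
qed

text \<open>The corner at \<open>e\<close> is a field and has no nonzero nilpotent elements. Applied
  to the order of the field, a power of the prime \<open>p\<close>, this gives characteristic
  \<open>p\<close>.\<close>

lemma of_nat_e_nilpotent:
  assumes "of_nat (p ^ n) * e = 0"
  shows "of_nat p * e = 0"
proof (rule ccontr)
  assume "of_nat p * e \<noteq> 0"
  then obtain u where u: "u * (of_nat p * e) = e"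
    using e_inverse[of "of_nat p * e"] by (auto simp: mult.left_commute)
  have n: "0 < n" using assms e_nz by (cases n) auto
  have "(u * (of_nat p * e)) ^ n = u ^ n * (of_nat (p ^ n) * e)"
    by (simp add: power_mult_distrib e_power[OF n])
  then have "e ^ n = 0" using u assms by simp
  then show False using e_nz e_power[OF n] by simp
qed

lemma prime_power_add:
  assumes p: "prime p" and pe: "of_nat p * e = 0"
  shows "e * (s + t) ^ p = e * s ^ p + e * t ^ p"
proof -
  have p0: "0 < p" using p prime_gt_0_nat by blast
  let ?f = "\<lambda>k. e * (of_nat (p choose k) * s ^ k * t ^ (p - k))"
  have "?f k = 0" if "k \<in> {..p} - {0, p}" for k
  proof -
    have "p dvd (p choose k)" by (rule dvd_choose_prime) (use that p p0 in auto)
    then obtain c where "p choose k = p * c" by blast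
    then have "?f k = (of_nat p * e) * (of_nat c * s ^ k * t ^ (p - k))" by (simp add: mult_ac)
    then show ?thesis using pe by simp
  qed
  then have "(\<Sum>k\<le>p. ?f k) = (\<Sum>k\<in>{0, p}. ?f k)"
    by (intro sum.mono_neutral_right) auto
  then show ?thesis using p0 by (simp add: binomial_ring sum_distrib_left algebra_simps)
qed

lemma prime_powers_add:
  assumes "prime p" "of_nat p * e = 0"
  shows "e * (s + t) ^ (p ^ j) = e * s ^ (p ^ j) + e * t ^ (p ^ j)"
proof (induction j)
  case (Suc j)
  have p0: "0 < p" using assms(1) prime_gt_0_nat by blast
  have step: "e * x ^ (p ^ Suc j) = e * (e * x ^ (p ^ j)) ^ p" for x
    by (simp add: power_mult_distrib e_power[OF p0] power_mult[symmetric] mult.commute[of p] mult.assoc[symmetric]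
        e_power[of 2, simplified power2_eq_square])
  show ?case unfolding step Suc using prime_power_add[OF assms] .
qed (simp add: algebra_simps)

lemma power_order:
  assumes "finite (carrier F)" "e * t = t"
  shows "e * t ^ Coset.order F = t"
proof -
  define x where "x = coord t F"
  have x: "x \<in> carrier F" "t = emb x" using assms(2) e_mult[of t] by (simp_all add: x_def cringF)
  have ord: "0 < Coset.order F" using assms(1) zero_closed by (auto simp: Coset.order_def card_gt_0_iff)
  have "x [^] Coset.order F = x"
  proof (cases "x = \<zero>")
    case True
    then show ?thesis using ord by (simp add: nat_pow_zero)
  next
    case False
    interpret M: group "mult_of F" by (rule field_mult_group)
    have "x [^] (Coset.order F - 1) = \<one>"
      using M.pow_order_eq_1[of x] x False order_mult_of[OF assms(1)] by (simp add: nat_pow_mult_of)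
    then have "x [^] Suc (Coset.order F - 1) = x" using x by simp
    then show ?thesis using ord by simp
  qed
  then show ?thesis using emb_pow[OF x(1), of "Coset.order F"] x(2) by simp
qed

text \<open>\<open>- 1\<close> is fixed by \<open>x \<mapsto> x\<^sup>q\<close>; hence it is a power of a generator of the multiplicative group
  whose exponent is divisible by \<open>q + 1\<close>.\<close>

lemma ex_norm_minus_one:
  assumes fin: "finite (carrier F)" and card: "Coset.order F = q\<^sup>2" and q: "2 \<le> q"
    and minus: "(\<ominus> \<one>) [^] q = \<ominus> \<one>"
  shows "\<exists>x\<in>carrier F. \<exists>y\<in>carrier F. x \<noteq> y \<and> x [^] (q + 1) = \<ominus> \<one> \<and> y [^] (q + 1) = \<ominus> \<one>"
proof -
  interpret M: group "mult_of F" by (rule field_mult_group)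
  obtain g where g: "g \<in> carrier (mult_of F)" and gen: "carrier (mult_of F) = {g [^] i |i::nat. i \<in> UNIV}"
    using finite_field_mult_group_has_gen[OF fin] by blast
  have gc: "g \<in> carrier F" "g \<noteq> \<zero>" using g by auto
  have finM: "finite (carrier (mult_of F))" using fin by simp
  have "M.ord g = card (carrier (mult_of F))"
    using M.generate_pow_card[OF g] M.generate_pow_on_finite_carrier[OF finM g] gen by (simp add: nat_pow_mult_of)
  then have ord: "M.ord g = q\<^sup>2 - 1" using order_mult_of[OF fin] card by (simp add: Coset.order_def)
  have q1: "q\<^sup>2 - 1 = (q - 1) * (q + 1)" using q by (simp add: power2_eq_square algebra_simps)
  have one: "g [^] i = \<one> \<longleftrightarrow> (q - 1) * (q + 1) dvd i" for i :: nat
    using M.pow_eq_id[OF g, of i] ord q1 by (simp add: nat_pow_mult_of)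
  have "\<ominus> \<one> \<noteq> \<zero>"
  proof
    assume "\<ominus> \<one> = \<zero>"
    then have "\<ominus> (\<ominus> \<one>) = \<zero>" by simp
    then show False by simp
  qed
  then have "\<ominus> \<one> \<in> carrier (mult_of F)" by simp
  then obtain s where s: "\<ominus> \<one> = g [^] (s :: nat)" unfolding gen by blast
  define u where "u = (\<ominus> \<one>) [^] (q - 1)"
  have u: "u \<in> carrier F" by (simp add: u_def)
  have "(\<ominus> \<one>) [^] Suc (q - 1) = \<ominus> \<one>" using minus q by simp
  then have "u \<otimes> \<ominus> \<one> = \<ominus> \<one>" by (simp add: u_def)
  then have "\<ominus> (\<ominus> u) = \<ominus> (\<ominus> \<one>)" using u by (simp add: r_minus)
  then have "(\<ominus> \<one>) [^] (q - 1) = \<one>" using u by (simp add: u_def)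
  then have "g [^] (s * (q - 1)) = \<one>" unfolding s using gc by (simp add: nat_pow_pow)
  then have "(q - 1) * (q + 1) dvd (q - 1) * s" unfolding one by (simp only: mult.commute[of s])
  then have "(q + 1) dvd s" using q nat_mult_dvd_cancel1[of "q - 1" "q + 1" s] by linarith
  then obtain s' where s': "s = (q + 1) * s'" by blast
  have x: "(g [^] s') [^] (q + 1) = \<ominus> \<one>"
    unfolding s s' nat_pow_pow[OF gc(1)] by (simp only: mult.commute)
  \<comment> \<open>This is a nontrivial element of norm one; multiplying by it yields the second
    solution. Two solutions are wanted for two complementary isotropic spaces.\<close>
  have "g [^] (q - 1) \<noteq> \<one>"
  proof
    assume "g [^] (q - 1) = \<one>"
    then have "(q - 1) * (q + 1) dvd q - 1" unfolding one .
    then have "(q - 1) * (q + 1) \<le> q - 1" by (rule dvd_imp_le) (use q in linarith)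
    moreover have "0 < (q - 1) * q" using q by simp
    ultimately show False unfolding distrib_left by linarith
  qed
  moreover have "g [^] s' \<noteq> \<zero>" using M.nat_pow_closed[OF g, of s'] by (simp add: nat_pow_mult_of)
  ultimately have ne: "g [^] s' \<noteq> g [^] s' \<otimes> g [^] (q - 1)"
    using gc m_lcancel[of "g [^] s'" \<one> "g [^] (q - 1)"] by auto
  have "(g [^] (q - 1)) [^] (q + 1) = \<one>"
    unfolding nat_pow_pow[OF gc(1)] one by simp
  then have "(g [^] s' \<otimes> g [^] (q - 1)) [^] (q + 1) = \<ominus> \<one>"
    using gc x nat_pow_distrib[of "g [^] s'" "g [^] (q - 1)" "q + 1"] by simp
  then show ?thesis using ne x gc by (intro bexI[of _ "g [^] s'"] bexI[of _ "g [^] s' \<otimes> g [^] (q - 1)"]) simp_all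
qed

end

section \<open>The standard Hermitian space over a field of order \<open>q^2\<close>\<close>

locale unitary_space = matrix_space F m for F :: "nat ring" (structure) and m +
  fixes q :: nat
  assumes card_F: "Coset.order F = q\<^sup>2" and primepow_q: "primepow q" and m_pos: "0 < m"
begin

abbreviation k where "k \<equiv> m div 2"

definition \<sigma> :: "univ \<Rightarrow> univ" where "\<sigma> t = e * t ^ q"

lemma q2: "2 \<le> q"
  using primepow_gt_Suc_0[OF primepow_q] by simp

lemma fin: "finite (carrier F)"
  using card_F q2 by (intro card_ge_0_finite) (simp add: Coset.order_def)

lemma \<sigma>_add: "\<sigma> (s + t) = \<sigma> s + \<sigma> t"
proof -
  obtain p j where p: "prime p" "q = p ^ j" using primepow_q by (auto simp: primepow_def)
  have "of_nat (p ^ (j * 2)) * e = 0"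
    using of_nat_order_e[OF fin] card_F p(2) by (simp add: power_mult)
  from prime_powers_add[OF p(1) of_nat_e_nilpotent[OF this], of s t j] show ?thesis
    unfolding \<sigma>_def p(2)[symmetric] .
qed

lemma \<sigma>_mult: "\<sigma> (s * t) = \<sigma> s * \<sigma> t"
  by (simp add: \<sigma>_def power_mult_distrib mult_ac)

lemma \<sigma>_simps [simp]: "\<sigma> 0 = 0" "\<sigma> e = e" "e * \<sigma> t = \<sigma> t"
  using q2 by (simp_all add: \<sigma>_def e_power power_0_left mult.assoc[symmetric])

lemma \<sigma>_minus: "\<sigma> (- t) = - \<sigma> t"
  using \<sigma>_add[of t "- t"] by (simp add: eq_neg_iff_add_eq_0 add.commute)

lemma \<sigma>_sum: "\<sigma> (sum f A) = (\<Sum>i\<in>A. \<sigma> (f i))"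
  by (induction A rule: infinite_finite_induct) (simp_all add: \<sigma>_add)

lemma \<sigma>_\<sigma>: "e * t = t \<Longrightarrow> \<sigma> (\<sigma> t) = t"
proof -
  assume t: "e * t = t"
  have "\<sigma> (\<sigma> t) = e * t ^ (q\<^sup>2)"
    using q2 by (simp add: \<sigma>_def power_mult_distrib e_power power_mult[symmetric] power2_eq_square)
  then show ?thesis using power_order[OF fin t] card_F by simp
qed

text \<open>If \<open>\<sigma> \<alpha> * \<alpha> = - e\<close>, the vector with entries
  \<open>e\<close> and \<open>\<alpha>\<close> in a coordinate plane of the standard Hermitian form
  is isotropic; two roots give two isotropic lines in this plane.\<close>

lemma ex_roots: "\<exists>\<alpha> \<beta>. e * \<alpha> = \<alpha> \<and> e * \<beta> = \<beta> \<and> \<alpha> \<noteq> \<beta> \<and> \<sigma> \<alpha> * \<alpha> = - e \<and> \<sigma> \<beta> * \<beta> = - e"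
proof -
  have "emb ((\<ominus> \<one>) [^] q) = \<sigma> (- e)" by (simp add: emb_pow emb_minus \<sigma>_def)
  also have "\<dots> = emb (\<ominus> \<one>)" by (simp add: \<sigma>_minus emb_minus)
  finally have "(\<ominus> \<one>) [^] q = \<ominus> \<one>" by (simp add: emb_inj)
  from ex_norm_minus_one[OF fin card_F q2 this] obtain x y where
    xy: "x \<in> carrier F" "y \<in> carrier F" "x \<noteq> y" "x [^] (q + 1) = \<ominus> \<one>" "y [^] (q + 1) = \<ominus> \<one>" by blast
  have "\<sigma> (emb z) * emb z = - e" if "z \<in> carrier F" "z [^] (q + 1) = \<ominus> \<one>" for z
    using emb_pow[OF that(1), of "q + 1"] that(2) by (simp add: \<sigma>_def emb_minus mult_ac)
  then have "e * emb x = emb x \<and> e * emb y = emb y \<and> emb x \<noteq> emb y \<and>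
      \<sigma> (emb x) * emb x = - e \<and> \<sigma> (emb y) * emb y = - e"
    using xy by (simp add: emb_inj)
  then show ?thesis by blast
qed

definition \<alpha> where "\<alpha> = fst (SOME (a, b). e * a = a \<and> e * b = b \<and> a \<noteq> b \<and> \<sigma> a * a = - e \<and> \<sigma> b * b = - e)"
definition \<beta> where "\<beta> = snd (SOME (a, b). e * a = a \<and> e * b = b \<and> a \<noteq> b \<and> \<sigma> a * a = - e \<and> \<sigma> b * b = - e)"

lemma roots: "e * \<alpha> = \<alpha>" "e * \<beta> = \<beta>" "\<alpha> \<noteq> \<beta>" "\<sigma> \<alpha> * \<alpha> = - e" "\<sigma> \<beta> * \<beta> = - e"
proof -
  let ?P = "\<lambda>(a, b). e * a = a \<and> e * b = b \<and> a \<noteq> b \<and> \<sigma> a * a = - e \<and> \<sigma> b * b = - e"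
  have "\<exists>ab. ?P ab" using ex_roots by simp
  then have "?P (SOME ab. ?P ab)" by (rule someI_ex)
  then have "?P (\<alpha>, \<beta>)" by (simp add: \<alpha>_def \<beta>_def split_def)
  then show "e * \<alpha> = \<alpha>" "e * \<beta> = \<beta>" "\<alpha> \<noteq> \<beta>" "\<sigma> \<alpha> * \<alpha> = - e" "\<sigma> \<beta> * \<beta> = - e" by auto
qed

text \<open>Multiplication by \<open>\<alpha>\<close> turns the expression into
  \<open>\<alpha> - \<beta>\<close>.\<close>

lemma pairing_nonzero: "e + \<sigma> \<alpha> * \<beta> \<noteq> 0"
proof
  assume "e + \<sigma> \<alpha> * \<beta> = 0"
  then have "\<alpha> * (e + \<sigma> \<alpha> * \<beta>) = 0" by simp
  moreover have "\<alpha> * (e + \<sigma> \<alpha> * \<beta>) = e * \<alpha> + (\<sigma> \<alpha> * \<alpha>) * \<beta>" by (simp add: algebra_simps)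
  ultimately show False using roots by simp
qed

text \<open>Normalises the second vector of each pair in \<open>hsys0\<close>, whose product with
  the first is \<open>e + \<sigma> \<alpha> * \<beta>\<close> before scaling.\<close>

definition \<gamma> where "\<gamma> = (SOME g. g * (e + \<sigma> \<alpha> * \<beta>) = e)"

lemma \<gamma>: "\<gamma> * (e + \<sigma> \<alpha> * \<beta>) = e"
proof -
  have "e * (e + \<sigma> \<alpha> * \<beta>) = e + \<sigma> \<alpha> * \<beta>" by (simp add: distrib_left mult.assoc[symmetric])
  then show ?thesis unfolding \<gamma>_def by (rule someI_ex[OF e_inverse[OF _ pairing_nonzero]])
qed

text \<open>Semilinear in the first argument, to fit \<open>hyp_space\<close>;
  \<open>hermitian\<close> takes the power in the second, whence the swapped arguments in
  \<open>emb_hermitian\<close>.\<close>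

definition herm :: "(nat \<Rightarrow> univ) \<Rightarrow> (nat \<Rightarrow> univ) \<Rightarrow> univ" where
  "herm x z = (\<Sum>i<m. \<sigma> (x i) * z i)"

definition iso :: "univ \<Rightarrow> (nat \<Rightarrow> univ) set" where
  "iso a = {v \<in> V. (\<forall>j. v (2 * j + 1) = a * v (2 * j)) \<and> (\<forall>i\<ge>2 * k. v i = 0)}"

definition pair :: "univ \<Rightarrow> nat \<Rightarrow> nat \<Rightarrow> univ" where
  "pair a j = unitv (2 * j) + vscale a (unitv (2 * j + 1))"

lemma sum_pairs: "(\<Sum>i<2 * n. f i) = (\<Sum>j<n. f (2 * j) + f (2 * j + 1))" for f :: "nat \<Rightarrow> univ"
  by (induction n) (simp_all add: add.assoc)

lemma herm_low:
  assumes "\<And>i. 2 * k \<le> i \<Longrightarrow> x i = 0"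
  shows "herm x z = (\<Sum>j<k. \<sigma> (x (2 * j)) * z (2 * j) + \<sigma> (x (2 * j + 1)) * z (2 * j + 1))"
proof -
  have "herm x z = (\<Sum>i<2 * k. \<sigma> (x i) * z i)"
    unfolding herm_def by (rule sum.mono_neutral_right) (use assms in auto)
  then show ?thesis by (simp only: sum_pairs)
qed

lemma pair_iso: "e * a = a \<Longrightarrow> j < k \<Longrightarrow> pair a j \<in> iso a"
proof -
  assume a: "e * a = a" and j: "j < k"
  have "2 * j < m" "2 * j + 1 < m" using j by auto
  then have "pair a j \<in> V"
    unfolding pair_def using V_subspace unitv_V unfolding vs.subspace_def by blast
  moreover have "2 * i \<noteq> Suc (2 * i')" "Suc (2 * i') \<noteq> 2 * i" for i i' :: nat by presburger+
  ultimately show ?thesis using j a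
    by (auto simp: iso_def pair_def unitv_def vscale_def mult.commute[of _ e])
qed

lemma herm_pair:
  assumes "j < k" "e * a = a" "z \<in> V"
  shows "herm (pair a j) z = z (2 * j) + \<sigma> a * z (2 * j + 1)"
proof -
  have p: "2 * i \<noteq> Suc (2 * i')" "Suc (2 * i') \<noteq> 2 * i" for i i' :: nat by presburger+
  have z: "e * z i = z i" for i using assms(3) by (simp add: V_def)
  have "herm (pair a j) z = (\<Sum>i<k. \<sigma> (pair a j (2 * i)) * z (2 * i) + \<sigma> (pair a j (2 * i + 1)) * z (2 * i + 1))"
    by (rule herm_low) (use pair_iso[OF assms(2,1)] in \<open>auto simp: iso_def\<close>)
  also have "\<dots> = (\<Sum>i<k. if i = j then z (2 * j) + \<sigma> a * z (2 * j + 1) else 0)"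
    by (rule sum.cong) (auto simp: pair_def unitv_def vscale_def p z assms(2) \<sigma>_mult mult.assoc)
  finally show ?thesis using assms(1) by simp
qed

lemma herm_scale1: "herm (vscale t x) z = \<sigma> t * herm x z"
  by (simp add: herm_def vscale_def \<sigma>_mult sum_distrib_left mult.assoc)

lemma herm_swap: "x \<in> V \<Longrightarrow> y \<in> V \<Longrightarrow> herm y x = \<sigma> (herm x y)"
  unfolding herm_def \<sigma>_sum \<sigma>_mult by (intro sum.cong) (auto simp: \<sigma>_\<sigma> V_def)

lemma herm_iso_zero:
  assumes "\<sigma> a * a = - e" "x \<in> iso a" "y \<in> iso a"
  shows "herm x y = 0"
proof -
  have y: "e * y i = y i" for i using assms(3) by (simp add: iso_def V_def)
  have "herm x y = (\<Sum>j<k. \<sigma> (x (2 * j)) * y (2 * j) + \<sigma> (x (2 * j + 1)) * y (2 * j + 1))"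
    by (rule herm_low) (use assms(2) in \<open>auto simp: iso_def\<close>)
  also have "\<dots> = 0"
  proof (rule sum.neutral, rule ballI)
    fix j
    have "x (2 * j + 1) = a * x (2 * j)" "y (2 * j + 1) = a * y (2 * j)" using assms by (auto simp: iso_def)
    then have "\<sigma> (x (2 * j + 1)) * y (2 * j + 1) = (\<sigma> a * a) * (\<sigma> (x (2 * j)) * y (2 * j))"
      by (simp only: \<sigma>_mult mult_ac)
    also have "\<dots> = - (\<sigma> (x (2 * j)) * y (2 * j))"
      unfolding assms(1) by (simp add: mult.assoc[symmetric])
    finally show "\<sigma> (x (2 * j)) * y (2 * j) + \<sigma> (x (2 * j + 1)) * y (2 * j + 1) = 0" by simp
  qed
  finally show ?thesis .
qed

sublocale hyp_space vscale e 1 V "iso \<alpha>" "iso \<beta>" herm k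
proof
  show "e \<noteq> 0" by (rule e_nz)
  show "\<exists>s. s * t = e" if "e * t = t" "t \<noteq> 0" for t using e_inverse that .
  show "1 * 1 = (1 :: univ)" by simp
  show "vs.subspace V" by (rule V_subspace)
  show "vscale e x = x" if "x \<in> V" for x using V_e that .
  show "vs.subspace (iso \<alpha>)" "vs.subspace (iso \<beta>)"
    using V_subspace by (auto simp: iso_def vs.subspace_def vscale_def algebra_simps)
  show "iso \<alpha> \<subseteq> V" "iso \<beta> \<subseteq> V" by (auto simp: iso_def)
  show "herm x (y + z) = herm x y + herm x z" for x y z
    by (simp add: herm_def algebra_simps sum.distrib)
  show "herm x (vscale a y) = a * herm x y" for x y a
    by (simp add: herm_def vscale_def algebra_simps sum_distrib_left)
  show "herm (x + y) z = herm x z + herm y z" for x y z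
    by (simp add: herm_def \<sigma>_add algebra_simps sum.distrib)
  show "herm y x = 0" if "x \<in> V" "y \<in> V" "herm x y = 0" for x y using herm_swap[OF that(1,2)] that by simp
  show "herm x y = 0" if "x \<in> iso \<alpha>" "y \<in> iso \<alpha>" for x y using herm_iso_zero[OF roots(4)] that .
  show "herm x y = 0" if "x \<in> iso \<beta>" "y \<in> iso \<beta>" for x y using herm_iso_zero[OF roots(5)] that .
qed

lemma hsys0: "hsys 0 {..<k} (pair \<alpha>) (\<lambda>j. vscale \<gamma> (pair \<beta> j))"
proof -
  let ?a = "pair \<alpha>" and ?b = "\<lambda>j. vscale \<gamma> (pair \<beta> j)"
  have pE: "?a j \<in> iso \<alpha>" "?b j \<in> iso \<beta>" if "j < k" for j
    using pair_iso[OF roots(1) that] pair_iso[OF roots(2) that] E'_sub(1) by (auto simp: vs.subspace_def)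
  then have pV: "?a j \<in> V" "?b j \<in> V" if "j < k" for j using that by (auto simp: iso_def)
  have np: "2 * i \<noteq> Suc (2 * i')" "Suc (2 * i') \<noteq> 2 * i" for i i' :: nat by presburger+
  have dual1: "herm (?a i) (?b j) = (if i = j then e else 0)" if "i < k" "j < k" for i j
  proof -
    have "herm (?a i) (?b j) = ?b j (2 * i) + \<sigma> \<alpha> * ?b j (2 * i + 1)"
      by (rule herm_pair[OF that(1) roots(1) pV(2)[OF that(2)]])
    also have "\<dots> = (if i = j then \<gamma> * (e + \<sigma> \<alpha> * \<beta>) else 0)"
      using roots(2) by (simp add: pair_def vscale_def unitv_def np algebra_simps)
    finally show ?thesis using \<gamma> by simp
  qed
  have dual2: "herm (?b i) (?a j) = (if i = j then e else 0)" if "i < k" "j < k" for i j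
    using herm_swap[OF pV(1)[OF that(2)] pV(2)[OF that(1)]] dual1[OF that(2,1)] by simp
  define gs where "gs = map (\<lambda>i (v::nat \<Rightarrow> univ). v i) [2 * k..<m]"
  define ws where "ws = map unitv [2 * k..<m]"
  have gs: "length gs \<le> 2 * 0 + 2" "\<forall>g\<in>set gs. lin g" by (auto simp: gs_def lin_def vscale_def)
  \<comment> \<open>Up to sign, \<open>\<alpha> - \<beta>\<close> is the determinant of the change
    of basis in a coordinate plane.\<close>
  have diff: "\<exists>d. d * (\<alpha> - \<beta>) = e" by (rule e_inverse) (use roots in \<open>simp_all add: right_diff_distrib\<close>)
  then obtain d where d: "d * (\<alpha> - \<beta>) = e" by blast
  have zero: "\<forall>z\<in>V. (\<forall>j\<in>{..<k}. herm (?a j) z = 0 \<and> herm (?b j) z = 0) \<longrightarrow> (\<forall>g\<in>set gs. g z = 0) \<longrightarrow> z = 0"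
  proof (intro ballI impI)
    fix z assume z: "z \<in> V" and h: "\<forall>j\<in>{..<k}. herm (?a j) z = 0 \<and> herm (?b j) z = 0"
      and g: "\<forall>g\<in>set gs. g z = 0"
    have ez: "e * z i = z i" for i using z by (simp add: V_def)
    have low: "z (2 * j) = 0 \<and> z (2 * j + 1) = 0" if j: "j < k" for j
    proof -
      let ?x = "z (2 * j)" and ?y = "z (2 * j + 1)"
      have A: "?x + \<sigma> \<alpha> * ?y = 0" using h j herm_pair[OF j roots(1) z] by simp
      have "\<sigma> \<gamma> * herm (pair \<beta> j) z = 0" using h j by (auto simp: herm_scale1)
      then have sg: "\<sigma> \<gamma> * (?x + \<sigma> \<beta> * ?y) = 0" unfolding herm_pair[OF j roots(2) z] .
      have g: "\<sigma> \<gamma> * \<sigma> (e + \<sigma> \<alpha> * \<beta>) = e" unfolding \<sigma>_mult[symmetric] \<gamma> by simp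
      have "?x + \<sigma> \<beta> * ?y = e * (?x + \<sigma> \<beta> * ?y)"
        by (simp add: distrib_left ez mult.left_commute[of e])
      also have "\<dots> = (\<sigma> \<gamma> * \<sigma> (e + \<sigma> \<alpha> * \<beta>)) * (?x + \<sigma> \<beta> * ?y)" unfolding g ..
      also have "\<dots> = \<sigma> (e + \<sigma> \<alpha> * \<beta>) * (\<sigma> \<gamma> * (?x + \<sigma> \<beta> * ?y))"
        by (simp only: mult.assoc mult.left_commute)
      also have "\<dots> = 0" unfolding sg by simp
      finally have B: "?x + \<sigma> \<beta> * ?y = 0" .
      \<comment> \<open>Multiplication by \<open>\<alpha> * \<beta>\<close> replaces
        \<open>\<sigma> \<alpha>\<close> and \<open>\<sigma> \<beta>\<close> by
        \<open>- \<beta>\<close> and \<open>- \<alpha>\<close>, so the difference of the two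
        equations says that \<open>\<alpha> - \<beta>\<close>, which is invertible in the field,
        kills the second entry.\<close>
      have "\<alpha> * \<beta> * ((?x + \<sigma> \<alpha> * ?y) - (?x + \<sigma> \<beta> * ?y)) = (\<sigma> \<alpha> * \<alpha>) * \<beta> * ?y - (\<sigma> \<beta> * \<beta>) * \<alpha> * ?y"
        by (simp add: algebra_simps)
      also have "\<dots> = (\<alpha> - \<beta>) * ?y" unfolding roots(4,5) using roots(1,2) by (simp add: algebra_simps ez)
      finally have "(\<alpha> - \<beta>) * ?y = 0" unfolding A B by simp
      then have "d * (\<alpha> - \<beta>) * ?y = 0" by (simp add: mult.assoc)
      then have "?y = 0" unfolding d by (simp add: ez)
      then show ?thesis using A by simp
    qed
    have "z i = 0" for i
    proof -
      consider "i < 2 * k" "even i" | "i < 2 * k" "odd i" | "2 * k \<le> i" "i < m" | "m \<le> i" by linarith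
      then show ?thesis
      proof cases
        case 1
        then obtain j where "i = 2 * j" "j < k" by (auto elim: evenE)
        then show ?thesis using low by simp
      next
        case 2
        then obtain j where "i = 2 * j + 1" "j < k" by (auto elim: oddE)
        then show ?thesis using low by blast
      next
        case 3
        then show ?thesis using g by (auto simp: gs_def)
      next
        case 4
        then show ?thesis using z by (auto simp: V_def)
      qed
    qed
    then show "z = 0" by auto
  qed
  have ws: "length ws \<le> 2 * 0 + 2" "set ws \<subseteq> V" by (auto simp: ws_def unitv_V)
  let ?W = "vs.span (?a ` {..<k} \<union> ?b ` {..<k} \<union> set ws)"
  have uW: "unitv (2 * j) \<in> ?W \<and> unitv (2 * j + 1) \<in> ?W" if j: "j < k" for j
  proof -
    have uV: "unitv (2 * j) \<in> V" "unitv (2 * j + 1) \<in> V" using j by (auto intro!: unitv_V)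
    have a: "?a j \<in> ?W" "?b j \<in> ?W" using j by (auto intro!: vs.span_base)
    have "vscale (e + \<sigma> \<alpha> * \<beta>) (?b j) = vscale e (pair \<beta> j)"
      unfolding vs.scale_scale using \<gamma> by (simp add: mult.commute)
    also have "\<dots> = pair \<beta> j" using pair_iso[OF roots(2) j] V_e by (simp add: iso_def)
    finally have b: "pair \<beta> j \<in> ?W" using vs.span_scale[OF a(2), of "e + \<sigma> \<alpha> * \<beta>"] by simp
    have "vscale d (?a j - pair \<beta> j) = vscale (d * (\<alpha> - \<beta>)) (unitv (2 * j + 1))"
      by (simp add: pair_def fun_eq_iff vscale_def algebra_simps)
    then have "unitv (2 * j + 1) = vscale d (?a j - pair \<beta> j)" using V_e[OF uV(2)] d by simp
    then have 1: "unitv (2 * j + 1) \<in> ?W" using vs.span_scale[OF vs.span_diff[OF a(1) b]] by simp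
    have "unitv (2 * j) = ?a j - vscale \<alpha> (unitv (2 * j + 1))" by (simp add: pair_def)
    then have "unitv (2 * j) \<in> ?W" using vs.span_diff[OF a(1) vs.span_scale[OF 1]] by simp
    with 1 show ?thesis by simp
  qed
  have uW': "unitv i \<in> ?W" if "i < m" for i
  proof -
    consider "i < 2 * k" "even i" | "i < 2 * k" "odd i" | "2 * k \<le> i" by linarith
    then show ?thesis
    proof cases
      case 1
      then obtain j where "i = 2 * j" "j < k" by (auto elim: evenE)
      then show ?thesis using uW by simp
    next
      case 2
      then obtain j where "i = 2 * j + 1" "j < k" by (auto elim: oddE)
      then show ?thesis using uW by blast
    next
      case 3
      then have "unitv i \<in> set ws" using that by (auto simp: ws_def)
      then show ?thesis by (intro vs.span_base) blast
    qed
  qed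
  have "V \<subseteq> ?W"
  proof
    fix v assume v: "v \<in> V"
    have "(\<Sum>i<m. vscale (v i) (unitv i)) \<in> ?W" by (intro vs.span_sum vs.span_scale uW') simp
    then show "v \<in> ?W" using V_expand[OF v] by simp
  qed
  then show ?thesis
    unfolding hsys_def
    using pE dual1 dual2 zero gs ws by (intro conjI exI[of _ gs] exI[of _ ws]) auto
qed

sublocale sesqui_space F m 1 "iso \<alpha>" "iso \<beta>" herm k \<sigma> "{..<k}" "pair \<alpha>" "\<lambda>j. vscale \<gamma> (pair \<beta> j)"
proof (intro_locales, rule sesqui_space_axioms.intro[OF m_pos])
  show "(1::univ) = 1 \<or> (1::univ) = - 1" by simp
  show "herm (vscale t x) y = \<sigma> t * herm x y" for t x y by (rule herm_scale1)
  show "herm y x = 1 * \<sigma> (herm x y)" if "x \<in> V" "y \<in> V" for x y using herm_swap[OF that] by simp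
  show "\<sigma> (- t) = - \<sigma> t" for t by (rule \<sigma>_minus)
qed (rule hsys0)

lemma emb_hermitian:
  assumes "x \<in> vecs F m" "y \<in> vecs F m"
  shows "hermitian F q m y x \<in> carrier F \<and> emb (hermitian F q m y x) = herm (vemb x) (vemb y)"
proof -
  have c: "x $ i \<in> carrier F" "y $ i \<in> carrier F" if "i < m" for i using assms that by (auto intro!: vecs_closed)
  have "emb (hermitian F q m y x) = (\<Sum>i<m. emb (y $ i) * emb (x $ i [^] q))"
    unfolding hermitian_def by (rule emb_sum_mult) (use c in auto)
  also have "\<dots> = herm (vemb x) (vemb y)"
    unfolding herm_def by (rule sum.cong) (use c in \<open>auto simp: vemb_apply emb_pow \<sigma>_def mult_ac\<close>)
  finally show ?thesis unfolding hermitian_def using c by (auto intro!: finsum_closed)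
qed

theorem unitary_identity_length:
  assumes "7 \<le> k" "mixed_identity (PSU F q m) r w" "nonsingular r w"
  shows "k < 14 ^ word_length w * (12 * (2 * word_length w + 2) ^ 3 + 1)"
proof -
  let ?I = "isometries F m (hermitian F q m)"
  interpret I: subgroup ?I GLn by (rule isometries_subgroup)
  show ?thesis
  proof (rule commutator_identity_length[OF assms(1) _ _ _ _ assms(3), where I = ?I])
    show "subgroup (SL F m \<inter> ?I) GLn"
      by (rule GL.subgroups_Inter_pair[OF SL_subgroup isometries_subgroup])
    show "mixed_identity (projective F m (SL F m \<inter> ?I)) r w" using assms(2) by (simp add: PSU_def)
    show "A \<otimes>\<^bsub>GLn\<^esub> C \<otimes>\<^bsub>GLn\<^esub> inv\<^bsub>GLn\<^esub> A \<otimes>\<^bsub>GLn\<^esub> inv\<^bsub>GLn\<^esub> C \<in> SL F m \<inter> ?I"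
      if "A \<in> ?I" "C \<in> ?I" for A C
      using commutator_SL[OF I.mem_carrier[OF that(1)] I.mem_carrier[OF that(2)]] that by simp
    show "tmat t p r \<in> ?I" if "unit_sign t" "sing p" "sing r" "herm p r = 0" for t p r
    proof -
      \<comment> \<open>The condition defining isometries ranges over all pairs of vectors, so
        exchanging the arguments of the form does not change the group.\<close>
      have "tmat t p r \<in> isometries F m (\<lambda>x y. hermitian F q m y x)"
        by (rule tmat_isometries[OF that emb_hermitian])
      then show ?thesis unfolding isometries_def by blast
    qed
  qed
qed

end

lemma PSU_identity_length:
  assumes "field (F :: nat ring)" "Coset.order F = q\<^sup>2" "primepow q" "15 \<le> n"
    "mixed_identity (PSU F q (n + 1)) r w" "nonsingular r w"
  shows "(n + 1) div 2 < 14 ^ word_length w * (12 * (2 * word_length w + 2) ^ 3 + 1)"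
proof -
  interpret unitary_space F "n + 1" q
    by (intro unitary_space.intro matrix_space.intro embedded_field.intro unitary_space_axioms.intro assms(1-3)) simp
  show ?thesis by (rule unitary_identity_length) (use assms in auto)
qed

section \<open>The bound\<close>

lemma nonsingular_length_pos: "nonsingular r w \<Longrightarrow> 1 \<le> word_length w"
  by (cases w; cases "snd w") (auto simp: nonsingular_def Defs.content_def free_prod_def word_length_def)

lemma linear_bound: "z \<le> 8 * y \<Longrightarrow> 1 \<le> y \<Longrightarrow> 2 * (12 * z + 1) \<le> 194 * y" for y z :: nat
  by simp

text \<open>\<open>21728 = 14 * 194 * 8\<close>: here 14 comes from the defect, \<open>8 ^ L\<close>
  from \<open>(L + 1) ^ 3 \<le> (2 ^ L) ^ 3\<close>, and \<open>194 = 2 * (12 * 8 + 1)\<close> from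
  the remaining constants. The outer factor 2 allows for groups with only about \<open>n / 2\<close>
  hyperbolic pairs.\<close>

lemma exponential_bound:
  assumes "1 \<le> (L :: nat)" "n \<le> 2 * (14 ^ L * (12 * (2 * L + 2) ^ 3 + 1))"
  shows "n \<le> 21728 ^ L"
proof -
  have "L + 1 \<le> 2 ^ L" by (induction L) auto
  then have "(L + 1) ^ 3 \<le> (2 ^ L) ^ 3" by (rule power_mono) simp
  also have "(2 ^ L) ^ 3 = (8 :: nat) ^ L" by (simp add: power_mult[symmetric] mult.commute[of L]) (simp add: power_mult)
  finally have 1: "(2 * L + 2) ^ 3 \<le> 8 * 8 ^ L"
    using power_mult_distrib[of 2 "L + 1" 3] by simp
  have "1 \<le> (8 :: nat) ^ L" by simp
  from 1 this have "2 * (12 * (2 * L + 2) ^ 3 + 1) \<le> 194 * 8 ^ L"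
    by (rule linear_bound)
  also have "\<dots> \<le> 194 ^ L * 8 ^ L" using assms(1) self_le_power[of 194 L] by simp
  finally have "14 ^ L * (2 * (12 * (2 * L + 2) ^ 3 + 1)) \<le> 14 ^ L * (194 ^ L * 8 ^ L)"
    by (rule mult_le_mono2)
  also have "\<dots> = 21728 ^ L" by (simp add: power_mult_distrib[symmetric])
  finally show ?thesis using assms(2) by (simp only: mult.left_commute)
qed

lemma alt_group_bound:
  assumes "mixed_identity (alt_group n) r w" "nonsingular r w"
  shows "n \<le> 21728 ^ word_length w"
proof (rule exponential_bound[OF nonsingular_length_pos[OF assms(2)]])
  let ?L = "word_length w"
  have "n < 4 ^ ?L * (12 * ?L + 9)" by (rule alt_mixed_identity_length[OF assms])
  also have "\<dots> \<le> 14 ^ ?L * (12 * (2 * ?L + 2) ^ 3 + 1)"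
  proof (rule mult_le_mono)
    have "2 * ?L + 2 \<le> (2 * ?L + 2) ^ 3" by (rule self_le_power) auto
    then have "12 * (2 * ?L + 2) + 1 \<le> 12 * (2 * ?L + 2) ^ 3 + 1" by (intro add_mono mult_le_mono2) auto
    then show "12 * ?L + 9 \<le> 12 * (2 * ?L + 2) ^ 3 + 1" by (rule order_trans[rotated]) simp
  qed (rule power_mono, auto)
  finally show "n \<le> 2 * (14 ^ ?L * (12 * (2 * ?L + 2) ^ 3 + 1))" by linarith
qed

text \<open>From \<open>n = 15\<close> on every family has at least seven hyperbolic pairs, as the
  commutator formula demands; the fewest, \<open>(n + 1) div 2\<close>, occur for the linear and
  unitary groups.\<close>

lemma classical_group_bound:
  assumes n: "15 \<le> n" and q: "primepow q" and G: "G \<in> classical_groups n q"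
    and w: "mixed_identity G r w" "nonsingular r w"
  shows "n \<le> 21728 ^ word_length w"
proof (rule exponential_bound[OF nonsingular_length_pos[OF w(2)]])
  let ?X = "14 ^ word_length w * (12 * (2 * word_length w + 2) ^ 3 + 1)"
  consider F :: "nat ring" where "field F" "G = PSL F (n + 1)"
    | F :: "nat ring" where "field F" "G = POmega_odd F n"
    | F :: "nat ring" where "field F" "G = PSp F n"
    | F :: "nat ring" where "field F" "G = POmega_plus F n"
    | F :: "nat ring" and a b c where "field F" "anisotropic F a b c" "G = POmega_minus F a b c n"
    | F :: "nat ring" where "field F" "Coset.order F = q\<^sup>2" "G = PSU F q (n + 1)"
    using G unfolding classical_groups_def by fast
  then show "n \<le> 2 * ?X"
  proof cases
    case 1
    have "(n + 1) div 2 < ?X" using PSL_identity_length[OF 1(1) n] w 1(2) by blast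
    then show ?thesis by linarith
  next
    case 2
    have "n < ?X" using POmega_odd_identity_length[OF 2(1) _ _ w(2)] n w 2(2) by simp
    then show ?thesis by linarith
  next
    case 3
    have "n < ?X" using PSp_identity_length[OF 3(1) _ _ w(2)] n w 3(2) by simp
    then show ?thesis by linarith
  next
    case 4
    have "n < ?X" using POmega_plus_identity_length[OF 4(1) _ _ w(2)] n w 4(2) by simp
    then show ?thesis by linarith
  next
    case 5
    have "n - 1 < ?X" using POmega_minus_identity_length[OF 5(1) _ 5(2) _ w(2)] n w 5(3) by simp
    then show ?thesis by linarith
  next
    case 6
    have "(n + 1) div 2 < ?X" using PSU_identity_length[OF 6(1,2) q n] w 6(3) by blast
    then show ?thesis by linarith
  qed
qed

text \<open>The bound \<open>ln n / ln 21728\<close> is stronger than the claim: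
  \<open>n \<ge> 27\<close> gives \<open>n \<ge> exp 3\<close>, so
  \<open>ln n \<ge> 3 \<ge> exp 1\<close> and \<open>ln (ln n) \<ge> 1\<close>.\<close>

lemma length_lower_bound:
  assumes n: "27 \<le> n" and le: "n \<le> 21728 ^ L"
  shows "1 / ln 21728 * (ln (real n) / ln (ln (real n))) \<le> real L"
proof -
  have "real n \<le> 21728 ^ L" using of_nat_mono[OF le, where 'a = real] by simp
  then have "ln (real n) \<le> ln (21728 ^ L)" using n by (subst ln_le_cancel_iff) simp_all
  then have L: "ln (real n) \<le> real L * ln 21728" by (simp add: ln_realpow)
  have exp1: "exp 1 \<le> (3 :: real)" by (rule exp_le)
  have "exp (3 :: real) = exp 1 ^ 3" using exp_of_nat_mult[of 3 "1 :: real"] by simp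
  also have "\<dots> \<le> 3 ^ 3" using exp1 by (intro power_mono) auto
  also have "\<dots> \<le> real n" using n by simp
  finally have "3 \<le> ln (real n)" using n by (simp add: ln_ge_iff)
  then have e: "exp 1 \<le> ln (real n)" using exp1 by linarith
  then have pos: "0 < ln (real n)" using exp_gt_zero[of "1::real"] by linarith
  have "1 \<le> ln (ln (real n))" using e pos by (simp add: ln_ge_iff)
  moreover have "x / y \<le> x" if "0 < x" "1 \<le> y" for x y :: real
    using divide_left_mono[of 1 y x] that by simp
  ultimately have "ln (real n) / ln (ln (real n)) \<le> ln (real n)" using pos by blast
  then have "ln (real n) / ln (ln (real n)) \<le> real L * ln 21728" using L by simp
  moreover have "1 / c * x \<le> l" if "x \<le> l * c" "0 < c" for c x l :: real
    using that by (simp add: divide_le_eq)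
  moreover have "0 < ln (21728 :: real)" by simp
  ultimately show ?thesis by blast
qed

theorem theorem6:
  shows "\<exists>c::real. c > 0 \<and> (\<exists>N::nat. \<forall>n\<ge>N.
    (\<forall>r\<ge>1. \<forall>w. mixed_identity (alt_group n) r w \<and> nonsingular r w \<longrightarrow>
        real (word_length w) \<ge> c * (ln (real n) / ln (ln (real n)))) \<and>
    (\<forall>q. primepow q \<longrightarrow> (\<forall>G \<in> classical_groups n q.
      \<forall>r\<ge>1. \<forall>w. mixed_identity G r w \<and> nonsingular r w \<longrightarrow>
        real (word_length w) \<ge> c * (ln (real n) / ln (ln (real n))))))"
proof (intro exI conjI allI impI ballI)
  show "0 < 1 / ln (21728 :: real)" by simp
  fix n :: nat assume n: "27 \<le> n"
  show "1 / ln 21728 * (ln (real n) / ln (ln (real n))) \<le> real (word_length w)"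
    if "mixed_identity (alt_group n) r w \<and> nonsingular r w" for r w
    using length_lower_bound[OF n alt_group_bound] that by blast
  show "1 / ln 21728 * (ln (real n) / ln (ln (real n))) \<le> real (word_length w)"
    if "primepow q" "G \<in> classical_groups n q" "mixed_identity G r w \<and> nonsingular r w" for q G r w
    using length_lower_bound[OF n classical_group_bound[of n q G r w]] that n by simp
qed

end
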